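(* With the notation of the context, the following hold. (i) For every prime $p\ge 11$, $$A_{p-1}\equiv -3p \pmod{p^2},\qquad C_{p-1}\equiv -\frac{2p}{21}B_{p-3}\pmod{p^2},$$ and also $$\mathcal E_p\equiv \tfrac14 B_{p-3}\pmod{1-q_p}.$$ In particular, in the ring $\mathcal A$, $$\bigl(\mathcal E_p \bmod (1-q_p)\bigr)_p=\frac{63}{8}\left(\frac{C_{p-1}}{A_{p-1}}\right)_p=\frac34 Z(3).$$ (ii) Regarding $\mathcal E_N$ as a complex number, $$\lim_{\substack{N\to\infty\\ N\ \mathrm{odd}}}\mathcal E_N=\frac34\zeta(3).$$
   Context: The sequences of rational numbers $A=(A_n)_{n\ge0}$ and $C=(C_n)_{n\ge0}$ are the solutions of $$4n^2(16n^2-1)u_{n-1}-(65n^4+130n^3+105n^2+40n+6)u_n+(n+1)^4u_{n+1}=0\qquad(n\ge1)$$ with initial values $(A_0,A_1)=(1,6)$ and $(C_0,C_1)=(0,1)$. $B_n$ denotes the $n$-th Bernoulli number, $\frac{t}{e^t-1}=\sum_{n\ge0}B_n\frac{t^n}{n!}$. Put $[n]_q=\frac{1-q^n}{1-q}=1+q+\dots+q^{n-1}$ and $$E_m(q)=\sum_{n=1}^m\frac{(-1)^{n-1}q^{2n}}{[n]_q^3}.$$ For odd $N\ge5$ put $q_N=e^{2\pi i/N}$ and $\mathcal E_N=E_{(N-1)/2}(q_N)$. Congruences of rational numbers modulo $p$ or $p^2$ are taken in the localization $\mathbb Z_{(p)}$ (denominators prime to $p$). For a prime $p$, congruences modulo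 $1-q_p$ are taken in the local ring $\mathbb Z[q_p]_{(1-q_p)}$, whose residue field is identified with $\mathbb Z/p\mathbb Z$. $\mathcal A=\bigl(\prod_{p}\mathbb Z/p\mathbb Z\bigr)/\bigl(\bigoplus_{p}\mathbb Z/p\mathbb Z\bigr)$, with $p$ running over all primes; two families are identified if they agree at all but finitely many primes, so a family needs to be specified only for all sufficiently large $p$. The symbol $(C_{p-1}/A_{p-1})_p$ denotes the class of the residues modulo $p$ of the rational numbers $C_{p-1}/A_{p-1}$ (which are $p$-integral for large $p$). Finally $Z(3)=\bigl(\frac{B_{p-3}}{3}\bmod p\bigr)_p\in\mathcal A$. *)

theory Defs
  imports
    "HOL-Analysis.Analysis"
    "HOL-Computational_Algebra.Computational_Algebra"
    "HOL-Number_Theory.Number_Theory"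
    "HOL-Algebra.QuotRing"
begin

section \<open>The recurrence\<close>

definition solves_recurrence :: "(nat \<Rightarrow> rat) \<Rightarrow> bool" where
  "solves_recurrence u \<longleftrightarrow> (\<forall>n\<ge>1.
     4 * of_nat n ^ 2 * (16 * of_nat n ^ 2 - 1) * u (n - 1)
     - (65 * of_nat n ^ 4 + 130 * of_nat n ^ 3 + 105 * of_nat n ^ 2 + 40 * of_nat n + 6) * u n
     + (of_nat n + 1) ^ 4 * u (n + 1) = 0)"


section \<open>Bernoulli numbers and zeta values\<close>

definition bernoulli :: "nat \<Rightarrow> rat" where
  "bernoulli n = fact n * fps_nth (fps_X / (fps_exp 1 - 1)) n"

lemma bernoulli_generating_function:
  "fps_X = Abs_fps (\<lambda>n. bernoulli n / fact n) * (fps_exp 1 - 1)"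
proof -
  let ?e = "fps_exp 1 - 1 :: rat fps"
  have nz: "?e $ 1 \<noteq> 0" by simp
  hence "?e \<noteq> 0" by auto
  moreover have "subdegree ?e \<le> 1" using nz by (rule subdegree_leI)
  ultimately have "?e dvd fps_X" by (subst fps_dvd_iff) auto
  moreover have "Abs_fps (\<lambda>n. bernoulli n / fact n) = fps_X / ?e"
    by (rule fps_ext) (simp add: bernoulli_def)
  ultimately show ?thesis by simp
qed

text \<open>Intended for integers \<open>s \<ge> 2\<close>.\<close>

definition zeta :: "nat \<Rightarrow> real" where
  "zeta s = (\<Sum>n. 1 / real (Suc n) ^ s)"


section \<open>The truncated $q$-series\<close>

definition qint :: "nat \<Rightarrow> complex \<Rightarrow> complex" where
  "qint n q = (\<Sum>k<n. q ^ k)"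

lemma qint_closed_form: "q \<noteq> 1 \<Longrightarrow> qint n q = (1 - q ^ n) / (1 - q)"
  by (simp add: qint_def sum_gp_strict)

definition Eq :: "nat \<Rightarrow> complex \<Rightarrow> complex" where
  "Eq m q = (\<Sum>n=1..m. (-1) ^ (n - 1) * q ^ (2 * n) / qint n q ^ 3)"

definition unity_root :: "nat \<Rightarrow> complex" where
  "unity_root N = exp (2 * of_real pi * \<i> / of_nat N)"

definition EN :: "nat \<Rightarrow> complex" where
  "EN N = Eq ((N - 1) div 2) (unity_root N)"


section \<open>Localizations and congruences\<close>

text \<open>For a subring \<open>S\<close> of a field and an element \<open>m\<close> of \<open>S\<close> generating a prime ideal of \<open>S\<close>,
  this is the localization of \<open>S\<close> at \<open>m S\<close>, realized inside the field.\<close>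

definition localization :: "'a::field set \<Rightarrow> 'a \<Rightarrow> 'a set" where
  "localization S m = {a / b | a b. a \<in> S \<and> b \<in> S \<and> b \<notin> {m * s | s. s \<in> S}}"

definition cong_in :: "'a::field set \<Rightarrow> 'a \<Rightarrow> 'a \<Rightarrow> 'a \<Rightarrow> bool" where
  "cong_in R m a b \<longleftrightarrow> a \<in> R \<and> b \<in> R \<and> (\<exists>c\<in>R. a - b = m * c)"

text \<open>\<open>\<int>\<^sub>(\<^sub>p\<^sub>)\<close> as a subring of \<open>\<rat>\<close>.\<close>

definition Zloc :: "nat \<Rightarrow> rat set" where
  "Zloc p = localization \<int> (of_nat p)"

text \<open>\<open>\<int>[q]\<close> for a complex number \<open>q\<close>, and its localization at \<open>1 - q\<close> for \<open>q = q\<^sub>p\<close>.\<close>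

definition Zadjoin :: "complex \<Rightarrow> complex set" where
  "Zadjoin q = range (\<lambda>f::int poly. poly (map_poly of_int f) q)"

definition cycloc :: "nat \<Rightarrow> complex set" where
  "cycloc p = localization (Zadjoin (unity_root p)) (1 - unity_root p)"

text \<open>Reductions modulo the maximal ideal, with values in \<open>{0..<p} = \<int>/p\<int>\<close>. Both residue fields
  are identified with \<open>\<int>/p\<int>\<close> by the only possible ring isomorphism, the one sending the class of
  an integer \<open>k\<close> to \<open>k\<close>. The values are unspecified outside the local rings.\<close>

definition res_rat :: "nat \<Rightarrow> rat \<Rightarrow> int" where
  "res_rat p x = (THE k. k \<in> {0..<int p} \<and> cong_in (Zloc p) (of_nat p) x (of_int k))"

definition res_cyc :: "nat \<Rightarrow> complex \<Rightarrow> int" where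
  "res_cyc p x = (THE k. k \<in> {0..<int p} \<and> cong_in (cycloc p) (1 - unity_root p) x (of_int k))"


section \<open>The ring \<open>\<A>\<close>\<close>

definition prod_Zp :: "(nat \<Rightarrow> int) ring" where
  "prod_Zp =
    \<lparr>carrier = (\<Pi>\<^sub>E p\<in>{p. prime p}. carrier (residue_ring (int p))),
     monoid.mult = (\<lambda>f g. \<lambda>p\<in>{p. prime p}. f p \<otimes>\<^bsub>residue_ring (int p)\<^esub> g p),
     one = (\<lambda>p\<in>{p. prime p}. \<one>\<^bsub>residue_ring (int p)\<^esub>),
     zero = (\<lambda>p\<in>{p. prime p}. \<zero>\<^bsub>residue_ring (int p)\<^esub>),
     add = (\<lambda>f g. \<lambda>p\<in>{p. prime p}. f p \<oplus>\<^bsub>residue_ring (int p)\<^esub> g p)\<rparr>"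

definition sum_Zp :: "(nat \<Rightarrow> int) set" where
  "sum_Zp = {f \<in> carrier prod_Zp. finite {p. prime p \<and> f p \<noteq> \<zero>\<^bsub>residue_ring (int p)\<^esub>}}"

definition ringA :: "(nat \<Rightarrow> int) set ring" where
  "ringA = prod_Zp Quot sum_Zp"

text \<open>The class of a family of integers, the \<open>p\<close>-th one being read modulo \<open>p\<close>.\<close>

definition classA :: "(nat \<Rightarrow> int) \<Rightarrow> (nat \<Rightarrow> int) set" where
  "classA f = sum_Zp +>\<^bsub>prod_Zp\<^esub> (\<lambda>p\<in>{p. prime p}. f p mod int p)"

text \<open>The class of a family of rationals that are \<open>p\<close>-integral for all large \<open>p\<close>.\<close>

definition class_rat :: "(nat \<Rightarrow> rat) \<Rightarrow> (nat \<Rightarrow> int) set" where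
  "class_rat x = classA (\<lambda>p. res_rat p (x p))"

text \<open>\<open>\<A>\<close> is a \<open>\<rat>\<close>-algebra: \<open>c\<close> acts as multiplication by the class of \<open>(c mod p)\<^sub>p\<close>.\<close>

definition scaleA :: "rat \<Rightarrow> (nat \<Rightarrow> int) set \<Rightarrow> (nat \<Rightarrow> int) set" where
  "scaleA c x = class_rat (\<lambda>_. c) \<otimes>\<^bsub>ringA\<^esub> x"

definition Z3 :: "(nat \<Rightarrow> int) set" where
  "Z3 = class_rat (\<lambda>p. bernoulli (p - 3) / 3)"

lemma residue_ring_cring: "prime p \<Longrightarrow> cring (residue_ring (int p))"
  using prime_gt_1_nat[of p] by (intro residues.cring) (simp add: residues_def)

lemma cring_prod_Zp: "cring prod_Zp"
proof (intro cringI abelian_groupI comm_monoidI)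
  fix x assume x: "x \<in> carrier prod_Zp"
  show "\<exists>y\<in>carrier prod_Zp. y \<oplus>\<^bsub>prod_Zp\<^esub> x = \<zero>\<^bsub>prod_Zp\<^esub>"
    using x residue_ring_cring
    by (intro bexI[of _ "\<lambda>p\<in>{p. prime p}. \<ominus>\<^bsub>residue_ring (int p)\<^esub> x p"])
       (auto simp: prod_Zp_def PiE_iff cring_def intro!: restrict_ext ring.ring_simprules)
qed (auto simp: prod_Zp_def PiE_iff extensional_def fun_eq_iff
       intro!: residue_ring_cring[THEN cring.cring_simprules(1)]
         residue_ring_cring[THEN cring.cring_simprules(2)]
         residue_ring_cring[THEN cring.cring_simprules(5)]
         residue_ring_cring[THEN cring.cring_simprules(6)]
         residue_ring_cring[THEN cring.cring_simprules(7)]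
         residue_ring_cring[THEN cring.cring_simprules(8)]
         residue_ring_cring[THEN cring.cring_simprules(10)]
         residue_ring_cring[THEN cring.cring_simprules(11)]
         residue_ring_cring[THEN cring.cring_simprules(12)]
         residue_ring_cring[THEN cring.cring_simprules(13)]
         residue_ring_cring[THEN cring.cring_simprules(14)])

lemma ideal_sum_Zp: "ideal sum_Zp prod_Zp"
proof -
  interpret P: cring prod_Zp by (rule cring_prod_Zp)
  have zero: "\<zero>\<^bsub>prod_Zp\<^esub> \<in> sum_Zp"
    by (simp add: sum_Zp_def) (simp add: prod_Zp_def)
  have add: "f \<oplus>\<^bsub>prod_Zp\<^esub> g \<in> sum_Zp" if "f \<in> sum_Zp" "g \<in> sum_Zp" for f g
  proof -
    have "{p. prime p \<and> (f \<oplus>\<^bsub>prod_Zp\<^esub> g) p \<noteq> \<zero>\<^bsub>residue_ring (int p)\<^esub>}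
      \<subseteq> {p. prime p \<and> f p \<noteq> \<zero>\<^bsub>residue_ring (int p)\<^esub>}
        \<union> {p. prime p \<and> g p \<noteq> \<zero>\<^bsub>residue_ring (int p)\<^esub>}"
      by (auto simp: prod_Zp_def residue_ring_def)
    then show ?thesis using that by (auto simp: sum_Zp_def intro: finite_subset)
  qed
  have mult: "r \<otimes>\<^bsub>prod_Zp\<^esub> f \<in> sum_Zp" if "f \<in> sum_Zp" "r \<in> carrier prod_Zp" for f r
  proof -
    have "{p. prime p \<and> (r \<otimes>\<^bsub>prod_Zp\<^esub> f) p \<noteq> \<zero>\<^bsub>residue_ring (int p)\<^esub>}
      \<subseteq> {p. prime p \<and> f p \<noteq> \<zero>\<^bsub>residue_ring (int p)\<^esub>}"
      by (auto simp: prod_Zp_def residue_ring_def)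
    then show ?thesis using that by (auto simp: sum_Zp_def intro: finite_subset)
  qed
  have sub: "sum_Zp \<subseteq> carrier prod_Zp" by (auto simp: sum_Zp_def)
  have minus: "\<ominus>\<^bsub>prod_Zp\<^esub> f \<in> sum_Zp" if f: "f \<in> sum_Zp" for f
  proof -
    have "\<ominus>\<^bsub>prod_Zp\<^esub> f = (\<ominus>\<^bsub>prod_Zp\<^esub> \<one>\<^bsub>prod_Zp\<^esub>) \<otimes>\<^bsub>prod_Zp\<^esub> f"
      using f sub by (simp add: P.l_minus subset_iff)
    then show ?thesis using mult[OF f] by simp
  qed
  show ?thesis
  proof (rule idealI[OF P.ring_axioms])
    show "subgroup sum_Zp (add_monoid prod_Zp)"
      by (rule P.add.subgroupI) (use zero add minus sub in \<open>auto simp: a_inv_def\<close>)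
    fix f r assume f: "f \<in> sum_Zp" and r: "r \<in> carrier prod_Zp"
    show "r \<otimes>\<^bsub>prod_Zp\<^esub> f \<in> sum_Zp" by (rule mult[OF f r])
    then show "f \<otimes>\<^bsub>prod_Zp\<^esub> r \<in> sum_Zp"
      using f r sub by (simp add: P.m_comm subset_iff)
  qed
qed

lemma cring_ringA: "cring ringA"
  unfolding ringA_def by (rule ideal.quotient_is_cring[OF ideal_sum_Zp cring_prod_Zp])

end

(*
  Both sequences have explicit double sums. Let f_n(x,y) be
  n!^4 prod_{m<=2n} (x+y-m) / (prod_{j<=n} (x-j)(y-j))^3. The recurrence operator maps f_n to a
  difference in x plus a difference in y, so linear functionals of the Laurent coefficients of f_n at
  the points (i,k), summed over i and k, satisfy the recurrence. One functional gives A_n as the sum of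
  n!^4 (i+k)! (2n-i-k)! / (i! k! (n-i)! (n-k)!)^3; another one, with harmonic weights, gives 21 C_n.

  For n = p-1 the terms off the antidiagonal i+k = p-1 are divisible by p, and those on it are sixth
  powers of binomial coefficients, so both sums can be evaluated modulo p^2. What remains are harmonic
  sums, which Faulhaber's formula reduces to B_{p-3}.

  In Z[q_p], an element f(q_p) is divisible by 1-q_p exactly if p divides f(1): when f(q_p) = 0, the sum
  of prod_{0<i<p} f(x^i) over the p-th roots of unity x is f(1)^(p-1), and it is divisible by p. Hence
  E(q_p) reduces to an alternating harmonic sum. The complex limit follows from Tannery's theorem, as
  |[n]_q| is at least n/4 in the range of summation.
*)

theory Submission
  imports Defs
begin

section \<open>The certificate of the recurrence\<close>

text \<open>Telescoping alone handles constant weights, as for \<open>A\<close>. For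
  \<open>C\<close> the weights must vary with i, and summation by parts leaves sums of residues of
  the x-certificate divided by x and by x^2. The degrees leave no residue at infinity, so only the
  pole at x = 0 remains, and there the two contributions agree because of a first-order symmetry of
  the certificate.

  The factor x + y - i - k of f_n vanishes at (i,k), so the cofactor is read off one order higher.
  Subtracting residue sums in y, which are zero, leaves only antisymmetric combinations of its
  derivatives. Thus the second logarithmic derivative of the numerator drops out, and with it
  harmonic sums with p^2 in the denominator; the remaining 1/p is multiplied by a difference of
  harmonic numbers that is divisible by p.

  The constant 21 is, up to sign, the value of the functional at n = 1. Modulo p^2 the decisive
  value is that of H_2(p-1), obtained by evaluating an alternating binomial sum in two ways.\<close>

text \<open>With \<open>f\<^sub>n(x, y) = n!\<^sup>4 \<Prod>m\<le>2n. (x + y - m) / (\<Prod>j\<le>n. (x - j) (y - j))\<^sup>3\<close>, the recurrence operator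
  applied to \<open>f\<^sub>n\<close> is a difference in \<open>x\<close> plus a difference in \<open>y\<close>. The numerators are \<open>cert n z w\<close> and
  \<open>cert n w z\<close> with \<open>z = n + 1 - x\<close> and \<open>w = n + 1 - y\<close>; the coefficients solve a linear system obtained
  by comparing coefficients.\<close>

definition cert0 :: "'a::comm_ring_1 \<Rightarrow> 'a \<Rightarrow> 'a" where
  "cert0 n w =
     (- 4*n^8 - 24*n^7 - 60*n^6 - 80*n^5 - 60*n^4 - 24*n^3 - 4*n^2)*w
   + (6*n^8 + 38*n^7 + 100*n^6 + 140*n^5 + 110*n^4 + 46*n^3 + 8*n^2)*w^2
   + (- 2*n^8 - 15*n^7 - 45*n^6 - 70*n^5 - 60*n^4 - 27*n^3 - 5*n^2)*w^3
   + (n^7 + 5*n^6 + 10*n^5 + 10*n^4 + 5*n^3 + n^2)*w^4"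

definition cert1 :: "'a::comm_ring_1 \<Rightarrow> 'a \<Rightarrow> 'a" where
  "cert1 n w =
     (6*n^8 + 26*n^7 + 40*n^6 + 20*n^5 - 10*n^4 - 14*n^3 - 4*n^2)*w
   + (- 4*n^8 - 2*n^7 + 38*n^6 + 92*n^5 + 88*n^4 + 38*n^3 + 6*n^2)*w^2
   + (- 8*n^7 - 44*n^6 - 80*n^5 - 56*n^4 - 8*n^3 + 4*n^2)*w^3
   + (5*n^6 + 17*n^5 + 16*n^4 + n^3 - 3*n^2)*w^4"

definition cert2 :: "'a::comm_ring_1 \<Rightarrow> 'a \<Rightarrow> 'a" where
  "cert2 n w =
     (- 2*n^8 - 7*n^7 - 5*n^6 + 10*n^5 + 20*n^4 + 13*n^3 + 3*n^2)*w
   + (- 9*n^7 + 3*n^6 + 60*n^5 + 72*n^4 + 21*n^3 - 3*n^2)*w^2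
   + (- 16*n^6 + 8*n^5 + 31*n^4 + 16*n^3 + 9*n^2)*w^3
   + (- 42*n^5 - 111*n^4 - 54*n^3 - 6*n^2)*w^4
   + (21*n^4 + 21*n^3)*w^5"

definition cert3 :: "'a::comm_ring_1 \<Rightarrow> 'a \<Rightarrow> 'a" where
  "cert3 n w =
     (- 21*n^6 - 63*n^5 - 63*n^4 - 21*n^3)*w^2
   + (- 22*n^5 + 11*n^4 + 22*n^3 + 8*n^2 + 14*n + 4)*w^3
   + (n^4 + 10*n^3 + 3*n^2 - 39*n - 12)*w^4
   + (- 40*n^3 - 37*n^2 + 36*n + 12)*w^5
   + (20*n^2 - 11*n - 4)*w^6"

definition cert4 :: "'a::comm_ring_1 \<Rightarrow> 'a \<Rightarrow> 'a" where
  "cert4 n w =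
     (- 20*n^4 - 49*n^3 - 23*n^2 - 19*n - 4)*w^3
   + (44*n^3 + 35*n^2 + 54*n + 12)*w^4
   + (- 12*n^2 - 51*n - 12)*w^5
   + (16*n + 4)*w^6"

definition cert :: "'a::comm_ring_1 \<Rightarrow> 'a \<Rightarrow> 'a \<Rightarrow> 'a" where
  "cert n z w = cert0 n w + cert1 n w * z + cert2 n w * z^2 + cert3 n w * z^3 + cert4 n w * z^4"

lemmas cert_defs = cert_def cert0_def cert1_def cert2_def cert3_def cert4_def

text \<open>The recurrence at f_(n-1), f_n, f_(n+1), multiplied by n^2 and freed of n!^4, of the
  factors x + y - m with 1 <= m <= 2n - 2 and of the cubed denominators up to n + 1. The extra n^2
  turns the first coefficient into 4 n^4 (16 n^2 - 1), and n^4 absorbs the quotient of n!^4 and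
  (n-1)!^4.\<close>

lemma cert_identity:
  fixes n x y :: "'a::idom"
  defines "s \<equiv> x + y" and "z \<equiv> n + 1 - x" and "w \<equiv> n + 1 - y"
  shows "s * (4*(16*n^2-1) * (z*(n-x)*w*(n-y))^3
     - n^2*(65*n^4+130*n^3+105*n^2+40*n+6) * ((2*n-s)*(2*n-1-s)*(z*w)^3)
     + n^2*(n+1)^8 * ((2*n+2-s)*(2*n+1-s)*(2*n-s)*(2*n-1-s)))
   = s*z^3 * cert n (z - 1) w - x^3*(2*n-1-s) * cert n z w
   + s*w^3 * cert n (w - 1) z - y^3*(2*n-1-s) * cert n w z"
  unfolding s_def z_def w_def cert_defs
  by Groebner_Basis.algebra

section \<open>Sums of residues of rational functions\<close>

text \<open>The residue at \<open>u\<close> of \<open>x\<^sup>d / \<Prod>v\<in>#V. (x - v)\<close>.\<close>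

definition res_at :: "nat \<Rightarrow> rat multiset \<Rightarrow> rat \<Rightarrow> rat" where
  "res_at d V u = fls_nth ((fls_const u + fls_X) ^ d * (\<Prod>v\<in>#V. inverse (fls_const (u - v) + fls_X))) (-1)"

lemma lin_ne_0 [simp]: "fls_const (c::rat) + fls_X \<noteq> 0"
proof
  assume "fls_const c + fls_X = 0"
  then have "fls_nth (fls_const c + fls_X) 1 = 0" by simp
  then show False by simp
qed

lemma res_at_not_node:
  assumes "u \<notin># V"
  shows "res_at d V u = 0"
proof -
  have lin: "fls_subdegree (fls_const c + fls_X) \<ge> 0" for c :: rat
    by (rule fls_subdegree_geI) auto
  have sd: "fls_subdegree (fls_const c + fls_X) = 0" if "c \<noteq> 0" for c :: rat
    using that by (intro fls_subdegree_eqI) auto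
  have "fls_subdegree (\<Prod>v\<in>#W. inverse (fls_const (u - v) + fls_X)) = 0" if "u \<notin># W" for W
    using that
  proof (induction W)
    case (add v W)
    then have "u - v \<noteq> 0" by auto
    moreover have "(\<Prod>v\<in>#W. inverse (fls_const (u - v) + fls_X)) \<noteq> 0"
      by (auto simp: prod_mset_zero_iff)
    ultimately show ?case using add
      by (simp add: sd fls_inverse_subdegree)
  qed auto
  from this[OF assms] have "0 \<le> fls_subdegree ((fls_const u + fls_X) ^ d * (\<Prod>v\<in>#V. inverse (fls_const (u - v) + fls_X)))"
    using lin[of u] by (subst fls_subdegree_mult) (auto simp: prod_mset_zero_iff fls_subdegree_pow)
  then show ?thesis unfolding res_at_def by (intro fls_eq0_below_subdegree) auto
qed

text \<open>From x = (x - v) + v; this lowers the degree of the numerator by one.\<close>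

lemma res_at_Suc:
  "res_at (Suc d) (add_mset v V) u = res_at d V u + v * res_at d (add_mset v V) u"
proof -
  let ?L = "\<lambda>c. fls_const c + fls_X :: rat fls"
  let ?P = "\<Prod>w\<in>#V. inverse (?L (u - w))"
  have "?L u ^ Suc d * (inverse (?L (u - v)) * ?P) =
      ?L u ^ d * ?P * ((?L (u - v) + fls_const v) * inverse (?L (u - v)))"
    by (simp add: fls_plus_const algebra_simps)
  also have "(?L (u - v) + fls_const v) * inverse (?L (u - v)) = 1 + fls_const v * inverse (?L (u - v))"
    by (subst distrib_right, subst right_inverse) simp_all
  finally have "?L u ^ Suc d * (inverse (?L (u - v)) * ?P) =
     ?L u ^ d * ?P + fls_const v * (?L u ^ d * (inverse (?L (u - v)) * ?P))"
    by (simp add: algebra_simps)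
  then show ?thesis unfolding res_at_def by simp
qed

lemma res_at_split:
  assumes "v \<noteq> w"
  shows "res_at 0 (add_mset v (add_mset w V)) u
       = (res_at 0 (add_mset v V) u - res_at 0 (add_mset w V) u) / (v - w)"
proof -
  let ?L = "\<lambda>c. fls_const c + fls_X :: rat fls"
  let ?P = "\<Prod>x\<in>#V. inverse (?L (u - x))"
  have ne: "fls_const (v - w) \<noteq> 0" using assms by simp
  have "inverse (?L (u - v)) - inverse (?L (u - w)) = fls_const (v - w) * (inverse (?L (u - v)) * inverse (?L (u - w)))"
  proof -
    have "?L (u - w) - ?L (u - v) = fls_const (v - w)" by (simp add: fls_minus_const)
    moreover have "inverse A - inverse B = (B - A) * (inverse A * inverse B)" if "A \<noteq> 0" "B \<noteq> 0" for A B :: "rat fls"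
      using that by (simp add: field_simps)
    ultimately show ?thesis by simp
  qed
  then have "fls_const (v - w) * (inverse (?L (u - v)) * (inverse (?L (u - w)) * ?P)) =
     inverse (?L (u - v)) * ?P - inverse (?L (u - w)) * ?P"
    by (metis (no_types, lifting) left_diff_distrib mult.assoc)
  from this[THEN arg_cong, of "\<lambda>f. fls_nth f (-1)"]
  have "(v - w) * res_at 0 (add_mset v (add_mset w V)) u = res_at 0 (add_mset v V) u - res_at 0 (add_mset w V) u"
    unfolding res_at_def by simp
  then show ?thesis using assms by (simp add: field_simps)
qed

lemma sum_res_at_singleton:
  assumes "finite S" "v \<in> S"
  shows "(\<Sum>u\<in>S. res_at 0 {#v#} u) = 1"
proof -
  have "res_at 0 {#v#} v = 1"
    by (simp add: res_at_def fls_inverse_X)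
  moreover have "(\<Sum>u\<in>S. res_at 0 {#v#} u) = (\<Sum>u\<in>{v}. res_at 0 {#v#} u)"
    using assms by (intro sum.mono_neutral_right) (auto intro!: res_at_not_node)
  ultimately show ?thesis by simp
qed

text \<open>Partial fractions at two distinct nodes lead to multisets that are smaller by one;
  splitting ends with a pure power (x - v)^(-k), k >= 2, which has no residue. If only two factors
  are left, both fractions have residue sum 1 and cancel.\<close>

lemma sum_res_at_const:
  assumes "finite S" "set_mset V \<subseteq> S" "size V \<ge> 2"
  shows "(\<Sum>u\<in>S. res_at 0 V u) = 0"
  using assms(2,3)
proof (induction "size V" arbitrary: V rule: less_induct)
  case less
  show ?case
  proof (cases "\<exists>v w W. v \<noteq> w \<and> V = add_mset v (add_mset w W)")
    case True
    then obtain v w W where vw: "v \<noteq> w" and V: "V = add_mset v (add_mset w W)" by blast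
    have "(\<Sum>u\<in>S. res_at 0 (add_mset v W) u) = (\<Sum>u\<in>S. res_at 0 (add_mset w W) u)"
    proof (cases "W = {#}")
      case True
      then show ?thesis using less.prems V assms(1) by (simp add: sum_res_at_singleton)
    next
      case False
      then have "size W \<ge> 1" by (cases W) auto
      then show ?thesis using less.hyps[of "add_mset v W"] less.hyps[of "add_mset w W"] less.prems V by auto
    qed
    then show ?thesis unfolding V res_at_split[OF vw] by (simp add: sum_subtractf flip: sum_divide_distrib)
  next
    case False
    obtain v W where V: "V = add_mset v W" using less.prems(2) by (cases V) auto
    have "w = v" if "w \<in># W" for w
      using that False V by (metis insert_DiffM)
    then have "W = replicate_mset (size W) v"
      by (metis set_mset_subset_singletonD singleton_iff subsetI)
    then obtain k where W: "W = replicate_mset (Suc k) v"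
      using less.prems(2) V by (cases "size W") auto
    have "res_at 0 V u = 0" for u
    proof (cases "u = v")
      case True
      have "(\<Prod>v\<in>#V. inverse (fls_const (u - v) + fls_X)) = fls_X_inv ^ Suc (Suc k)"
        unfolding V W using True by (simp add: fls_inverse_X)
      then show ?thesis by (simp add: res_at_def fls_X_inv_power_conv_shift_1 del: power_Suc)
    next
      case False
      then show ?thesis unfolding V W by (intro res_at_not_node) auto
    qed
    then show ?thesis by simp
  qed
qed

text \<open>The residue theorem for rational functions; the condition on \<open>d\<close> says that
  there is no residue at infinity.\<close>

theorem sum_res_at:
  assumes "finite S" "set_mset V \<subseteq> S" "d + 2 \<le> size V"
  shows "(\<Sum>u\<in>S. res_at d V u) = 0"
  using assms(2,3)
proof (induction d arbitrary: V)
  case 0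
  then show ?case using assms(1) by (intro sum_res_at_const) auto
next
  case (Suc d)
  then obtain v W where V: "V = add_mset v W" by (cases V) auto
  have "(\<Sum>u\<in>S. res_at d W u) = 0" "(\<Sum>u\<in>S. res_at d V u) = 0"
    using Suc V by (intro Suc.IH; simp)+
  then show ?case unfolding V res_at_Suc by (simp add: sum.distrib flip: sum_distrib_left)
qed

section \<open>Local expansions\<close>

text \<open>Functions of \<open>x = i + a\<close> and \<open>y = k + b\<close> are expanded as series in the outer variable \<open>a\<close> with
  coefficients that are series in the inner variable \<open>b\<close>.\<close>

definition lift :: "rat fps \<Rightarrow> rat fps fps" where
  "lift U = Abs_fps (\<lambda>m. fps_const (U $ m))"

definition cf :: "nat \<Rightarrow> nat \<Rightarrow> rat fps fps \<Rightarrow> rat" where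
  "cf u v F = F $ u $ v"

lemma lift_nth [simp]: "lift U $ m = fps_const (U $ m)"
  by (simp add: lift_def)

lemma lift_add: "lift (U + V) = lift U + lift V"
  by (simp add: fps_eq_iff)

lemma lift_mult: "lift (U * V) = lift U * lift V"
  by (simp add: fps_eq_iff fps_mult_nth fps_sum_nth if_distrib cong: if_cong)

lemma lift_const: "lift (fps_const c) = fps_const (fps_const c)"
  by (simp add: fps_eq_iff)

lemma lift_X: "lift fps_X = fps_X"
  by (auto simp: fps_eq_iff fps_X_def)

lemma lift_1 [simp]: "lift 1 = 1"
  by (auto simp: fps_eq_iff)

lemma lift_power: "lift (U ^ k) = lift U ^ k"
  by (induction k) (simp_all add: lift_mult)

lemma cf_add [simp]: "cf u v (F + G) = cf u v F + cf u v G"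
  and cf_diff [simp]: "cf u v (F - G) = cf u v F - cf u v G"
  and cf_uminus [simp]: "cf u v (- F) = - cf u v F"
  and cf_sum: "cf u v (sum f A) = (\<Sum>a\<in>A. cf u v (f a))"
  by (simp_all add: cf_def fps_sum_nth)

lemma cf_lift_const [simp]: "cf u v (fps_const q * lift S) = S $ u * q $ v"
  by (simp add: cf_def)

lemma cf_scalar: "cf u v (fps_const (fps_const c) * F) = c * cf u v F"
  by (simp add: cf_def)

lemma cf_lift_X3: "u < 3 \<Longrightarrow> cf u v (F * lift (fps_X ^ 3 * S)) = 0"
proof -
  assume "u < 3"
  have "F * lift (fps_X ^ 3 * S) = fps_X ^ 3 * (F * lift S)"
    by (simp add: lift_mult lift_power lift_X mult_ac)
  with \<open>u < 3\<close> show ?thesis unfolding cf_def by (simp only: fps_X_power_mult_nth) simp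
qed

lemma cf_const_X3: "v < 3 \<Longrightarrow> cf u v (F * fps_const (fps_X ^ 3 * S)) = 0"
proof -
  assume "v < 3"
  have "cf u v (F * fps_const (fps_X ^ 3 * S)) = (fps_X ^ 3 * (F $ u * S)) $ v"
    by (simp add: cf_def mult_ac)
  with \<open>v < 3\<close> show ?thesis by (simp only: fps_X_power_mult_nth) simp
qed

abbreviation lin :: "rat \<Rightarrow> rat fps" where
  "lin c \<equiv> fps_const c + fps_X"

text \<open>The expansion at \<open>x = i\<close> of \<open>(x - i)\<^sup>3 / (\<Prod>j\<le>n. x - j)\<^sup>3\<close>. The factor \<open>(x - i)\<^sup>3\<close> is present also
  for \<open>i > n\<close>, where it makes the low coefficients vanish.\<close>

definition loc :: "nat \<Rightarrow> nat \<Rightarrow> rat fps" where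
  "loc n i = (if i \<le> n then 1 else fps_X ^ 3) * inverse (\<Prod>j\<in>{..n} - {i}. lin (of_nat i - of_nat j)) ^ 3"

lemma lin_cancel: "c \<noteq> 0 \<Longrightarrow> lin c * inverse (lin c) = 1"
  by (rule inverse_mult_eq_1') simp

lemma inverse_prod_fps:
  "inverse (\<Prod>a\<in>A. f a) = (\<Prod>a\<in>A. inverse (f a :: rat fps))"
  by (induction A rule: infinite_finite_induct) (simp_all add: fps_inverse_mult)

text \<open>One more node divides by one more cube. The convention for i > n makes this hold for all
  i: at i = n + 1 the cube is \<open>fps_X ^ 3\<close> itself.\<close>

lemma loc_Suc: "lin (of_nat i - of_nat (Suc n)) ^ 3 * loc (Suc n) i = loc n i"
proof -
  let ?L = "\<lambda>j. lin (of_nat i - of_nat j)"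
  consider "i \<le> n" | "i = Suc n" | "i > Suc n" by linarith
  then show ?thesis
  proof cases
    case 1
    then have "{..Suc n} - {i} = insert (Suc n) ({..n} - {i})" by auto
    then have "loc (Suc n) i = inverse (?L (Suc n)) ^ 3 * loc n i"
      using 1 by (simp add: loc_def fps_inverse_mult power_mult_distrib)
    then have "?L (Suc n) ^ 3 * loc (Suc n) i = (?L (Suc n) * inverse (?L (Suc n))) ^ 3 * loc n i"
      by (simp add: power_mult_distrib)
    with 1 show ?thesis by (simp add: lin_cancel)
  next
    case 2
    then have "{..Suc n} - {i} = {..n}" "{..n} - {i} = {..n}" by auto
    with 2 show ?thesis by (simp add: loc_def)
  next
    case 3
    then have "{..Suc n} - {i} = insert (Suc n) ({..n} - {i})" by auto
    then have "loc (Suc n) i = inverse (?L (Suc n)) ^ 3 * loc n i"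
      using 3 by (simp add: loc_def fps_inverse_mult power_mult_distrib)
    then have "?L (Suc n) ^ 3 * loc (Suc n) i = (?L (Suc n) * inverse (?L (Suc n))) ^ 3 * loc n i"
      by (simp add: power_mult_distrib)
    with 3 show ?thesis by (simp add: lin_cancel)
  qed
qed

text \<open>Moving the expansion point together with the nodes changes nothing, except that the node
  0 of the larger set has no counterpart and contributes its own factor.\<close>

lemma loc_shift: "lin (of_nat (Suc i)) ^ 3 * loc (Suc n) (Suc i) = loc n i"
proof -
  have "{..Suc n} - {Suc i} = insert 0 (Suc ` ({..n} - {i}))"
    by (auto simp: atMost_Suc_eq_insert_0)
  then have "(\<Prod>j\<in>{..Suc n} - {Suc i}. lin (of_nat (Suc i) - of_nat j)) =
      lin (of_nat (Suc i)) * (\<Prod>j\<in>{..n} - {i}. lin (of_nat i - of_nat j))"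
    by (simp add: prod.reindex)
  then have "loc (Suc n) (Suc i) = inverse (lin (of_nat (Suc i))) ^ 3 * loc n i"
    by (simp add: loc_def fps_inverse_mult power_mult_distrib)
  then have "lin (of_nat (Suc i)) ^ 3 * loc (Suc n) (Suc i) =
      (lin (of_nat (Suc i)) * inverse (lin (of_nat (Suc i)))) ^ 3 * loc n i"
    by (simp add: power_mult_distrib)
  moreover have "lin (of_nat (Suc i)) * inverse (lin (of_nat (Suc i))) = 1"
    by (rule lin_cancel) (simp del: of_nat_Suc)
  ultimately show ?thesis by simp
qed

lemma loc_beyond: "i > n \<Longrightarrow> \<exists>S. loc n i = fps_X ^ 3 * S"
  by (auto simp: loc_def)

abbreviation xx :: "nat \<Rightarrow> rat fps fps" where "xx i \<equiv> lift (lin (of_nat i))"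
abbreviation yy :: "nat \<Rightarrow> rat fps fps" where "yy k \<equiv> fps_const (lin (of_nat k))"

text \<open>\<open>FF n i k\<close> is \<open>a\<^sup>3 b\<^sup>3 f\<^sub>n(i + a, k + b)\<close>; \<open>GX\<close> and \<open>GY\<close> are the certificates scaled in the same way.
  The factor \<open>x\<^sup>3\<close> of \<open>GX\<close> cancels the pole at \<open>x = 0\<close>.\<close>

definition FF :: "nat \<Rightarrow> nat \<Rightarrow> nat \<Rightarrow> rat fps fps" where
  "FF n i k = fact n ^ 4 * (\<Prod>m\<le>2*n. xx i + yy k - of_nat m) * lift (loc n i) * fps_const (loc n k)"

definition GX :: "nat \<Rightarrow> nat \<Rightarrow> nat \<Rightarrow> rat fps fps" where
  "GX n i k = - (fact n ^ 4) * (\<Prod>m=1..2*n-1. xx i + yy k - of_nat m)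
     * cert (of_nat n) (of_nat n + 1 - xx i) (of_nat n + 1 - yy k)
     * lift (lin (of_nat i) ^ 3 * loc (Suc n) i) * fps_const (loc (Suc n) k)"

definition GY :: "nat \<Rightarrow> nat \<Rightarrow> nat \<Rightarrow> rat fps fps" where
  "GY n i k = - (fact n ^ 4) * (\<Prod>m=1..2*n-1. xx i + yy k - of_nat m)
     * cert (of_nat n) (of_nat n + 1 - yy k) (of_nat n + 1 - xx i)
     * lift (loc (Suc n) i) * fps_const (lin (of_nat k) ^ 3 * loc (Suc n) k)"

lemma xx_Suc: "xx (Suc i) = xx i + 1"
  by (simp add: lift_add lift_const lift_X flip: fps_const_add)

lemma yy_Suc: "yy (Suc k) = yy k + 1"
  by (simp flip: fps_const_add fps_const_1_eq_1)

lemma lift_of_nat [simp]: "lift (of_nat m) = of_nat m"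
  by (induction m) (simp_all add: lift_add, simp add: fps_eq_iff)

lemma lift_diff: "lift (U - V) = lift U - lift V"
  by (simp add: fps_eq_iff)

lemma lin_diff_Suc: "lin (of_nat i - of_nat (Suc n)) = - (of_nat n + 1 - lin (of_nat i))"
  by (simp add: fps_of_nat flip: fps_const_sub)

lemma lift_loc_Suc: "lift (loc n i) = - ((of_nat n + 1 - xx i) ^ 3) * lift (loc (Suc n) i)"
  by (subst loc_Suc[symmetric])
     (simp only: lin_diff_Suc lift_mult lift_power, simp add: lift_diff lift_add power3_eq_cube algebra_simps)

lemma const_loc_Suc: "fps_const (loc n k) = - ((of_nat n + 1 - yy k) ^ 3) * fps_const (loc (Suc n) k)"
proof -
  have "fps_const (- (of_nat n + 1 - lin (of_nat k))) = - (of_nat n + 1 - yy k)"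
    by (simp flip: fps_const_sub fps_const_add add: fps_of_nat)
  moreover have "(- c) ^ 3 * d = - (c ^ 3) * d" for c d :: "rat fps fps"
    by simp
  moreover have "fps_const (loc n k) = fps_const (- (of_nat n + 1 - lin (of_nat k))) ^ 3 * fps_const (loc (Suc n) k)"
    by (subst loc_Suc[symmetric]) (simp only: lin_diff_Suc fps_const_mult fps_const_power)
  ultimately show ?thesis by metis
qed

text \<open>All terms are \<open>K\<close> times polynomials in x, y and N, so this is
  \<open>cert_identity\<close> times \<open>K\<close>. As an identity of expansions at (i + a, k +
  b) it is valid at the poles and for all i and k.\<close>

lemma FF_recurrence:
  fixes n i k :: nat
  defines "N \<equiv> of_nat (Suc n) :: rat fps fps"
  shows "N ^ 2 * (4 * N ^ 2 * (16 * N ^ 2 - 1) * FF n i k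
      - (65 * N ^ 4 + 130 * N ^ 3 + 105 * N ^ 2 + 40 * N + 6) * FF (Suc n) i k
      + (N + 1) ^ 4 * FF (Suc (Suc n)) i k)
    = (GX (Suc n) (Suc i) k - GX (Suc n) i k) + (GY (Suc n) i (Suc k) - GY (Suc n) i k)"
proof -
  define x where "x = xx i"
  define y where "y = yy k"
  define s where "s = x + y"
  define z where "z = N + 1 - x"
  define w where "w = N + 1 - y"
  define M where "M = (\<Prod>m=1..2*n. s - of_nat m)"
  define U where "U = lift (loc (Suc (Suc n)) i)"
  define V where "V = fps_const (loc (Suc (Suc n)) k)"
  define K where "K = fact (Suc n) ^ 4 * M * U * V"
  have e: "2 * Suc n = Suc (Suc (2 * n))" "2 * Suc (Suc n) = Suc (Suc (Suc (Suc (2 * n))))"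
     "2 * Suc n - 1 = Suc (2 * n)" by simp_all
  have N: "of_nat (Suc (2*n)) = 2 * N - 1" "of_nat (Suc (Suc (2*n))) = 2 * N"
    "of_nat (Suc (Suc (Suc (2*n)))) = 2 * N + 1" "of_nat (Suc (Suc (Suc (Suc (2*n))))) = 2 * N + 2"
    by (simp_all add: N_def)
  have prod0: "(\<Prod>m\<le>2*n. s - of_nat m) = s * M"
    unfolding M_def by (subst atMost_atLeast0, subst prod.atLeast_Suc_atMost) auto
  have prod2: "(\<Prod>m\<le>2*Suc n. s - of_nat m) = s * M * ((2*N-1-s) * (2*N-s))"
    unfolding e prod.atMost_Suc prod0 N by Groebner_Basis.algebra
  have prod4: "(\<Prod>m\<le>2*Suc (Suc n). s - of_nat m) = s * M * ((2*N-1-s) * (2*N-s)) * ((2*N+1-s) * (2*N+2-s))"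
    unfolding e prod.atMost_Suc prod0 N by Groebner_Basis.algebra
  have prod1: "(\<Prod>m=1..2*Suc n-1. s - of_nat m) = - (M * (2*N-1-s))"
  proof -
    have "(\<Prod>m=1..Suc (2*n). s - of_nat m) = M * (s - of_nat (Suc (2*n)))"
      unfolding M_def by (subst prod.nat_ivl_Suc') (simp_all add: mult_ac)
    then show ?thesis unfolding e(3) N by Groebner_Basis.algebra
  qed
  \<comment> \<open>Raising x or y by one turns the range 1, ..., 2N - 1 into 0, ..., 2N -
    2.\<close>
  have prod1': "(\<Prod>m=1..2*Suc n-1. s + 1 - of_nat m) = s * M"
  proof -
    have "(\<Prod>m=1..2*Suc n-1. s + 1 - of_nat m) = (\<Prod>m\<in>Suc ` {..2*n}. s + 1 - of_nat m)"
      by (intro prod.cong) (auto simp: image_Suc_atMost)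
    also have "\<dots> = (\<Prod>m\<le>2*n. s - of_nat m)" by (subst prod.reindex) auto
    finally show ?thesis using prod0 by simp
  qed
  have Ui: "lift (loc (Suc n) i) = - (z^3) * U" "lift (loc n i) = - ((N - x)^3) * (- (z^3) * U)"
  proof -
    show *: "lift (loc (Suc n) i) = - (z^3) * U"
      unfolding U_def z_def x_def N_def by (rule lift_loc_Suc)
    have "lift (loc n i) = - ((N - x)^3) * lift (loc (Suc n) i)"
      unfolding x_def N_def of_nat_Suc add.commute[of 1] by (rule lift_loc_Suc)
    then show "lift (loc n i) = - ((N - x)^3) * (- (z^3) * U)" unfolding * .
  qed
  have Vi: "fps_const (loc (Suc n) k) = - (w^3) * V" "fps_const (loc n k) = - ((N - y)^3) * (- (w^3) * V)"
  proof -
    show *: "fps_const (loc (Suc n) k) = - (w^3) * V"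
      unfolding V_def w_def y_def N_def by (rule const_loc_Suc)
    have "fps_const (loc n k) = - ((N - y)^3) * fps_const (loc (Suc n) k)"
      unfolding y_def N_def of_nat_Suc add.commute[of 1] by (rule const_loc_Suc)
    then show "fps_const (loc n k) = - ((N - y)^3) * (- (w^3) * V)" unfolding * .
  qed
  have fact: "fact (Suc n) = N * fact n" "fact (Suc (Suc n)) = (N + 1) * fact (Suc n)"
    by (simp_all add: N_def algebra_simps)
  have xs: "xx (Suc i) = x + 1" "yy (Suc k) = y + 1"
    unfolding x_def y_def by (rule xx_Suc yy_Suc)+
  have F0: "N ^ 4 * FF n i k = K * (s * (z*(N-x)*w*(N-y))^3)"
    unfolding FF_def Ui Vi K_def x_def[symmetric] y_def[symmetric] s_def[symmetric] prod0 fact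
    by Groebner_Basis.algebra
  have F1: "FF (Suc n) i k = K * (s * ((2*N-s)*(2*N-1-s)*(z*w)^3))"
    unfolding FF_def Ui Vi K_def x_def[symmetric] y_def[symmetric] s_def[symmetric] prod2
    by Groebner_Basis.algebra
  have F2: "FF (Suc (Suc n)) i k = (N+1)^4 * (K * (s * ((2*N+2-s)*(2*N+1-s)*(2*N-s)*(2*N-1-s))))"
    unfolding FF_def K_def x_def[symmetric] y_def[symmetric] s_def[symmetric] prod4 fact(2) U_def V_def
    by Groebner_Basis.algebra
  have G0: "GX (Suc n) i k = K * (x^3 * (2*N-1-s) * cert N z w)"
    unfolding GX_def K_def x_def[symmetric] y_def[symmetric] s_def[symmetric] prod1
      lift_mult lift_power z_def w_def N_def U_def V_def by Groebner_Basis.algebra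
  have H0: "GY (Suc n) i k = K * (y^3 * (2*N-1-s) * cert N w z)"
    unfolding GY_def K_def x_def[symmetric] y_def[symmetric] s_def[symmetric] prod1
      fps_const_mult[symmetric] fps_const_power[symmetric] z_def w_def N_def U_def V_def by Groebner_Basis.algebra
  have G1: "GX (Suc n) (Suc i) k = K * (s * z^3 * cert N (z - 1) w)"
  proof -
    have "lift (lin (of_nat (Suc i)) ^ 3 * loc (Suc (Suc n)) (Suc i)) = - (z^3) * U"
      unfolding loc_shift by (rule Ui)
    moreover have "x + 1 + y = s + 1" "N + 1 - (x + 1) = z - 1" by (simp_all add: s_def z_def)
    ultimately show ?thesis
      unfolding GX_def K_def xs y_def[symmetric] N_def[symmetric] V_def w_def[symmetric]
      by (simp only: prod1') (simp add: mult_ac)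
  qed
  have H1: "GY (Suc n) i (Suc k) = K * (s * w^3 * cert N (w - 1) z)"
  proof -
    have "fps_const (lin (of_nat (Suc k)) ^ 3 * loc (Suc (Suc n)) (Suc k)) = - (w^3) * V"
      unfolding loc_shift by (rule Vi)
    moreover have "x + (y + 1) = s + 1" "N + 1 - (y + 1) = w - 1" by (simp_all add: s_def w_def)
    ultimately show ?thesis
      unfolding GY_def K_def xs x_def[symmetric] N_def[symmetric] U_def z_def[symmetric]
      by (simp only: prod1') (simp add: mult_ac)
  qed
  have id: "s * (4*(16*N^2-1) * (z*(N-x)*w*(N-y))^3
     - N^2*(65*N^4+130*N^3+105*N^2+40*N+6) * ((2*N-s)*(2*N-1-s)*(z*w)^3)
     + N^2*(N+1)^8 * ((2*N+2-s)*(2*N+1-s)*(2*N-s)*(2*N-1-s)))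
   = s*z^3 * cert N (z - 1) w - x^3*(2*N-1-s) * cert N z w
   + s*w^3 * cert N (w - 1) z - y^3*(2*N-1-s) * cert N w z"
    using cert_identity[of x y N] unfolding s_def z_def w_def .
  have "N ^ 2 * (4 * N ^ 2 * (16 * N ^ 2 - 1) * FF n i k
      - (65 * N ^ 4 + 130 * N ^ 3 + 105 * N ^ 2 + 40 * N + 6) * FF (Suc n) i k
      + (N + 1) ^ 4 * FF (Suc (Suc n)) i k)
     = 4 * (16 * N ^ 2 - 1) * (N ^ 4 * FF n i k)
      - N ^ 2 * (65 * N ^ 4 + 130 * N ^ 3 + 105 * N ^ 2 + 40 * N + 6) * FF (Suc n) i k
      + N ^ 2 * (N + 1) ^ 4 * FF (Suc (Suc n)) i k"
    by Groebner_Basis.algebra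
  also have "\<dots> = K * (s * (4*(16*N^2-1) * (z*(N-x)*w*(N-y))^3
     - N^2*(65*N^4+130*N^3+105*N^2+40*N+6) * ((2*N-s)*(2*N-1-s)*(z*w)^3)
     + N^2*(N+1)^8 * ((2*N+2-s)*(2*N+1-s)*(2*N-s)*(2*N-1-s))))"
    unfolding F0 F1 F2 by Groebner_Basis.algebra
  also have "\<dots> = (GX (Suc n) (Suc i) k - GX (Suc n) i k) + (GY (Suc n) i (Suc k) - GY (Suc n) i k)"
    unfolding id G0 G1 H0 H1 by Groebner_Basis.algebra
  finally show ?thesis .
qed

section \<open>Residue sums over triple poles and a pole at the origin\<close>

definition nodes :: "nat \<Rightarrow> nat set \<Rightarrow> rat multiset" where
  "nodes r J = replicate_mset r 0 + (\<Sum>j\<in>J. replicate_mset 3 (of_nat j))"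

text \<open>The cube of \<open>x - i\<close> times \<open>x\<^sup>d\<^sup>-\<^sup>r / (\<Prod>j\<in>J. x - j)\<^sup>3\<close>, expanded at \<open>x = i\<close>.\<close>

abbreviation local_part :: "nat \<Rightarrow> nat set \<Rightarrow> nat \<Rightarrow> nat \<Rightarrow> rat fps" where
  "local_part r J d i \<equiv> lin (of_nat i) ^ d * (inverse (lin (of_nat i)) ^ r * inverse (\<Prod>j\<in>J - {i}. lin (of_nat i - of_nat j)) ^ 3)"

lemma prod_mset_sum: "(\<Prod>x\<in>#(\<Sum>j\<in>J. M j). f x) = (\<Prod>j\<in>J. \<Prod>x\<in>#M j. f x :: 'a::comm_monoid_mult)"
  by (induction J rule: infinite_finite_induct) auto

lemma fps_to_fls_prod: "fps_to_fls (\<Prod>a\<in>A. f a) = (\<Prod>a\<in>A. fps_to_fls (f a :: rat fps))"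
  by (induction A rule: infinite_finite_induct) (simp_all add: fls_times_fps_to_fls)

lemma fls_lin: "fps_to_fls (lin c) = fls_const c + fls_X"
  by simp

lemma fls_inverse_lin: "c \<noteq> 0 \<Longrightarrow> inverse (fls_const c + fls_X) = fps_to_fls (inverse (lin c))"
  by (subst fls_lin[symmetric], rule fls_inverse_fps_to_fls) simp

lemma res_at_nodes_pole:
  assumes "finite J" "i \<in> J" "i \<noteq> 0 \<or> r = 0"
  shows "res_at d (nodes r J) (of_nat i)
    = (local_part r J d i) $ 2"
proof -
  let ?L = "\<lambda>c. inverse (fls_const c + fls_X) :: rat fls"
  have "(\<Prod>v\<in>#nodes r J. ?L (of_nat i - v)) = ?L (of_nat i) ^ r * (\<Prod>j\<in>J. ?L (of_nat i - of_nat j) ^ 3)"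
    by (simp add: nodes_def prod_mset_sum)
  also have "(\<Prod>j\<in>J. ?L (of_nat i - of_nat j) ^ 3) = fls_X_inv ^ 3 * (\<Prod>j\<in>J-{i}. ?L (of_nat i - of_nat j) ^ 3)"
    using assms by (subst prod.remove[of _ i]) (auto simp: fls_inverse_X)
  also have "(\<Prod>j\<in>J-{i}. ?L (of_nat i - of_nat j) ^ 3) = (\<Prod>j\<in>J-{i}. fps_to_fls (inverse (lin (of_nat i - of_nat j))) ^ 3)"
    by (intro prod.cong refl arg_cong[of _ _ "\<lambda>x. x ^ 3"] fls_inverse_lin) auto
  also have "\<dots> = fps_to_fls (inverse (\<Prod>j\<in>J - {i}. lin (of_nat i - of_nat j)) ^ 3)"
    by (simp add: inverse_prod_fps prod_power_distrib fps_to_fls_power fps_to_fls_prod)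
  also have "?L (of_nat i) ^ r = fps_to_fls (inverse (lin (of_nat i))) ^ r"
    using assms(3) by (cases "r = 0") (simp_all add: fls_inverse_lin)
  finally have "res_at d (nodes r J) (of_nat i) = fls_nth (fls_X_inv ^ 3 * fps_to_fls (local_part r J d i)) (-1)"
    unfolding res_at_def fls_lin[symmetric] by (simp add: fls_times_fps_to_fls fps_to_fls_power mult_ac)
  then show ?thesis by (simp add: fls_X_inv_power_times_conv_shift)
qed

lemma res_at_nodes_0:
  assumes "finite J" "0 \<notin> J" "r > 0"
  shows "res_at d (nodes r J) 0
    = (fps_X ^ d * inverse (\<Prod>j\<in>J. lin (- of_nat j)) ^ 3) $ (r - 1)"
proof -
  let ?L = "\<lambda>c. inverse (fls_const c + fls_X) :: rat fls"
  have "(\<Prod>v\<in>#nodes r J. ?L (0 - v)) = fls_X_inv ^ r * (\<Prod>j\<in>J. ?L (- of_nat j) ^ 3)"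
    by (simp add: nodes_def prod_mset_sum fls_inverse_X)
  also have "(\<Prod>j\<in>J. ?L (- of_nat j) ^ 3) = (\<Prod>j\<in>J. fps_to_fls (inverse (lin (- of_nat j))) ^ 3)"
    using assms by (intro prod.cong refl arg_cong[of _ _ "\<lambda>x. x ^ 3"] fls_inverse_lin) (auto intro: ccontr)
  also have "\<dots> = fps_to_fls (inverse (\<Prod>j\<in>J. lin (- of_nat j)) ^ 3)"
    by (simp add: inverse_prod_fps prod_power_distrib fps_to_fls_power fps_to_fls_prod)
  finally have "res_at d (nodes r J) 0 = fls_nth (fls_X_inv ^ r * fps_to_fls (fps_X ^ d * inverse (\<Prod>j\<in>J. lin (- of_nat j)) ^ 3)) (-1)"
    unfolding res_at_def by (simp add: fls_times_fps_to_fls fps_to_fls_power mult_ac)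
  then show ?thesis using assms(3) by (simp add: fls_X_inv_power_times_conv_shift nat_diff_distrib)
qed

text \<open>The residue theorem solved for the pole of order r at 0, where the residue is a
  coefficient of the regular cofactor.\<close>

lemma sum_res_nodes:
  assumes "finite J" "0 \<notin> J" "d + 2 \<le> r + 3 * card J" "r > 0"
  shows "(\<Sum>i\<in>J. (local_part r J d i) $ 2)
    = - (fps_X ^ d * inverse (\<Prod>j\<in>J. lin (- of_nat j)) ^ 3) $ (r - 1)"
proof -
  have "(\<Sum>u\<in>of_nat ` insert 0 J. res_at d (nodes r J) u) = 0"
    using assms by (intro sum_res_at) (auto simp: nodes_def set_mset_sum split: if_splits)
  then have "(\<Sum>i\<in>insert 0 J. res_at d (nodes r J) (of_nat i)) = 0"
    by (subst (asm) sum.reindex) (auto simp: inj_on_def)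
  then have "(\<Sum>i\<in>J. res_at d (nodes r J) (of_nat i)) = - res_at d (nodes r J) 0"
    using assms by (simp add: add_eq_0_iff)
  moreover have "(\<Sum>i\<in>J. res_at d (nodes r J) (of_nat i)) = (\<Sum>i\<in>J. (local_part r J d i) $ 2)"
    using assms by (intro sum.cong refl res_at_nodes_pole) (auto intro: ccontr)
  ultimately show ?thesis using assms by (simp add: res_at_nodes_0)
qed

text \<open>The coefficient of index 2 is the residue at a triple pole; the denominator has degree
  3(n + 1), so the bound on d excludes a residue at infinity.\<close>

lemma sum_res_loc:
  assumes "d \<le> 3 * n + 1"
  shows "(\<Sum>i\<le>n. (lin (of_nat i) ^ d * loc n i) $ 2) = 0"
proof -
  have "(\<Sum>u\<in>of_nat ` {..n}. res_at d (nodes 0 {..n}) u) = 0"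
    using assms by (intro sum_res_at) (auto simp: nodes_def set_mset_sum size_multiset_sum split: if_splits)
  then have "(\<Sum>i\<le>n. res_at d (nodes 0 {..n}) (of_nat i)) = 0"
    by (subst (asm) sum.reindex) (auto simp: inj_on_def)
  moreover have "(\<Sum>i\<le>n. res_at d (nodes 0 {..n}) (of_nat i)) = (\<Sum>i\<le>n. (lin (of_nat i) ^ d * loc n i) $ 2)"
    by (intro sum.cong refl, subst res_at_nodes_pole) (auto simp: loc_def)
  ultimately show ?thesis by simp
qed

section \<open>The residue theorem for the certificate in x\<close>

lemma cf_mult_lift2: "cf 2 v (G * lift S) = cf 0 v G * S $ 2 + cf 1 v G * S $ 1 + cf 2 v G * S $ 0"
proof -
  have "(G * lift S) $ 2 = G $ 0 * fps_const (S $ 2) + G $ 1 * fps_const (S $ 1) + G $ 2 * fps_const (S $ 0)"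
    by (simp add: fps_mult_nth numeral_2_eq_2)
  then show ?thesis by (simp add: cf_def)
qed

lemma fps_const_sum: "fps_const (\<Sum>a\<in>A. f a) = (\<Sum>a\<in>A. fps_const (f a :: rat fps))"
  by (induction A rule: infinite_finite_induct) (simp_all flip: fps_const_add)

text \<open>Polynomial functions of x whose coefficients are series in b. In this form one set of
  coefficients serves for the evaluation at all nodes and at x = 0. The vanishing of
  \<open>q\<close> beyond \<open>D\<close> is what the convolution formula for products asks
  for.\<close>

definition polyform :: "nat \<Rightarrow> (rat fps fps \<Rightarrow> rat fps fps) \<Rightarrow> bool" where
  "polyform D f \<longleftrightarrow> (\<exists>q. (\<forall>d>D. q d = 0) \<and> (\<forall>x. f x = (\<Sum>d\<le>D. fps_const (q d) * x ^ d)))"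

lemma polyform_const: "polyform 0 (\<lambda>_. fps_const c)"
  unfolding polyform_def by (rule exI[of _ "\<lambda>d. if d = 0 then c else 0"]) auto

lemma polyform_id: "polyform 1 (\<lambda>x. x)"
  unfolding polyform_def by (rule exI[of _ "\<lambda>d. if d = 1 then 1 else 0"]) auto

lemma polyform_mono: "polyform D f \<Longrightarrow> D \<le> D' \<Longrightarrow> polyform D' f"
  unfolding polyform_def
proof (elim exE conjE)
  fix q assume D: "D \<le> D'" and q: "\<forall>d>D. q d = 0" "\<forall>x. f x = (\<Sum>d\<le>D. fps_const (q d) * x ^ d)"
  show "\<exists>q. (\<forall>d>D'. q d = 0) \<and> (\<forall>x. f x = (\<Sum>d\<le>D'. fps_const (q d) * x ^ d))"
  proof (intro exI[of _ q] conjI allI impI)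
    fix x show "f x = (\<Sum>d\<le>D'. fps_const (q d) * x ^ d)"
      unfolding q(2)[rule_format] using q(1) D by (intro sum.mono_neutral_left) auto
  qed (use q D in auto)
qed

lemma polyform_add: "polyform D f \<Longrightarrow> polyform D g \<Longrightarrow> polyform D (\<lambda>x. f x + g x)"
  unfolding polyform_def
proof (elim exE conjE)
  fix q r assume "\<forall>d>D. q d = 0" "\<forall>x. f x = (\<Sum>d\<le>D. fps_const (q d) * x ^ d)"
     "\<forall>d>D. r d = 0" "\<forall>x. g x = (\<Sum>d\<le>D. fps_const (r d) * x ^ d)"
  then show "\<exists>q. (\<forall>d>D. q d = 0) \<and> (\<forall>x. f x + g x = (\<Sum>d\<le>D. fps_const (q d) * x ^ d))"
    by (intro exI[of _ "\<lambda>d. q d + r d"]) (simp add: sum.distrib distrib_right flip: fps_const_add)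
qed

lemma polyform_mult: "polyform D f \<Longrightarrow> polyform E g \<Longrightarrow> polyform (D + E) (\<lambda>x. f x * g x)"
  unfolding polyform_def
proof (elim exE conjE)
  fix q r assume q: "\<forall>d>D. q d = 0" "\<forall>x. f x = (\<Sum>d\<le>D. fps_const (q d) * x ^ d)"
    and r: "\<forall>d>E. r d = 0" "\<forall>x. g x = (\<Sum>d\<le>E. fps_const (r d) * x ^ d)"
  define t where "t d = (\<Sum>k\<le>d. q k * r (d - k))" for d
  have "t d = 0" if "d > D + E" for d
    unfolding t_def
  proof (intro sum.neutral ballI)
    fix k assume "k \<in> {..d}"
    then have "k > D \<or> d - k > E" using that by auto
    then show "q k * r (d - k) = 0" using q r by auto
  qed
  moreover have "f x * g x = (\<Sum>d\<le>D + E. fps_const (t d) * x ^ d)" for x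
  proof -
    have "f x * g x = (\<Sum>d\<le>D + E. (\<Sum>k\<le>d. fps_const (q k) * fps_const (r (d - k))) * x ^ d)"
      using q r by (simp only:) (rule polynomial_product; simp)
    then show ?thesis by (simp add: t_def fps_const_sum)
  qed
  ultimately show "\<exists>q. (\<forall>d>D + E. q d = 0) \<and> (\<forall>x. f x * g x = (\<Sum>d\<le>D + E. fps_const (q d) * x ^ d))"
    by blast
qed

lemma polyform_power: "polyform D f \<Longrightarrow> polyform (D * k) (\<lambda>x. f x ^ k)"
  by (induction k) (auto simp: add.commute dest: polyform_mult intro: polyform_const[of 1, simplified])

lemma polyform_prod: "(\<And>a. a \<in> A \<Longrightarrow> polyform 1 (f a)) \<Longrightarrow> polyform (card A) (\<lambda>x. \<Prod>a\<in>A. f a x)"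
proof (induction A rule: infinite_finite_induct)
  case (insert a A)
  then show ?case using polyform_mult[of 1 "f a" "card A"] by simp
qed (auto intro: polyform_const[of 1, simplified])

lemma polyform_quartic:
  assumes "polyform 1 z"
  shows "polyform 4 (\<lambda>x. fps_const c0 + fps_const c1 * z x + fps_const c2 * z x ^ 2 + fps_const c3 * z x ^ 3 + fps_const c4 * z x ^ 4)"
proof -
  have "polyform 4 (\<lambda>x. fps_const c * z x ^ k)" if "k \<le> 4" for c k
    using polyform_mono[OF polyform_mult[OF polyform_const polyform_power[OF assms]]] that by simp
  from this[of 0] this[of 1] this[of 2] this[of 3] this[of 4] show ?thesis
    by (intro polyform_add) (simp_all)
qed

lemma cert_quartic:
  "cert (of_nat n) z (fps_const w)
     = fps_const (cert0 (of_nat n) w) + fps_const (cert1 (of_nat n) w) * z + fps_const (cert2 (of_nat n) w) * z ^ 2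
     + fps_const (cert3 (of_nat n) w) * z ^ 3 + fps_const (cert4 (of_nat n) (w :: rat fps)) * z ^ 4"
proof -
  have num: "fps_const (numeral k :: rat fps) = numeral k" for k by (simp add: numeral_fps_const)
  have "cert0 (of_nat n) (fps_const w) = fps_const (cert0 (of_nat n) w)"
     "cert1 (of_nat n) (fps_const w) = fps_const (cert1 (of_nat n) w)"
     "cert2 (of_nat n) (fps_const w) = fps_const (cert2 (of_nat n) w)"
     "cert3 (of_nat n) (fps_const w) = fps_const (cert3 (of_nat n) w)"
     "cert4 (of_nat n) (fps_const w) = fps_const (cert4 (of_nat n) w)"
    unfolding cert_defs by (simp_all add: num fps_of_nat flip: fps_const_mult fps_const_add fps_const_sub fps_const_power fps_const_neg)
  then show ?thesis by (simp add: cert_def)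
qed

text \<open>The certificate \<open>GX\<close> without its factor \<open>x\<^sup>3\<close>, expanded at \<open>x = 0\<close>.\<close>

definition GX0 :: "nat \<Rightarrow> nat \<Rightarrow> rat fps fps" where
  "GX0 n k = - (fact n ^ 4) * (\<Prod>m=1..2*n-1. xx 0 + yy k - of_nat m)
     * cert (of_nat n) (of_nat n + 1 - xx 0) (of_nat n + 1 - yy k)
     * lift (loc (Suc n) 0) * fps_const (loc (Suc n) k)"

lemma fact_fps_const: "fact n = fps_const (fact n :: rat fps)"
  by (metis fps_of_nat of_nat_fact)

text \<open>There are 2n - 1 linear factors and a certificate of degree 4 in z. The factors that
  depend on x alone are left out; they form the denominator of the residue sums.\<close>

lemma GX_polyform:
  "polyform (2*n-1+4) (\<lambda>x. - (fact n ^ 4) * (\<Prod>m=1..2*n-1. x + yy k - of_nat m)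
     * cert (of_nat n) (of_nat n + 1 - x) (of_nat n + 1 - yy k) * fps_const (loc (Suc n) k))"
proof -
  have lin: "polyform 1 (\<lambda>x. fps_const c * x + fps_const d)" for c d
    using polyform_mult[OF polyform_const[of c] polyform_id] by (intro polyform_add polyform_mono[OF polyform_const]) auto
  have 1: "polyform 1 (\<lambda>x. x + yy k - of_nat m)" for m
    using lin[of 1 "lin (of_nat k) - of_nat m"] by (simp add: fps_of_nat algebra_simps flip: fps_const_sub)
  have 2: "polyform 1 (\<lambda>x. of_nat n + 1 - x)"
    using lin[of "- 1" "of_nat n + 1"] by (simp add: fps_of_nat flip: fps_const_add fps_const_neg)
  have w: "of_nat n + 1 - yy k = fps_const (of_nat n + 1 - lin (of_nat k))"
    by (simp add: fps_of_nat flip: fps_const_add fps_const_sub)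
  have 3: "polyform 4 (\<lambda>x. cert (of_nat n) (of_nat n + 1 - x) (of_nat n + 1 - yy k))"
    unfolding w cert_quartic by (rule polyform_quartic[OF 2])
  have 4: "polyform (2*n-1) (\<lambda>x. \<Prod>m=1..2*n-1. x + yy k - of_nat m)"
    using polyform_prod[of "{1..2*n-1}" "\<lambda>m x. x + yy k - of_nat m"] 1 by simp
  have 5: "- (fact n ^ 4) = fps_const (- (fact n ^ 4) :: rat fps)"
    by (simp add: fact_fps_const flip: fps_const_neg fps_const_power)
  show ?thesis
    unfolding 5 using polyform_mult[OF polyform_mult[OF polyform_mult[OF polyform_const 4] 3] polyform_const] by simp
qed

lemma lin_loc: "i \<in> {1..n} \<Longrightarrow> lin (of_nat i) ^ 3 * loc n i = inverse (\<Prod>j\<in>{1..n} - {i}. lin (of_nat i - of_nat j)) ^ 3"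
proof -
  assume i: "i \<in> {1..n}"
  then have "{..n} - {i} = insert 0 ({1..n} - {i})" by auto
  then have "loc n i = inverse (lin (of_nat i)) ^ 3 * inverse (\<Prod>j\<in>{1..n} - {i}. lin (of_nat i - of_nat j)) ^ 3"
    using i by (simp add: loc_def fps_inverse_mult power_mult_distrib)
  then have "lin (of_nat i) ^ 3 * loc n i = (lin (of_nat i) * inverse (lin (of_nat i))) ^ 3 * inverse (\<Prod>j\<in>{1..n} - {i}. lin (of_nat i - of_nat j)) ^ 3"
    by (simp add: power_mult_distrib)
  with i show ?thesis by (simp add: lin_cancel)
qed

lemma loc_0: "loc n 0 = inverse (\<Prod>j\<in>{1..n}. lin (- of_nat j)) ^ 3"
proof -
  have "{..n} - {0} = {1..n}" by auto
  then show ?thesis by (simp add: loc_def)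
qed

text \<open>The factor x^3 has removed the triple pole at 0, and division by x^r creates one of
  order r. The other poles are 1, ..., n + 1, so the residues there sum to minus the residue at
  0.\<close>

lemma res_GX:
  assumes "n \<ge> 1" "r \<ge> 1"
  shows "(\<Sum>i=1..Suc n. cf 2 v (GX n i k * lift (inverse (lin (of_nat i)) ^ r))) = - cf (r - 1) v (GX0 n k)"
proof -
  define D where "D = 2*n-1+4"
  obtain q where q: "\<And>x. - (fact n ^ 4) * (\<Prod>m=1..2*n-1. x + yy k - of_nat m)
     * cert (of_nat n) (of_nat n + 1 - x) (of_nat n + 1 - yy k) * fps_const (loc (Suc n) k) = (\<Sum>d\<le>D. fps_const (q d) * x ^ d)"
    using GX_polyform[of n k] unfolding polyform_def D_def by blast
  have "GX n i k * lift (inverse (lin (of_nat i)) ^ r) = (\<Sum>d\<le>D. fps_const (q d) *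
       lift (local_part r {1..Suc n} d i))"
    if i: "i \<in> {1..Suc n}" for i
  proof -
    have "GX n i k * lift (inverse (lin (of_nat i)) ^ r) = (\<Sum>d\<le>D. fps_const (q d) * xx i ^ d) *
       lift (inverse (lin (of_nat i)) ^ r * (lin (of_nat i) ^ 3 * loc (Suc n) i))"
      unfolding q[symmetric] by (simp add: GX_def lift_mult mult_ac)
    also have "\<dots> = (\<Sum>d\<le>D. fps_const (q d) *
       lift (local_part r {1..Suc n} d i))"
      unfolding lin_loc[OF i] sum_distrib_right lift_mult lift_power by (simp only: mult_ac)
    finally show ?thesis .
  qed
  then have "(\<Sum>i=1..Suc n. cf 2 v (GX n i k * lift (inverse (lin (of_nat i)) ^ r))) =
     (\<Sum>i=1..Suc n. \<Sum>d\<le>D. (local_part r {1..Suc n} d i) $ 2 * q d $ v)"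
    by (intro sum.cong refl) (simp add: cf_sum)
  also have "\<dots> = (\<Sum>d\<le>D. (\<Sum>i=1..Suc n. (local_part r {1..Suc n} d i) $ 2) * q d $ v)"
    by (subst sum.swap) (simp only: sum_distrib_right)
  also have "\<dots> = (\<Sum>d\<le>D. - (fps_X ^ d * inverse (\<Prod>j\<in>{1..Suc n}. lin (- of_nat j)) ^ 3) $ (r - 1) * q d $ v)"
  proof (intro sum.cong refl arg_cong2[of _ _ _ _ "(*)"] sum_res_nodes)
    \<comment> \<open>2n + 5 <= r + 3(n + 1), as n and r are at least 1.\<close>
    fix d assume "d \<in> {..D}" then show "d + 2 \<le> r + 3 * card {1..Suc n}" using assms by (simp add: D_def)
  qed (use assms in auto)
  also have "\<dots> = - cf (r - 1) v (\<Sum>d\<le>D. fps_const (q d) * lift (fps_X ^ d * inverse (\<Prod>j\<in>{1..Suc n}. lin (- of_nat j)) ^ 3))"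
    by (simp add: cf_sum sum_negf)
  also have "(\<Sum>d\<le>D. fps_const (q d) * lift (fps_X ^ d * inverse (\<Prod>j\<in>{1..Suc n}. lin (- of_nat j)) ^ 3)) =
     (\<Sum>d\<le>D. fps_const (q d) * xx 0 ^ d) * lift (loc (Suc n) 0)"
    unfolding loc_0 by (simp add: sum_distrib_right lift_mult lift_power mult_ac)
  also have "\<dots> = GX0 n k" unfolding q[symmetric] by (simp add: GX0_def mult_ac)
  finally show ?thesis .
qed

section \<open>First-order coefficients and the symmetry of the certificate at x = 0\<close>

lemma cf00_mult: "cf 0 0 (F * G) = cf 0 0 F * cf 0 0 G"
  and cf10_mult: "cf (Suc 0) 0 (F * G) = cf (Suc 0) 0 F * cf 0 0 G + cf 0 0 F * cf (Suc 0) 0 G"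
  and cf01_mult: "cf 0 (Suc 0) (F * G) = cf 0 (Suc 0) F * cf 0 0 G + cf 0 0 F * cf 0 (Suc 0) G"
  by (simp_all add: cf_def fps_mult_nth)

lemma cf_of_nat: "cf 0 0 (of_nat m) = of_nat m" "cf (Suc 0) 0 (of_nat m) = 0" "cf 0 (Suc 0) (of_nat m) = 0"
  by (simp_all add: cf_def flip: fps_of_nat)

lemma cf_numeral: "cf 0 0 (numeral m) = numeral m" "cf (Suc 0) 0 (numeral m) = 0" "cf 0 (Suc 0) (numeral m) = 0"
  "cf 0 0 1 = 1" "cf (Suc 0) 0 1 = 0" "cf 0 (Suc 0) 1 = 0"
  using cf_of_nat[of "numeral m"] cf_of_nat[of 1] by simp_all

lemma cf_power: "cf 0 0 (F ^ m) = cf 0 0 F ^ m"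
   "cf (Suc 0) 0 (F ^ m) = of_nat m * cf 0 0 F ^ (m - 1) * cf (Suc 0) 0 F"
   "cf 0 (Suc 0) (F ^ m) = of_nat m * cf 0 0 F ^ (m - 1) * cf 0 (Suc 0) F"
proof -
  show 0: "cf 0 0 (F ^ m) = cf 0 0 F ^ m" for m by (induction m) (simp_all add: cf00_mult cf_numeral)
  have "cf (Suc 0) 0 (F ^ m) = of_nat m * cf 0 0 F ^ (m - 1) * cf (Suc 0) 0 F
      \<and> cf 0 (Suc 0) (F ^ m) = of_nat m * cf 0 0 F ^ (m - 1) * cf 0 (Suc 0) F"
  proof (induction m)
    case (Suc m)
    then show ?case
      by (cases m) (auto simp: cf_numeral cf10_mult cf01_mult cf00_mult 0 algebra_simps)
  qed (simp add: cf_numeral)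
  then show "cf (Suc 0) 0 (F ^ m) = of_nat m * cf 0 0 F ^ (m - 1) * cf (Suc 0) 0 F"
    "cf 0 (Suc 0) (F ^ m) = of_nat m * cf 0 0 F ^ (m - 1) * cf 0 (Suc 0) F" by auto
qed

lemma cf_xx: "cf 0 0 (xx i) = of_nat i" "cf (Suc 0) 0 (xx i) = 1" "cf 0 (Suc 0) (xx i) = 0"
  and cf_yy: "cf 0 0 (yy i) = of_nat i" "cf (Suc 0) 0 (yy i) = 0" "cf 0 (Suc 0) (yy i) = 1"
  by (simp_all add: cf_def)

text \<open>To first order, the series depends on a + b only.\<close>

definition balanced :: "rat fps fps \<Rightarrow> bool" where
  "balanced F \<longleftrightarrow> cf 0 (Suc 0) F = cf (Suc 0) 0 F"

lemma balanced_mult: "balanced F \<Longrightarrow> balanced G \<Longrightarrow> balanced (F * G)"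
  by (simp add: balanced_def cf10_mult cf01_mult)

text \<open>For k = 0 the certificate has equal first derivatives at x = y = 0, by a polynomial
  identity in n, and the other factors are symmetric. For k > n + 1 the low coefficients vanish. For
  1 <= k <= 2n - 1 the product contains the factor a + b. Only n = 1, k = 2 is left, where the
  certificate vanishes together with its first derivatives.\<close>

lemma balanced_GX0:
  assumes "n \<ge> 1"
  shows "cf 0 (Suc 0) (GX0 n k) = cf (Suc 0) 0 (GX0 n k)"
proof -
  have c: "balanced (- (fact n ^ 4))"
    using cf_of_nat[of "fact n"] by (simp add: balanced_def cf_power)
  have lin: "balanced (xx 0 + yy k - of_nat m)" for m
    by (simp add: balanced_def cf_xx cf_yy cf_of_nat del: of_nat_0)
  have p: "balanced (\<Prod>m\<in>A. xx 0 + yy k - of_nat m)" for A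
    by (induction A rule: infinite_finite_induct)
       (auto simp del: of_nat_0 intro!: balanced_mult lin, auto simp: balanced_def cf_numeral)
  consider "k = 0" | "k > Suc n" | "k \<in> {1..2*n-1}" | "n = 1" "k = 2" using assms by force
  then have "balanced (GX0 n k)"
  proof cases
    case 1
    have "balanced (cert (of_nat n) (of_nat n + 1 - X) (of_nat n + 1 - Y))"
      if "cf 0 0 X = 0" "cf (Suc 0) 0 X = 1" "cf 0 (Suc 0) X = 0" "cf 0 0 Y = 0" "cf (Suc 0) 0 Y = 0" "cf 0 (Suc 0) Y = 1" for X Y
      unfolding balanced_def cert_defs
      by (simp add: that cf_of_nat cf_numeral cf_power cf10_mult cf01_mult cf00_mult) Groebner_Basis.algebra
    from this[of "xx 0" "yy 0"] have ct: "balanced (cert (of_nat n) (of_nat n + 1 - xx 0) (of_nat n + 1 - yy 0))"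
      using cf_xx[of 0] cf_yy[of 0] by simp
    have L: "balanced (lift L * fps_const L)" for L
      by (simp add: balanced_def cf_def)
    show ?thesis unfolding GX0_def 1 mult.assoc
      by (rule balanced_mult[OF c balanced_mult[OF p[unfolded 1] balanced_mult[OF ct L]]])
  next
    case 2
    then obtain S where "loc (Suc n) k = fps_X ^ 3 * S" using loc_beyond by blast
    then show ?thesis unfolding balanced_def GX0_def by (simp add: cf_const_X3)
  next
    case 3
    then have "(\<Prod>m=1..2*n-1. xx 0 + yy k - of_nat m) = (xx 0 + yy k - of_nat k) * (\<Prod>m\<in>{1..2*n-1}-{k}. xx 0 + yy k - of_nat m)"
      by (intro prod.remove) auto
    then have "GX0 n k = (xx 0 + yy k - of_nat k) * (- (fact n ^ 4) * (\<Prod>m\<in>{1..2*n-1}-{k}. xx 0 + yy k - of_nat m)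
        * cert (of_nat n) (of_nat n + 1 - xx 0) (of_nat n + 1 - yy k) * lift (loc (Suc n) 0) * fps_const (loc (Suc n) k))"
      unfolding GX0_def by (simp only: mult_ac)
    then show ?thesis
      by (simp add: balanced_def cf10_mult cf01_mult cf_xx cf_yy cf_of_nat del: of_nat_0)
  next
    case 4
    define c where "c = cert (of_nat n) (of_nat n + 1 - xx 0) (of_nat n + 1 - yy k)"
    have "cf 0 0 (cert 1 (2 - X) (2 - Y)) = 0 \<and> cf (Suc 0) 0 (cert 1 (2 - X) (2 - Y)) = 0 \<and> cf 0 (Suc 0) (cert 1 (2 - X) (2 - Y)) = 0"
      if "cf 0 0 X = 0" "cf (Suc 0) 0 X = 1" "cf 0 (Suc 0) X = 0" "cf 0 0 Y = 2" "cf (Suc 0) 0 Y = 0" "cf 0 (Suc 0) Y = 1" for X Y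
      unfolding cert_defs
      by (simp add: that cf_numeral cf_power cf10_mult cf01_mult cf00_mult)
    from this[of "xx 0" "yy 2"] have "cf 0 0 c = 0 \<and> cf (Suc 0) 0 c = 0 \<and> cf 0 (Suc 0) c = 0"
      using cf_xx[of 0] cf_yy[of 2] by (simp add: c_def 4)
    moreover have "GX0 n k = c * (- (fact n ^ 4) * (\<Prod>m=1..2*n-1. xx 0 + yy k - of_nat m)
        * lift (loc (Suc n) 0) * fps_const (loc (Suc n) k))"
      unfolding GX0_def c_def by (simp only: mult_ac)
    ultimately show ?thesis by (simp add: balanced_def cf10_mult cf01_mult)
  qed
  then show ?thesis by (simp add: balanced_def)
qed

text \<open>The weights of \<open>phi\<close> are chosen such that summation by parts turns the sum over \<open>GX\<close> into sums of
  residues of \<open>GX / x\<close> and \<open>GX / x\<^sup>2\<close>. By the residue theorem these reduce to the pole at \<open>x = 0\<close>, where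
  they cancel because \<open>GX0\<close> is balanced.\<close>

definition hs :: "nat \<Rightarrow> nat \<Rightarrow> rat" where
  "hs s i = (\<Sum>m=1..i. (-1) ^ s / of_nat m ^ s)"

definition phi :: "nat \<Rightarrow> rat fps fps \<Rightarrow> rat" where
  "phi i G = hs 1 i * cf 2 1 G + hs 2 i * (cf 1 1 G + cf 2 0 G)
     + hs 3 i * (cf 0 1 G + 2 * cf 1 0 G) + hs 4 i * (3 * cf 0 0 G)"

lemma phi_add: "phi i (F + G) = phi i F + phi i G"
  and phi_diff: "phi i (F - G) = phi i F - phi i G"
  and phi_scalar: "phi i (fps_const (fps_const c) * F) = c * phi i F"
  unfolding phi_def cf_scalar cf_add cf_diff by (simp_all add: algebra_simps)

lemma abel_sum:
  fixes w g :: "nat \<Rightarrow> rat"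
  assumes "w 0 = 0"
  shows "(\<Sum>i\<le>M. w i * (g (Suc i) - g i)) = w M * g (Suc M) + (\<Sum>i=1..M. (w (i - 1) - w i) * g i)"
  by (induction M) (simp_all add: assms algebra_simps)

lemma hs_0: "hs s 0 = 0" by (simp add: hs_def)

lemma hs_diff: "i \<ge> 1 \<Longrightarrow> hs s (i - 1) - hs s i = - ((-1) ^ s / of_nat i ^ s)"
  by (cases i) (simp_all add: hs_def)

lemma inverse_lin_nth:
  assumes "c \<noteq> 0"
  shows "inverse (lin c) $ 0 = 1 / c" "inverse (lin c) $ Suc 0 = - 1 / c ^ 2" "inverse (lin c) $ 2 = 1 / c ^ 3"
proof -
  have *: "lin c * inverse (lin c) = 1" using assms by (rule lin_cancel)
  from arg_cong[OF *, of "\<lambda>f. fps_nth f 0"] have 0: "c * inverse (lin c) $ 0 = 1" by simp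
  from arg_cong[OF *, of "\<lambda>f. fps_nth f 1"] have 1: "c * inverse (lin c) $ 1 + inverse (lin c) $ 0 = 0"
    by (simp add: distrib_right)
  from arg_cong[OF *, of "\<lambda>f. fps_nth f 2"] have 2: "c * inverse (lin c) $ 2 + inverse (lin c) $ 1 = 0"
    by (simp add: distrib_right)
  show 3: "inverse (lin c) $ 0 = 1 / c" using 0 assms by (simp add: field_simps)
  show 4: "inverse (lin c) $ Suc 0 = - 1 / c ^ 2"
    using 1 unfolding 3 using assms by (simp add: field_simps power2_eq_square)
  show "inverse (lin c) $ 2 = 1 / c ^ 3"
    using 2 unfolding One_nat_def 4 using assms by (simp add: field_simps power2_eq_square power3_eq_cube)
qed

text \<open>At i = 0 the cube comes from the factor x^3, beyond n + 1 from the convention in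
  \<open>loc\<close>. These are the boundary terms of the sums over i.\<close>

lemma GX_ends: "u < 3 \<Longrightarrow> i = 0 \<or> i > Suc n \<Longrightarrow> cf u v (GX n i k) = 0"
proof -
  assume u: "u < 3" and i: "i = 0 \<or> i > Suc n"
  then obtain S where "lin (of_nat i) ^ 3 * loc (Suc n) i = fps_X ^ 3 * S"
  proof (cases "i = 0")
    case False
    then obtain S where "loc (Suc n) i = fps_X ^ 3 * S" using loc_beyond i by blast
    then have "lin (of_nat i) ^ 3 * loc (Suc n) i = fps_X ^ 3 * (lin (of_nat i) ^ 3 * S)" by (simp add: mult_ac)
    then show ?thesis using that by blast
  qed auto
  then have "GX n i k = (- (fact n ^ 4) * (\<Prod>m=1..2*n-1. xx i + yy k - of_nat m)
     * cert (of_nat n) (of_nat n + 1 - xx i) (of_nat n + 1 - yy k) * fps_const (loc (Suc n) k)) * lift (fps_X ^ 3 * S)"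
    unfolding GX_def by (simp add: mult_ac)
  then show ?thesis using u by (simp only: cf_lift_X3)
qed

lemma GY_ends: "v < 3 \<Longrightarrow> k = 0 \<or> k > Suc n \<Longrightarrow> cf u v (GY n i k) = 0"
proof -
  assume v: "v < 3" and k: "k = 0 \<or> k > Suc n"
  then obtain S where "lin (of_nat k) ^ 3 * loc (Suc n) k = fps_X ^ 3 * S"
  proof (cases "k = 0")
    case False
    then obtain S where "loc (Suc n) k = fps_X ^ 3 * S" using loc_beyond k by blast
    then have "lin (of_nat k) ^ 3 * loc (Suc n) k = fps_X ^ 3 * (lin (of_nat k) ^ 3 * S)" by (simp add: mult_ac)
    then show ?thesis using that by blast
  qed auto
  then have "GY n i k = (- (fact n ^ 4) * (\<Prod>m=1..2*n-1. xx i + yy k - of_nat m)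
     * cert (of_nat n) (of_nat n + 1 - yy k) (of_nat n + 1 - xx i) * lift (loc (Suc n) i)) * fps_const (fps_X ^ 3 * S)"
    unfolding GY_def by simp
  then show ?thesis using v by (simp only: cf_const_X3)
qed

lemma sum_phi_GX:
  assumes "n \<ge> 1"
  shows "(\<Sum>i\<le>Suc n. phi i (GX n (Suc i) k) - phi i (GX n i k)) = 0"
proof -
  define g where "g u v i = cf u v (GX n i k)" for u v i
  have gz: "g 2 1 (Suc (Suc n)) = 0" "g 1 1 (Suc (Suc n)) = 0" "g 2 0 (Suc (Suc n)) = 0"
     "g 0 1 (Suc (Suc n)) = 0" "g 1 0 (Suc (Suc n)) = 0" "g 0 0 (Suc (Suc n)) = 0"
    by (auto simp: g_def GX_ends)
  have "(\<Sum>i\<le>Suc n. phi i (GX n (Suc i) k) - phi i (GX n i k))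
    = (\<Sum>i\<le>Suc n. hs 1 i * (g 2 1 (Suc i) - g 2 1 i)) + (\<Sum>i\<le>Suc n. hs 2 i * (g 1 1 (Suc i) - g 1 1 i))
     + (\<Sum>i\<le>Suc n. hs 2 i * (g 2 0 (Suc i) - g 2 0 i)) + (\<Sum>i\<le>Suc n. hs 3 i * (g 0 1 (Suc i) - g 0 1 i))
     + 2 * (\<Sum>i\<le>Suc n. hs 3 i * (g 1 0 (Suc i) - g 1 0 i)) + 3 * (\<Sum>i\<le>Suc n. hs 4 i * (g 0 0 (Suc i) - g 0 0 i))"
    unfolding phi_def g_def sum_distrib_left sum.distrib[symmetric] by (intro sum.cong refl) (simp add: algebra_simps)
  also have "\<dots> = (\<Sum>i=1..Suc n. (hs 1 (i-1) - hs 1 i) * g 2 1 i + (hs 2 (i-1) - hs 2 i) * (g 1 1 i + g 2 0 i)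
      + (hs 3 (i-1) - hs 3 i) * (g 0 1 i + 2 * g 1 0 i) + (hs 4 (i-1) - hs 4 i) * (3 * g 0 0 i))"
    unfolding abel_sum[of "hs 1", OF hs_0] abel_sum[of "hs 2", OF hs_0] abel_sum[of "hs 3", OF hs_0] abel_sum[of "hs 4", OF hs_0]
    unfolding gz mult_zero_right add_0 sum_distrib_left sum.distrib[symmetric]
    by (intro sum.cong refl) (simp add: algebra_simps)
  \<comment> \<open>1/(i + a) and 1/(i + a)^2 begin with 1/i - a/i^2 + a^2/i^3 and 1/i^2 - 2a/i^3 +
    3a^2/i^4. The signs in \<open>hs\<close> and the factors 2 and 3 in \<open>phi\<close> are those
    of these expansions.\<close>
  also have "\<dots> = (\<Sum>i=1..Suc n. cf 2 1 (GX n i k * lift (inverse (lin (of_nat i)) ^ 1))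
       - cf 2 0 (GX n i k * lift (inverse (lin (of_nat i)) ^ 2)))"
  proof (intro sum.cong refl)
    fix i assume "i \<in> {1..Suc n}"
    then have i: "i \<ge> 1" by simp
    then have c: "(of_nat i :: rat) \<noteq> 0" by simp
    have sq: "(inverse (lin (of_nat i)) ^ 2) $ 0 = (inverse (lin (of_nat i)) $ 0)^2"
      "(inverse (lin (of_nat i)) ^ 2) $ Suc 0 = 2 * (inverse (lin (of_nat i)) $ 0) * (inverse (lin (of_nat i)) $ Suc 0)"
      "(inverse (lin (of_nat i)) ^ 2) $ 2 = 2 * (inverse (lin (of_nat i)) $ 0) * (inverse (lin (of_nat i)) $ 2) + (inverse (lin (of_nat i)) $ Suc 0)^2"
      by (simp_all add: power2_eq_square fps_mult_nth numeral_2_eq_2 algebra_simps)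
    show "(hs 1 (i-1) - hs 1 i) * g 2 1 i + (hs 2 (i-1) - hs 2 i) * (g 1 1 i + g 2 0 i)
      + (hs 3 (i-1) - hs 3 i) * (g 0 1 i + 2 * g 1 0 i) + (hs 4 (i-1) - hs 4 i) * (3 * g 0 0 i)
      = cf 2 1 (GX n i k * lift (inverse (lin (of_nat i)) ^ 1))
       - cf 2 0 (GX n i k * lift (inverse (lin (of_nat i)) ^ 2))"
      unfolding cf_mult_lift2 One_nat_def power_Suc0_right sq inverse_lin_nth[OF c]
      using c by (simp only: hs_diff[OF i, unfolded One_nat_def] g_def)
         (simp add: field_simps power2_eq_square power3_eq_cube power4_eq_xxxx)
  qed
  also have "\<dots> = 0"
    \<comment> \<open>The two residue sums are minus the coefficient of b and minus the coefficient
      of a in \<open>GX0 n k\<close>.\<close>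
    unfolding sum_subtractf using assms by (subst res_GX, simp, simp, subst res_GX, simp, simp) (simp add: balanced_GX0)
  finally show ?thesis .
qed

text \<open>The weights depend on i only, so the sum over k telescopes.\<close>

lemma sum_phi_GY: "(\<Sum>k\<le>Suc n. phi i (GY n i (Suc k)) - phi i (GY n i k)) = 0"
proof -
  have "(\<Sum>k\<le>Suc n. phi i (GY n i (Suc k)) - phi i (GY n i k)) = phi i (GY n i (Suc (Suc n))) - phi i (GY n i 0)"
    unfolding lessThan_Suc_atMost[symmetric] by (rule sum_lessThan_telescope)
  then show ?thesis by (simp add: phi_def GY_ends)
qed

lemma FF_ends: "u < 3 \<Longrightarrow> v < 3 \<Longrightarrow> i > n \<or> k > n \<Longrightarrow> cf u v (FF n i k) = 0"
proof -
  assume u: "u < 3" "v < 3" and i: "i > n \<or> k > n"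
  then consider S where "loc n i = fps_X ^ 3 * S" | S where "loc n k = fps_X ^ 3 * S" using loc_beyond by blast
  then show ?thesis
  proof cases
    case 1
    then have "FF n i k = (fact n ^ 4 * (\<Prod>m\<le>2*n. xx i + yy k - of_nat m) * fps_const (loc n k)) * lift (fps_X ^ 3 * S)"
      unfolding FF_def by (simp add: mult_ac)
    then show ?thesis using u by (simp only: cf_lift_X3)
  next
    case 2
    then show ?thesis using u unfolding FF_def by (simp only: cf_const_X3)
  qed
qed

section \<open>The two functionals and their recurrences\<close>

definition Phi :: "nat \<Rightarrow> rat" where "Phi n = (\<Sum>i\<le>n. \<Sum>k\<le>n. phi i (FF n i k))"
definition Asum :: "nat \<Rightarrow> rat" where "Asum n = (\<Sum>i\<le>n. \<Sum>k\<le>n. cf 1 0 (FF n i k))"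

lemma sum_square_mono:
  fixes f :: "nat \<Rightarrow> nat \<Rightarrow> rat"
  assumes "n \<le> M" "\<And>i k. i > n \<or> k > n \<Longrightarrow> f i k = 0"
  shows "(\<Sum>i\<le>M. \<Sum>k\<le>M. f i k) = (\<Sum>i\<le>n. \<Sum>k\<le>n. f i k)"
proof -
  have "(\<Sum>i\<le>M. \<Sum>k\<le>M. f i k) = (\<Sum>i\<le>n. \<Sum>k\<le>M. f i k)"
    using assms by (intro sum.mono_neutral_right ballI sum.neutral) auto
  also have "\<dots> = (\<Sum>i\<le>n. \<Sum>k\<le>n. f i k)"
    using assms by (intro sum.cong refl sum.mono_neutral_right) auto
  finally show ?thesis .
qed

lemma Phi_extend: "n \<le> M \<Longrightarrow> Phi n = (\<Sum>i\<le>M. \<Sum>k\<le>M. phi i (FF n i k))"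
  unfolding Phi_def by (rule sum_square_mono[symmetric]) (auto simp: phi_def FF_ends)

lemma Asum_extend: "n \<le> M \<Longrightarrow> Asum n = (\<Sum>i\<le>M. \<Sum>k\<le>M. cf 1 0 (FF n i k))"
  unfolding Asum_def by (rule sum_square_mono[symmetric]) (auto simp: FF_ends)

abbreviation recurrence :: "(nat \<Rightarrow> rat) \<Rightarrow> nat \<Rightarrow> rat" where
  "recurrence u n \<equiv> 4 * of_nat (Suc n) ^ 2 * (16 * of_nat (Suc n) ^ 2 - 1) * u n
     - (65 * of_nat (Suc n) ^ 4 + 130 * of_nat (Suc n) ^ 3 + 105 * of_nat (Suc n) ^ 2 + 40 * of_nat (Suc n) + 6) * u (Suc n)
     + (of_nat (Suc n) + 1) ^ 4 * u (Suc (Suc n))"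

text \<open>Linear functionals that annihilate the summed certificate differences inherit the
  recurrence from \<open>FF_recurrence\<close>. One range up to n + 2 serves all three indices, and
  the factor N^2 is cancelled at the end.\<close>

lemma linear_recurrence:
  fixes L :: "nat \<Rightarrow> rat fps fps \<Rightarrow> rat" and n :: nat
  assumes add: "\<And>i F G. L i (F + G) = L i F + L i G" and diff: "\<And>i F G. L i (F - G) = L i F - L i G"
    and scalar: "\<And>i c F. L i (fps_const (fps_const c) * F) = c * L i F"
    and X: "\<And>k. (\<Sum>i\<le>Suc (Suc n). L i (GX (Suc n) (Suc i) k) - L i (GX (Suc n) i k)) = 0"
    and Y: "\<And>i. (\<Sum>k\<le>Suc (Suc n). L i (GY (Suc n) i (Suc k)) - L i (GY (Suc n) i k)) = 0"
  defines "S \<equiv> \<lambda>m. \<Sum>i\<le>Suc (Suc n). \<Sum>k\<le>Suc (Suc n). L i (FF m i k)"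
  shows "recurrence S n = 0"
proof -
  define N where "N = (of_nat (Suc n) :: rat)"
  define a where "a = N ^ 2 * (4 * N ^ 2 * (16 * N ^ 2 - 1))"
  define b where "b = N ^ 2 * (65 * N ^ 4 + 130 * N ^ 3 + 105 * N ^ 2 + 40 * N + 6)"
  define c where "c = N ^ 2 * (N + 1) ^ 4"
  let ?c = "\<lambda>c. fps_const (fps_const c) :: rat fps fps"
  have N: "of_nat (Suc n) = ?c N" by (simp only: fps_of_nat N_def)
  have num: "numeral k = ?c (numeral k)" "1 = ?c 1" for k by (simp_all add: numeral_fps_const)
  have eq: "?c a * FF n i k - ?c b * FF (Suc n) i k + ?c c * FF (Suc (Suc n)) i k
     = (GX (Suc n) (Suc i) k - GX (Suc n) i k) + (GY (Suc n) i (Suc k) - GY (Suc n) i k)" for i k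
  proof -
    have abc: "?c a = ?c N ^ 2 * (4 * ?c N ^ 2 * (16 * ?c N ^ 2 - 1))"
        "?c b = ?c N ^ 2 * (65 * ?c N ^ 4 + 130 * ?c N ^ 3 + 105 * ?c N ^ 2 + 40 * ?c N + 6)"
        "?c c = ?c N ^ 2 * (?c N + 1) ^ 4"
      unfolding a_def b_def c_def num by (simp_all only: fps_const_mult fps_const_add fps_const_sub fps_const_power)
    show ?thesis
      unfolding FF_recurrence[of n i k, unfolded N, symmetric] abc by (simp only: algebra_simps)
  qed
  have "a * S n - b * S (Suc n) + c * S (Suc (Suc n)) = (\<Sum>i\<le>Suc (Suc n). \<Sum>k\<le>Suc (Suc n).
       L i (?c a * FF n i k - ?c b * FF (Suc n) i k + ?c c * FF (Suc (Suc n)) i k))"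
    unfolding add diff scalar S_def by (simp add: sum.distrib sum_subtractf sum_distrib_left del: sum.atMost_Suc)
  also have "\<dots> = (\<Sum>i\<le>Suc (Suc n). \<Sum>k\<le>Suc (Suc n). L i (GX (Suc n) (Suc i) k) - L i (GX (Suc n) i k))
     + (\<Sum>i\<le>Suc (Suc n). \<Sum>k\<le>Suc (Suc n). L i (GY (Suc n) i (Suc k)) - L i (GY (Suc n) i k))"
    unfolding eq add diff by (simp add: sum.distrib del: sum.atMost_Suc)
  also have "\<dots> = 0" unfolding Y by (subst sum.swap) (simp only: X sum.neutral_const)
  finally have "N ^ 2 * (4 * N ^ 2 * (16 * N ^ 2 - 1) * S n
      - (65 * N ^ 4 + 130 * N ^ 3 + 105 * N ^ 2 + 40 * N + 6) * S (Suc n)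
      + (N + 1) ^ 4 * S (Suc (Suc n))) = 0"
    unfolding a_def b_def c_def by (simp only: algebra_simps)
  then show ?thesis by (simp add: N_def del: of_nat_Suc)
qed

lemma Phi_recurrence:
  shows "recurrence Phi n = 0"
  using linear_recurrence[of phi n, OF phi_add phi_diff phi_scalar sum_phi_GX sum_phi_GY]
    Phi_extend[of n "Suc (Suc n)"] Phi_extend[of "Suc n" "Suc (Suc n)"] Phi_extend[of "Suc (Suc n)" "Suc (Suc n)"]
  by simp

text \<open>With constant weights both certificate sums telescope to zero.\<close>

lemma Asum_recurrence:
  shows "recurrence Asum n = 0"
proof -
  have X: "(\<Sum>i\<le>Suc m. cf 1 0 (GX m (Suc i) k) - cf 1 0 (GX m i k)) = 0" for m k
    unfolding lessThan_Suc_atMost[symmetric] sum_lessThan_telescope[of "\<lambda>i. cf 1 0 (GX m i k)"]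
    by (simp add: GX_ends)
  have Y: "(\<Sum>k\<le>Suc m. cf 1 0 (GY m i (Suc k)) - cf 1 0 (GY m i k)) = 0" for m i
    unfolding lessThan_Suc_atMost[symmetric] sum_lessThan_telescope[of "\<lambda>k. cf 1 0 (GY m i k)"]
    by (simp add: GY_ends)
  show ?thesis
    using linear_recurrence[of "\<lambda>_. cf 1 0" n, OF cf_add cf_diff cf_scalar X Y]
      Asum_extend[of n "Suc (Suc n)"] Asum_extend[of "Suc n" "Suc (Suc n)"] Asum_extend[of "Suc (Suc n)" "Suc (Suc n)"] by simp
qed

section \<open>Explicit double sums\<close>

definition HH :: "nat \<Rightarrow> nat \<Rightarrow> rat" where
  "HH s n = (\<Sum>m=1..n. 1 / of_nat m ^ s)"

definition tt :: "nat \<Rightarrow> nat \<Rightarrow> nat \<Rightarrow> rat" where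
  "tt n i k = fact n ^ 4 * fact (i + k) * fact (2 * n - (i + k)) / (fact i * fact k * fact (n - i) * fact (n - k)) ^ 3"

lemma split_range: "i \<le> n \<Longrightarrow> {..n::nat} - {i} = {..<i} \<union> {i<..n}"
  by auto

lemma prod_diff_nodes:
  assumes "i \<le> n"
  shows "(\<Prod>j\<in>{..n} - {i}. of_nat i - of_nat j :: rat) = (-1) ^ (n - i) * (fact i * fact (n - i))"
proof -
  have 1: "(\<Prod>j<i. of_nat i - of_nat j :: rat) = fact i"
  proof -
    have "(\<Prod>j<i. of_nat i - of_nat j :: rat) = (\<Prod>j<i. of_nat (i - j))"
      by (intro prod.cong) (auto simp: of_nat_diff)
    then show ?thesis by (simp add: fact_prod_rev atLeast0LessThan)
  qed
  have "(\<Prod>j\<in>{i<..n}. of_nat i - of_nat j :: rat) = (\<Prod>m\<in>{1..n-i}. of_nat i - of_nat (i + m))"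
    using assms by (intro prod.reindex_bij_witness[of _ "\<lambda>m. i + m" "\<lambda>j. j - i"]) auto
  also have "\<dots> = (\<Prod>m\<in>{1..n-i}. - 1 * of_nat m)" by simp
  also have "\<dots> = (-1) ^ (n - i) * fact (n - i)"
    unfolding prod.distrib by (simp add: fact_prod)
  finally have 2: "(\<Prod>j\<in>{i<..n}. of_nat i - of_nat j :: rat) = (-1) ^ (n - i) * fact (n - i)" .
  show ?thesis unfolding split_range[OF assms] using 1 2
    by (subst prod.union_disjoint) auto
qed

lemma sum_diff_nodes:
  assumes "i \<le> n"
  shows "(\<Sum>j\<in>{..n} - {i}. 1 / (of_nat i - of_nat j :: rat) ^ s) = HH s i + (-1) ^ s * HH s (n - i)"
proof -
  have 1: "(\<Sum>j<i. 1 / (of_nat i - of_nat j :: rat) ^ s) = HH s i"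
    unfolding HH_def by (intro sum.reindex_bij_witness[of _ "\<lambda>m. i - m" "\<lambda>j. i - j"]) (auto simp: of_nat_diff)
  have "(\<Sum>j\<in>{i<..n}. 1 / (of_nat i - of_nat j :: rat) ^ s) = (\<Sum>m\<in>{1..n-i}. 1 / (of_nat i - of_nat (i + m)) ^ s)"
    using assms by (intro sum.reindex_bij_witness[of _ "\<lambda>m. i + m" "\<lambda>j. j - i"]) auto
  also have "\<dots> = (\<Sum>m\<in>{1..n-i}. (-1) ^ s * (1 / of_nat m ^ s))"
  proof (intro sum.cong refl)
    fix m
    have "(of_nat i - of_nat (i + m) :: rat) ^ s = (-1) ^ s * of_nat m ^ s"
      by (simp add: power_minus[of "of_nat m"])
    moreover have "1 / ((-1 :: rat) ^ s) = (-1) ^ s" by (cases "even s") simp_all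
    ultimately show "1 / (of_nat i - of_nat (i + m) :: rat) ^ s = (-1) ^ s * (1 / of_nat m ^ s)"
      by (metis divide_divide_eq_left times_divide_eq_right mult.right_neutral)
  qed
  finally have 2: "(\<Sum>j\<in>{i<..n}. 1 / (of_nat i - of_nat j :: rat) ^ s) = (-1) ^ s * HH s (n - i)"
    by (simp add: HH_def sum_distrib_left)
  show ?thesis unfolding split_range[OF assms] using 1 2
    by (subst sum.union_disjoint) auto
qed

text \<open>The series is its constant term times exp(-3 L X + 3/2 L2 X^2 - ...).\<close>

lemma prod_inverse_lin_nth:
  assumes "finite A" "\<And>a. a \<in> A \<Longrightarrow> c a \<noteq> 0"
  defines "W \<equiv> inverse (\<Prod>a\<in>A. lin (c a)) ^ 3" and "L \<equiv> (\<Sum>a\<in>A. 1 / c a)" and "L2 \<equiv> (\<Sum>a\<in>A. 1 / c a ^ 2)"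
  shows "W $ 0 = 1 / (\<Prod>a\<in>A. c a) ^ 3 \<and> W $ Suc 0 = - 3 * L * W $ 0 \<and> W $ 2 = (9 / 2 * L ^ 2 + 3 / 2 * L2) * W $ 0"
  using assms(1,2) unfolding W_def L_def L2_def
proof (induction A)
  case (insert a A)
  let ?I = "inverse (lin (c a))"
  let ?W = "inverse (\<Prod>a\<in>A. lin (c a)) ^ 3"
  have c: "c a \<noteq> 0" using insert by auto
  have m0: "(F * G) $ 0 = F $ 0 * G $ 0" "(F * G) $ Suc 0 = F $ 0 * G $ Suc 0 + F $ Suc 0 * G $ 0"
    "(F * G) $ 2 = F $ 0 * G $ 2 + F $ Suc 0 * G $ Suc 0 + F $ 2 * G $ 0" for F G :: "rat fps"
    by (simp_all add: fps_mult_nth numeral_2_eq_2)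
  have I: "(?I ^ 3) $ 0 = 1 / c a ^ 3" "(?I ^ 3) $ Suc 0 = - 3 / c a ^ 4" "(?I ^ 3) $ 2 = 6 / c a ^ 5"
    unfolding power3_eq_cube m0 inverse_lin_nth[OF c] using c by (simp_all add: field_simps eval_nat_numeral)
  have W: "inverse (\<Prod>a\<in>insert a A. lin (c a)) ^ 3 = ?I ^ 3 * ?W"
    using insert by (simp add: fps_inverse_mult power_mult_distrib)
  show ?case
    unfolding W m0 I using insert c by (simp add: field_simps eval_nat_numeral)
qed (simp add: eval_nat_numeral)

lemma loc_nth:
  assumes "i \<le> n"
  shows "loc n i $ 0 = 1 / ((-1) ^ (n - i) * (fact i * fact (n - i))) ^ 3"
    and "loc n i $ Suc 0 = - 3 * (HH 1 i - HH 1 (n - i)) * loc n i $ 0"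
    and "loc n i $ 2 = (9 / 2 * (HH 1 i - HH 1 (n - i)) ^ 2 + 3 / 2 * (HH 2 i + HH 2 (n - i))) * loc n i $ 0"
proof -
  have W: "loc n i = inverse (\<Prod>a\<in>{..n} - {i}. lin (of_nat i - of_nat a)) ^ 3"
    using assms by (simp add: loc_def)
  have L: "(\<Sum>j\<in>{..n} - {i}. 1 / (of_nat i - of_nat j :: rat)) = HH 1 i - HH 1 (n - i)"
     "(\<Sum>j\<in>{..n} - {i}. 1 / (of_nat i - of_nat j :: rat) ^ 2) = HH 2 i + HH 2 (n - i)"
    using sum_diff_nodes[OF assms, of 1] sum_diff_nodes[OF assms, of 2] by simp_all
  note * = prod_inverse_lin_nth[of "{..n} - {i}" "\<lambda>a. of_nat i - of_nat a", unfolded prod_diff_nodes[OF assms] L, folded W]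
  show "loc n i $ 0 = 1 / ((-1) ^ (n - i) * (fact i * fact (n - i))) ^ 3"
     "loc n i $ Suc 0 = - 3 * (HH 1 i - HH 1 (n - i)) * loc n i $ 0"
     "loc n i $ 2 = (9 / 2 * (HH 1 i - HH 1 (n - i)) ^ 2 + 3 / 2 * (HH 2 i + HH 2 (n - i))) * loc n i $ 0"
    using * by auto
qed

section \<open>Expansion of f_n after removal of the factor a + b\<close>

lemma cf20_mult: "cf 2 0 (F * G) = cf 2 0 F * cf 0 0 G + cf (Suc 0) 0 F * cf (Suc 0) 0 G + cf 0 0 F * cf 2 0 G"
  and cf02_mult: "cf 0 2 (F * G) = cf 0 2 F * cf 0 0 G + cf 0 (Suc 0) F * cf 0 (Suc 0) G + cf 0 0 F * cf 0 2 G"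
  and cf11_mult: "cf (Suc 0) (Suc 0) (F * G) = cf (Suc 0) (Suc 0) F * cf 0 0 G + cf (Suc 0) 0 F * cf 0 (Suc 0) G
      + cf 0 (Suc 0) F * cf (Suc 0) 0 G + cf 0 0 F * cf (Suc 0) (Suc 0) G"
  by (simp_all add: cf_def fps_mult_nth numeral_2_eq_2)

definition ab :: "rat fps fps" where "ab = fps_X + fps_const fps_X"

lemma cf_ab: "cf 0 0 (ab * T) = 0" "cf (Suc 0) 0 (ab * T) = cf 0 0 T" "cf 0 (Suc 0) (ab * T) = cf 0 0 T"
  "cf (Suc 0) (Suc 0) (ab * T) = cf 0 (Suc 0) T + cf (Suc 0) 0 T" "cf 2 0 (ab * T) = cf (Suc 0) 0 T"
  "cf 0 2 (ab * T) = cf 0 (Suc 0) T"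
  "cf 2 (Suc 0) (ab * T) = cf (Suc 0) (Suc 0) T + cf 2 0 T" "cf (Suc 0) 2 (ab * T) = cf (Suc 0) (Suc 0) T + cf 0 2 T"
  by (simp_all add: ab_def cf_def distrib_right numeral_2_eq_2)

lemma cf_linear_form: "cf 0 0 (ab + fps_const (fps_const c)) = c" "cf (Suc 0) 0 (ab + fps_const (fps_const c)) = 1"
  "cf 0 (Suc 0) (ab + fps_const (fps_const c)) = 1" "cf 2 0 (ab + fps_const (fps_const c)) = 0"
  "cf 0 2 (ab + fps_const (fps_const c)) = 0" "cf (Suc 0) (Suc 0) (ab + fps_const (fps_const c)) = 0"
  by (simp_all add: ab_def cf_def)

text \<open>The product is a function of a + b, which forces the relations between its
  coefficients.\<close>

lemma prod_linear_form:
  assumes "finite A" "\<And>a. a \<in> A \<Longrightarrow> c a \<noteq> 0"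
  defines "F \<equiv> (\<Prod>a\<in>A. ab + fps_const (fps_const (c a)))"
  shows "cf 0 0 F = (\<Prod>a\<in>A. c a) \<and> cf (Suc 0) 0 F = (\<Prod>a\<in>A. c a) * (\<Sum>a\<in>A. 1 / c a)
    \<and> cf 0 (Suc 0) F = cf (Suc 0) 0 F \<and> cf 0 2 F = cf 2 0 F \<and> cf (Suc 0) (Suc 0) F = 2 * cf 2 0 F"
  using assms(1,2) unfolding F_def
proof (induction A)
  case empty
  have "cf 2 0 1 = 0" "cf 0 2 1 = 0" "cf (Suc 0) (Suc 0) 1 = 0" by (simp_all add: cf_def)
  then show ?case by (simp add: cf_numeral)
next
  case (insert a A)
  define E where "E = ab + fps_const (fps_const (c a))"
  note E = cf_linear_form[of "c a", folded E_def]
  have "c a \<noteq> 0" using insert by simp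
  with insert show ?case
    by (simp add: cf00_mult cf10_mult cf01_mult cf20_mult cf02_mult cf11_mult E field_simps flip: E_def)
qed

lemma xx_yy_form: "xx i + yy k - of_nat m = ab + fps_const (fps_const (of_nat (i + k) - of_nat m))"
  by (simp add: ab_def lift_add lift_const lift_X fps_of_nat flip: fps_const_add fps_const_sub)

lemma fact4_const: "fact n ^ 4 = fps_const (fps_const (fact n ^ 4 :: rat))"
proof -
  have "fact n = fps_const (fps_const (fact n :: rat))"
    by (metis fps_of_nat of_nat_fact)
  then show ?thesis by (simp only: fps_const_power)
qed

locale local_expansion =
  fixes n i k :: nat
  assumes ik: "i \<le> n" "k \<le> n"
begin

definition T :: "rat fps fps" where
  "T = fps_const (fps_const (fact n ^ 4)) * ((\<Prod>m\<in>{..2*n} - {i + k}. ab + fps_const (fps_const (of_nat (i + k) - of_nat m)))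
      * (lift (loc n i) * fps_const (loc n k)))"

lemma FF_eq: "FF n i k = ab * T"
proof -
  have "(\<Prod>m\<le>2*n. xx i + yy k - of_nat m) = ab * (\<Prod>m\<in>{..2*n} - {i + k}. ab + fps_const (fps_const (of_nat (i + k) - of_nat m)))"
    unfolding xx_yy_form using ik by (subst prod.remove[of _ "i + k"]) auto
  then show ?thesis unfolding FF_def T_def fact4_const by (simp only: mult_ac)
qed

text \<open>\<open>D0\<close> and \<open>Dp\<close> are the difference and the sum of the two
  logarithmic derivatives of \<open>T\<close> at the origin.\<close>

definition D0 :: rat where "D0 = 3 * (HH 1 (n - i) - HH 1 i - HH 1 (n - k) + HH 1 k)"
definition Dp :: rat where "Dp = 3 * (HH 1 (n - i) - HH 1 i + HH 1 (n - k) - HH 1 k) + 2 * (HH 1 (i + k) - HH 1 (2 * n - (i + k)))"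

text \<open>Relative to the constant term, the coefficient of a^2 is half of the squared first plus
  the second logarithmic derivative, and likewise for b^2. In the difference the second derivatives
  of the product over m cancel, as it is a function of a + b; hence no \<open>HH 2 (i + k)\<close>
  occurs.\<close>

lemma T_coeffs:
  shows "cf 0 0 T = tt n i k"
    and "cf (Suc 0) 0 T - cf 0 (Suc 0) T = tt n i k * D0"
    and "cf 2 0 T - cf 0 2 T = tt n i k * ((D0 * Dp + 3 * (HH 2 i + HH 2 (n - i) - HH 2 k - HH 2 (n - k))) / 2)"
proof -
  define s where "s = i + k"
  have s: "s \<le> 2 * n" using ik by (simp add: s_def)
  define S where "S = (\<Prod>m\<in>{..2*n} - {s}. ab + fps_const (fps_const (of_nat s - of_nat m)))"
  define U where "U = loc n i"
  define V where "V = loc n k"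
  have uv: "cf u v (lift U * fps_const V) = U $ u * V $ v" for u v by (simp add: cf_def)
  have sig: "(\<Sum>j\<in>{..2*n} - {s}. 1 / (of_nat s - of_nat j :: rat)) = HH 1 s - HH 1 (2 * n - s)"
    using sum_diff_nodes[OF s, of 1] by simp
  have S: "cf 0 0 S = (-1) ^ (2 * n - s) * (fact s * fact (2 * n - s))"
     "cf (Suc 0) 0 S = cf 0 0 S * (HH 1 s - HH 1 (2 * n - s))" "cf 0 (Suc 0) S = cf (Suc 0) 0 S" "cf 0 2 S = cf 2 0 S"
    using prod_linear_form[of "{..2*n} - {s}" "\<lambda>m. of_nat s - of_nat m"] unfolding S_def[symmetric] prod_diff_nodes[OF s] sig
    by auto
  have T: "T = fps_const (fps_const (fact n ^ 4)) * (S * (lift U * fps_const V))"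
    by (simp add: T_def S_def U_def V_def s_def)
  note U = loc_nth[OF ik(1), folded U_def] and V = loc_nth[OF ik(2), folded V_def]
  have t: "fact n ^ 4 * (cf 0 0 S * (U $ 0 * V $ 0)) = tt n i k"
  proof -
    have "(-1 :: rat) ^ (2 * n - s) = (-1) ^ (n - i) * (-1) ^ (n - k)"
      using ik by (simp add: s_def mult_2 flip: power_add)
    moreover have "((-1 :: rat) ^ m) ^ 3 = (-1) ^ m" "(-1 :: rat) ^ m * (-1) ^ m = 1" for m
      by (simp_all add: power3_eq_cube flip: power_add)
    ultimately show ?thesis unfolding S U V tt_def s_def[symmetric]
      by (simp add: power_mult_distrib field_simps)
  qed
  show "cf 0 0 T = tt n i k"
    unfolding T cf_scalar cf00_mult[of S] uv t ..
  have "cf (Suc 0) 0 T - cf 0 (Suc 0) T = fact n ^ 4 * (cf 0 0 S * (U $ 0 * V $ 0)) * D0"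
    unfolding T cf_scalar cf10_mult[of S] cf01_mult[of S] uv S(2,3) U(2,3) V(2,3) D0_def by (simp add: algebra_simps)
  then show "cf (Suc 0) 0 T - cf 0 (Suc 0) T = tt n i k * D0" unfolding t .
  have "cf 2 0 T - cf 0 2 T = fact n ^ 4 * (cf 0 0 S * (U $ 0 * V $ 0)) * ((D0 * Dp + 3 * (HH 2 i + HH 2 (n - i) - HH 2 k - HH 2 (n - k))) / 2)"
    unfolding T cf_scalar cf20_mult[of S] cf02_mult[of S] uv S(2-4) U(2,3) V(2,3) D0_def Dp_def s_def[symmetric]
    by (simp add: field_simps power2_eq_square)
  then show "cf 2 0 T - cf 0 2 T = tt n i k * ((D0 * Dp + 3 * (HH 2 i + HH 2 (n - i) - HH 2 k - HH 2 (n - k))) / 2)"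
    unfolding t .
qed
end

lemma prod_expand_inner:
  "\<exists>q. \<forall>y. (\<Prod>m<M. xx i + y - of_nat m) = (\<Sum>d\<le>M. lift (q d) * y ^ d)"
proof (induction M)
  case 0
  show ?case by (rule exI[of _ "\<lambda>_. 1"]) simp
next
  case (Suc M)
  then obtain q where q: "\<And>y. (\<Prod>m<M. xx i + y - of_nat m) = (\<Sum>d\<le>M. lift (q d) * y ^ d)" by blast
  define c where "c = lin (of_nat i) - of_nat M"
  define r where "r d = (if d \<le> M then c * q d else 0) + (if d = 0 then 0 else q (d - 1))" for d
  have l0: "lift 0 = 0" by (simp add: fps_eq_iff)
  have "(\<Prod>m<Suc M. xx i + y - of_nat m) = (\<Sum>d\<le>Suc M. lift (r d) * y ^ d)" for y
  proof -
    have c: "xx i + y - of_nat M = lift c + y" by (simp add: c_def lift_diff)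
    have "(\<Sum>d\<le>Suc M. lift (r d) * y ^ d) = (\<Sum>d\<le>Suc M. lift (if d \<le> M then c * q d else 0) * y ^ d)
       + (\<Sum>d\<le>Suc M. lift (if d = 0 then 0 else q (d - 1)) * y ^ d)"
      by (simp only: r_def lift_add distrib_right sum.distrib)
    also have "(\<Sum>d\<le>Suc M. lift (if d \<le> M then c * q d else 0) * y ^ d) = lift c * (\<Sum>d\<le>M. lift (q d) * y ^ d)"
      by (simp add: l0 lift_mult sum_distrib_left mult_ac)
    also have "(\<Sum>d\<le>Suc M. lift (if d = 0 then 0 else q (d - 1)) * y ^ d) = y * (\<Sum>d\<le>M. lift (q d) * y ^ d)"
      by (subst sum.atMost_Suc_shift) (simp add: l0 sum_distrib_left mult_ac)
    finally show ?thesis using q[of y] c by (simp add: algebra_simps)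
  qed
  then show ?case by blast
qed

text \<open>For fixed x these are the residues in y of a function whose numerator has degree 2n + 1
  and whose denominator has degree 3n + 3.\<close>

lemma slice_sum: "(\<Sum>k\<le>n. cf u 2 (FF n i k)) = 0"
proof -
  obtain q where q: "\<And>y. (\<Prod>m<2*n+1. xx i + y - of_nat m) = (\<Sum>d\<le>2*n+1. lift (q d) * y ^ d)"
    using prod_expand_inner by blast
  have "cf u 2 (FF n i k) = fact n ^ 4 * (\<Sum>d\<le>2*n+1. (q d * loc n i) $ u * (lin (of_nat k) ^ d * loc n k) $ 2)" for k
  proof -
    have "FF n i k = fps_const (fps_const (fact n ^ 4)) * (\<Sum>d\<le>2*n+1. fps_const (lin (of_nat k) ^ d * loc n k) * lift (q d * loc n i))"
      unfolding FF_def fact4_const lessThan_Suc_atMost[of "2*n", symmetric] Suc_eq_plus1 q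
      by (simp add: sum_distrib_left sum_distrib_right lift_mult mult_ac flip: fps_const_mult fps_const_power del: sum.atMost_Suc)
    then show ?thesis by (simp only: cf_scalar cf_sum cf_lift_const)
  qed
  then have "(\<Sum>k\<le>n. cf u 2 (FF n i k)) = fact n ^ 4 * (\<Sum>d\<le>2*n+1. (q d * loc n i) $ u * (\<Sum>k\<le>n. (lin (of_nat k) ^ d * loc n k) $ 2))"
    unfolding sum_distrib_left by (subst sum.swap) (simp only:)
  also have "\<dots> = 0"
    by (intro mult_eq_0_iff[THEN iffD2] disjI2 sum.neutral ballI sum_res_loc) auto
  finally show ?thesis .
qed

text \<open>What is left of \<open>- phi i (FF n i k)\<close> once the coefficients of b^2, whose
  sums over k vanish, are split off. The weight \<open>hs 4\<close> disappears because
  \<open>FF n i k\<close> has no constant coefficient.\<close>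

definition Cterm :: "nat \<Rightarrow> nat \<Rightarrow> nat \<Rightarrow> rat" where
  "Cterm n i k = tt n i k * (HH 1 i * ((local_expansion.D0 n i k * local_expansion.Dp n i k
      + 3 * (HH 2 i + HH 2 (n - i) - HH 2 k - HH 2 (n - k))) / 2) - 2 * HH 2 i * local_expansion.D0 n i k + 3 * HH 3 i)"

lemma hs_HH: "hs s i = (-1) ^ s * HH s i"
  by (simp add: hs_def HH_def sum_distrib_left)

lemma Asum_explicit: "Asum n = (\<Sum>i\<le>n. \<Sum>k\<le>n. tt n i k)"
  unfolding Asum_def
proof (intro sum.cong refl)
  fix i k assume "i \<in> {..n}" "k \<in> {..n}"
  then interpret local_expansion n i k by unfold_locales auto
  show "cf 1 0 (FF n i k) = tt n i k" by (simp add: FF_eq cf_ab T_coeffs)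
qed

lemma Phi_explicit: "Phi n = - (\<Sum>i\<le>n. \<Sum>k\<le>n. Cterm n i k)"
proof -
  have "phi i (FF n i k) = - Cterm n i k + hs 1 i * cf 1 2 (FF n i k) + 3 * hs 2 i * cf 0 2 (FF n i k)"
    if "i \<le> n" "k \<le> n" for i k
  proof -
    interpret local_expansion n i k using that by unfold_locales auto
    \<comment> \<open>For F = (a + b) T the coefficients satisfy F_21 = F_12 + T_20 - T_02 and F_11
      + F_20 = 3 F_02 + 2 (T_10 - T_01), which trades coefficients of F for those with b^2.\<close>
    have "phi i (FF n i k) = hs 1 i * (cf 2 0 T - cf 0 2 T) + 2 * hs 2 i * (cf (Suc 0) 0 T - cf 0 (Suc 0) T) + 3 * hs 3 i * cf 0 0 T
        + hs 1 i * cf 1 2 (FF n i k) + 3 * hs 2 i * cf 0 2 (FF n i k)"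
      unfolding phi_def One_nat_def FF_eq cf_ab by (simp add: algebra_simps)
    also have "hs 1 i * (cf 2 0 T - cf 0 2 T) + 2 * hs 2 i * (cf (Suc 0) 0 T - cf 0 (Suc 0) T) + 3 * hs 3 i * cf 0 0 T = - Cterm n i k"
      unfolding T_coeffs Cterm_def hs_HH by (simp add: field_simps)
    finally show ?thesis .
  qed
  then have "Phi n = (\<Sum>i\<le>n. \<Sum>k\<le>n. - Cterm n i k + hs 1 i * cf 1 2 (FF n i k) + 3 * hs 2 i * cf 0 2 (FF n i k))"
    unfolding Phi_def by (intro sum.cong refl) auto
  also have "\<dots> = - (\<Sum>i\<le>n. \<Sum>k\<le>n. Cterm n i k)"
    by (simp only: sum.distrib sum_negf sum_distrib_left[symmetric] slice_sum) simp
  finally show ?thesis .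
qed

section \<open>Uniqueness of solutions and the explicit formulas\<close>

lemma recurrence_unique:
  fixes u v :: "nat \<Rightarrow> rat"
  assumes "solves_recurrence u" "u 0 = v 0" "u 1 = v 1"
    and v: "\<And>n. recurrence v n = 0"
  shows "u n = v n"
proof -
  have "u n = v n \<and> u (Suc n) = v (Suc n)"
  proof (induction n)
    case (Suc n)
    define N where "N = (of_nat (Suc n) :: rat)"
    have N: "(N + 1) ^ 4 \<noteq> 0" unfolding N_def by (metis Suc_eq_plus1 of_nat_1 of_nat_add of_nat_eq_0_iff power_not_zero nat.distinct(1))
    have "4 * N ^ 2 * (16 * N ^ 2 - 1) * u n
      - (65 * N ^ 4 + 130 * N ^ 3 + 105 * N ^ 2 + 40 * N + 6) * u (Suc n)
      + (N + 1) ^ 4 * u (Suc (Suc n)) = 0"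
      using assms(1)[unfolded solves_recurrence_def, rule_format, of "Suc n"] by (simp add: N_def)
    moreover note v[of n, folded N_def]
    ultimately have "(N + 1) ^ 4 * u (Suc (Suc n)) = (N + 1) ^ 4 * v (Suc (Suc n))"
      using Suc by (metis (no_types, lifting) add_left_imp_eq)
    with N Suc show ?case by simp
  qed (use assms in auto)
  then show ?thesis ..
qed

theorem A_explicit:
  assumes "solves_recurrence A" "A 0 = 1" "A 1 = 6"
  shows "A n = (\<Sum>i\<le>n. \<Sum>k\<le>n. tt n i k)"
proof -
  have "Asum 0 = 1" "Asum 1 = 6" by (simp_all add: Asum_explicit tt_def)
  then have "A n = Asum n"
    using recurrence_unique[OF assms(1), of Asum n] Asum_recurrence assms(2,3) by metis
  then show ?thesis by (simp add: Asum_explicit)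
qed

theorem C_explicit:
  assumes "solves_recurrence C" "C 0 = 0" "C 1 = 1"
  shows "21 * C n = (\<Sum>i\<le>n. \<Sum>k\<le>n. Cterm n i k)"
proof -
  \<comment> \<open>The functional takes the values 0 and -21 at n = 0 and n = 1.\<close>
  define v where "v n = - Phi n / 21" for n
  have D: "local_expansion.D0 n i k = 3 * (HH 1 (n - i) - HH 1 i - HH 1 (n - k) + HH 1 k)"
    "local_expansion.Dp n i k = 3 * (HH 1 (n - i) - HH 1 i + HH 1 (n - k) - HH 1 k) + 2 * (HH 1 (i + k) - HH 1 (2 * n - (i + k)))"
    if "i \<le> n" "k \<le> n" for n i k
    using that by (simp_all add: local_expansion.D0_def local_expansion.Dp_def local_expansion_def)
  have v0: "v 0 = 0" "v 1 = 1"
    by (simp_all add: v_def Phi_explicit Cterm_def tt_def HH_def D)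
  have "C n = v n"
  proof (rule recurrence_unique[OF assms(1)])
    fix n
    show "recurrence v n = 0"
    proof -
      have "a * (- p / 21) - b * (- q / 21) + c * (- r / 21) = 0" if "a * p - b * q + c * r = 0" for a b c p q r :: rat
        using that by (simp add: field_simps)
      from this[OF Phi_recurrence[of n]] show ?thesis unfolding v_def .
    qed
  qed (use assms v0 in auto)
  then show ?thesis by (simp add: v_def Phi_explicit)
qed

section \<open>Congruences in the localization of the integers\<close>

lemma Zloc_iff:
  assumes "prime p"
  shows "x \<in> Zloc p \<longleftrightarrow> (\<exists>a b::int. x = of_int a / of_int b \<and> \<not> int p dvd b)"
proof -
  have "(of_int b :: rat) \<in> {of_nat p * s |s. s \<in> \<int>} \<longleftrightarrow> int p dvd b" for b
  proof
    assume "(of_int b :: rat) \<in> {of_nat p * s |s. s \<in> \<int>}"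
    then obtain k where "(of_int b :: rat) = of_nat p * of_int k" by (auto elim!: Ints_cases)
    then have "(of_int b :: rat) = of_int (int p * k)" by simp
    then show "int p dvd b" by (simp only: of_int_eq_iff) simp
  next
    assume "int p dvd b"
    then obtain k where "b = int p * k" by (elim dvdE)
    then show "(of_int b :: rat) \<in> {of_nat p * s |s. s \<in> \<int>}" by auto
  qed
  then have eq: "x \<in> Zloc p \<longleftrightarrow> (\<exists>a b. x = a / b \<and> a \<in> \<int> \<and> b \<in> \<int> \<and> b \<notin> {of_nat p * s |s. s \<in> \<int>})"
    and *: "\<And>b. (of_int b :: rat) \<notin> {of_nat p * s |s. s \<in> \<int>} \<longleftrightarrow> \<not> int p dvd b"
    unfolding Zloc_def localization_def by auto
  show ?thesis unfolding eq
  proof (intro iffI; elim exE conjE)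
    fix a b :: rat
    assume "x = a / b" "a \<in> \<int>" "b \<in> \<int>" and b: "b \<notin> {of_nat p * s |s. s \<in> \<int>}"
    then obtain a' b' where "a = of_int a'" "b = of_int b'" "x = a / b" by (auto elim!: Ints_cases)
    with b show "\<exists>a b::int. x = of_int a / of_int b \<and> \<not> int p dvd b" using * by blast
  next
    fix a b :: int
    assume "x = of_int a / of_int b" "\<not> int p dvd b"
    then show "\<exists>a b. x = a / b \<and> a \<in> \<int> \<and> b \<in> \<int> \<and> b \<notin> {of_nat p * s |s. s \<in> \<int>}"
      using *[of b] Ints_of_int by blast
  qed
qed

locale padic =
  fixes p :: nat
  assumes prime_p: "prime p" and p_ge_5: "p \<ge> 5"
begin

abbreviation P :: rat where "P \<equiv> of_nat p"
abbreviation R :: "rat set" where "R \<equiv> Zloc p"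

lemma R_iff: "x \<in> R \<longleftrightarrow> (\<exists>a b::int. x = of_int a / of_int b \<and> \<not> int p dvd b)"
  by (rule Zloc_iff[OF prime_p])

lemma prime_int_p: "prime (int p)" using prime_p by simp

lemma R_of_int [simp, intro]: "of_int a \<in> R"
  unfolding R_iff using prime_gt_1_nat[OF prime_p] by (intro exI[of _ a] exI[of _ 1]) auto

lemma R_numbers [simp, intro]: "of_nat m \<in> R" "0 \<in> R" "1 \<in> R" "numeral k \<in> R"
  using R_of_int[of "int m"] R_of_int[of 0] R_of_int[of 1] R_of_int[of "numeral k"] by simp_all

lemma R_uminus [intro]: "x \<in> R \<Longrightarrow> - x \<in> R"
  unfolding R_iff
proof (elim exE conjE)
  fix a b assume "x = of_int a / of_int b" "\<not> int p dvd b"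
  then show "\<exists>a b. - x = of_int a / of_int b \<and> \<not> int p dvd b"
    by (intro exI[of _ "- a"] exI[of _ b]) simp
qed

lemma R_add [intro]: "x \<in> R \<Longrightarrow> y \<in> R \<Longrightarrow> x + y \<in> R"
  unfolding R_iff
proof (elim exE conjE)
  fix a b c d :: int
  assume *: "x = of_int a / of_int b" "\<not> int p dvd b" "y = of_int c / of_int d" "\<not> int p dvd d"
  then have "b \<noteq> 0" "d \<noteq> 0" by auto
  then have "x + y = of_int (a * d + c * b) / of_int (b * d)" using * by (simp add: field_simps)
  moreover have "\<not> int p dvd b * d" using * prime_int_p by (simp add: prime_dvd_mult_iff)
  ultimately show "\<exists>a b. x + y = of_int a / of_int b \<and> \<not> int p dvd b" by blast
qed

lemma R_mult [intro]: "x \<in> R \<Longrightarrow> y \<in> R \<Longrightarrow> x * y \<in> R"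
  unfolding R_iff
proof (elim exE conjE)
  fix a b c d :: int
  assume *: "x = of_int a / of_int b" "\<not> int p dvd b" "y = of_int c / of_int d" "\<not> int p dvd d"
  then have "x * y = of_int (a * c) / of_int (b * d)" by simp
  moreover have "\<not> int p dvd b * d" using * prime_int_p by (simp add: prime_dvd_mult_iff)
  ultimately show "\<exists>a b. x * y = of_int a / of_int b \<and> \<not> int p dvd b" by blast
qed

lemma R_diff [intro]: "x \<in> R \<Longrightarrow> y \<in> R \<Longrightarrow> x - y \<in> R"
  using R_add[of x "- y"] by auto

lemma R_power [intro]: "x \<in> R \<Longrightarrow> x ^ m \<in> R"
  by (induction m) auto

lemma R_sum [intro]: "(\<And>a. a \<in> A \<Longrightarrow> f a \<in> R) \<Longrightarrow> sum f A \<in> R"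
  by (induction A rule: infinite_finite_induct) auto

lemma R_inverse_int: "\<not> int p dvd m \<Longrightarrow> 1 / of_int m \<in> R"
  unfolding R_iff by (intro exI[of _ 1] exI[of _ m]) simp

lemma R_inverse_nat: "\<not> p dvd m \<Longrightarrow> 1 / of_nat m \<in> R"
  using R_inverse_int[of "int m"] by simp

lemma R_divide: "x \<in> R \<Longrightarrow> \<not> p dvd m \<Longrightarrow> x / of_nat m \<in> R"
  using R_mult[OF _ R_inverse_nat, of x m] by simp

lemma not_dvd_less: "0 < m \<Longrightarrow> m < p \<Longrightarrow> \<not> p dvd m"
  by (auto dest: dvd_imp_le)

lemma R_inverse_less [intro]: "0 < m \<Longrightarrow> m < p \<Longrightarrow> 1 / of_nat m \<in> R"
  by (intro R_inverse_nat not_dvd_less)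

lemma not_dvd_2: "\<not> p dvd 2" "\<not> p dvd 3"
  using not_dvd_less[of 2] not_dvd_less[of 3] p_ge_5 by simp_all

lemma R_half [intro]: "x \<in> R \<Longrightarrow> x / 2 \<in> R"
  using R_divide[of x 2] not_dvd_2 by simp

text \<open>Unlike in \<open>cong_in\<close>, x and y are unrestricted, so congruences can be
  chained and cancelled before integrality is known; \<open>cg_R\<close> transfers it from one side
  to the other.\<close>

definition cg :: "nat \<Rightarrow> rat \<Rightarrow> rat \<Rightarrow> bool" where
  "cg e x y \<longleftrightarrow> (\<exists>c\<in>R. x - y = P ^ e * c)"

lemma cgI: "c \<in> R \<Longrightarrow> x - y = P ^ e * c \<Longrightarrow> cg e x y"
  by (auto simp: cg_def)

lemma cg_refl [simp, intro]: "cg e x x"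
  by (rule cgI[of 0]) auto

lemma cg_sym: "cg e x y \<Longrightarrow> cg e y x"
  unfolding cg_def
proof (elim bexE)
  fix c assume "c \<in> R" "x - y = P ^ e * c"
  then show "\<exists>c\<in>R. y - x = P ^ e * c" by (intro bexI[of _ "- c"]) (auto simp: algebra_simps)
qed

lemma cg_trans [trans]: "cg e x y \<Longrightarrow> cg e y z \<Longrightarrow> cg e x z"
  unfolding cg_def
proof (elim bexE)
  fix c d assume "c \<in> R" "d \<in> R" "x - y = P ^ e * c" "y - z = P ^ e * d"
  then show "\<exists>c\<in>R. x - z = P ^ e * c"
    by (intro bexI[of _ "c + d"]) (auto simp: algebra_simps)
qed

lemma cg_add: "cg e x y \<Longrightarrow> cg e z w \<Longrightarrow> cg e (x + z) (y + w)"
  unfolding cg_def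
proof (elim bexE)
  fix c d assume "c \<in> R" "d \<in> R" "x - y = P ^ e * c" "z - w = P ^ e * d"
  then show "\<exists>c\<in>R. x + z - (y + w) = P ^ e * c"
    by (intro bexI[of _ "c + d"]) (auto simp: algebra_simps)
qed

lemma cg_mult_left: "z \<in> R \<Longrightarrow> cg e x y \<Longrightarrow> cg e (z * x) (z * y)"
  unfolding cg_def
proof (elim bexE)
  fix c assume "z \<in> R" "c \<in> R" "x - y = P ^ e * c"
  then show "\<exists>c\<in>R. z * x - z * y = P ^ e * c"
    by (intro bexI[of _ "z * c"]) (auto simp: right_diff_distrib[symmetric])
qed

lemma cg_uminus: "cg e x y \<Longrightarrow> cg e (- x) (- y)"
  using cg_mult_left[of "- 1" e x y] by auto

lemma cg_diff: "cg e x y \<Longrightarrow> cg e z w \<Longrightarrow> cg e (x - z) (y - w)"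
  using cg_add[OF _ cg_uminus] by fastforce

lemma cg_mult: "cg e x y \<Longrightarrow> cg e z w \<Longrightarrow> x \<in> R \<Longrightarrow> w \<in> R \<Longrightarrow> cg e (x * z) (y * w)"
  using cg_trans[OF cg_mult_left[of x e z w], of "y * w"] cg_mult_left[of w e x y] by (simp add: mult.commute)

lemma cg_sum: "(\<And>a. a \<in> A \<Longrightarrow> cg e (f a) (g a)) \<Longrightarrow> cg e (sum f A) (sum g A)"
  by (induction A rule: infinite_finite_induct) (auto intro: cg_add)

lemma cg_R: "cg e x y \<Longrightarrow> y \<in> R \<Longrightarrow> x \<in> R"
proof -
  assume "cg e x y" "y \<in> R"
  then obtain c where "c \<in> R" "x = P ^ e * c + y" unfolding cg_def by (auto simp: algebra_simps)
  with \<open>y \<in> R\<close> show "x \<in> R" by auto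
qed

lemma cg_power: "cg e x y \<Longrightarrow> y \<in> R \<Longrightarrow> cg e (x ^ m) (y ^ m)"
proof (induction m)
  case (Suc m)
  then show ?case using cg_R[OF Suc.prems] by (auto intro!: cg_mult)
qed auto

lemma cg_P: "cg 1 x y \<Longrightarrow> cg 2 (P * x) (P * y)"
  unfolding cg_def by (auto simp: right_diff_distrib[symmetric] power2_eq_square)

lemma cg_zero_P: "x \<in> R \<Longrightarrow> cg 1 (P * x) 0"
  by (rule cgI[of x]) auto

lemma cg_le: "cg 2 x y \<Longrightarrow> cg 1 x y"
  unfolding cg_def
proof (elim bexE)
  fix c assume "c \<in> R" "x - y = P ^ 2 * c"
  then show "\<exists>c\<in>R. x - y = P ^ 1 * c" by (intro bexI[of _ "P * c"]) (auto simp: power2_eq_square)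
qed

lemma cg_cancel_nat: "cg e (of_nat m * x) (of_nat m * y) \<Longrightarrow> \<not> p dvd m \<Longrightarrow> cg e x y"
proof -
  assume "cg e (of_nat m * x) (of_nat m * y)" and m: "\<not> p dvd m"
  then have "cg e (1 / of_nat m * (of_nat m * x)) (1 / of_nat m * (of_nat m * y))"
    by (intro cg_mult_left[OF R_inverse_nat[OF m]])
  moreover have "m \<noteq> 0" using m by (metis dvd_0_right)
  ultimately show ?thesis by simp
qed

lemma cg_divide_power:
  assumes "cg 1 (of_int a) (of_int b)" "\<not> int p dvd a" "\<not> int p dvd b"
  shows "cg 1 (1 / of_int a ^ s) (1 / of_int b ^ s)"
proof -
  have nz: "a \<noteq> 0" "b \<noteq> 0" using assms by auto
  have "cg 1 (1 / of_int a) (1 / of_int b)"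
  proof -
    have "cg 1 (1 / of_int a * (1 / of_int b * of_int b)) (1 / of_int a * (1 / of_int b * of_int a))"
      using assms by (intro cg_mult_left R_inverse_int cg_sym[OF assms(1)])
    then show ?thesis using nz by simp
  qed
  from cg_power[OF this R_inverse_int[OF assms(3)], of s] show ?thesis by (simp add: power_one_over)
qed

lemma inverse_shift:
  assumes "0 < l" "l < p"
  shows "cg 1 (1 / (P - of_nat l) ^ s) ((-1) ^ s / of_nat l ^ s)"
proof -
  have nd: "\<not> int p dvd int l" using not_dvd_less[OF assms] by simp
  have "cg 1 (of_int (int p - int l)) (of_int (- int l))"
    by (rule cgI[of 1]) auto
  moreover have "\<not> int p dvd int p - int l" "\<not> int p dvd - int l"
    using nd by (simp_all add: dvd_diff_right_iff)
  ultimately have "cg 1 (1 / of_int (int p - int l) ^ s) (1 / of_int (- int l) ^ s)"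
    by (rule cg_divide_power)
  moreover have "1 / (of_int (- int l) :: rat) ^ s = (-1) ^ s / of_nat l ^ s"
    using assms by (cases "even s") (simp_all)
  ultimately show ?thesis by simp
qed

lemma HH_R [intro]: "i < p \<Longrightarrow> HH s i \<in> R"
proof -
  assume "i < p"
  then have "(1 / of_nat m) ^ s \<in> R" if "m \<in> {1..i}" for m using that by (intro R_power R_inverse_less) auto
  then show ?thesis unfolding HH_def by (intro R_sum) (simp add: power_one_over)
qed

lemma fermat_cg: "0 < m \<Longrightarrow> m < p \<Longrightarrow> cg 1 (of_nat m ^ (p - 1)) 1"
proof -
  assume "0 < m" "m < p"
  then have "[m ^ (p - 1) = 1] (mod p)" using fermat_theorem[OF prime_p] not_dvd_less by blast
  then obtain k where "int (m ^ (p - 1)) - 1 = int p * k"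
    by (metis cong_iff_dvd_diff cong_int_iff dvdE of_nat_1)
  then have "(of_int (int (m ^ (p - 1)) - 1) :: rat) = of_int (int p * k)" by simp
  then show ?thesis by (intro cgI[of "of_int k"]) auto
qed

text \<open>Fermat's theorem makes the exponents positive, so that Faulhaber's formula applies to
  harmonic sums.\<close>

lemma inverse_power_cg:
  assumes "0 < m" "m < p" "s \<le> p - 1"
  shows "cg 1 (1 / of_nat m ^ s) (of_nat m ^ (p - 1 - s))"
proof -
  have "cg 1 ((1 / of_nat m) ^ s * 1) ((1 / of_nat m) ^ s * of_nat m ^ (p - 1))"
    using assms by (intro cg_mult_left cg_sym[OF fermat_cg] R_power R_inverse_less)
  moreover have "(1 / of_nat m) ^ s * of_nat m ^ (p - 1) = (of_nat m ^ (p - 1 - s) :: rat)"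
    using assms by (simp add: power_diff field_simps)
  ultimately show ?thesis by (simp add: power_one_over)
qed
end

section \<open>Bernoulli numbers and harmonic sums\<close>

lemma bernoulli_fps_mult: "Abs_fps (\<lambda>n. bernoulli n / fact n) * (fps_exp 1 - 1) = fps_X"
  by (rule bernoulli_generating_function[symmetric])

abbreviation BF :: "rat fps" where "BF \<equiv> Abs_fps (\<lambda>n. bernoulli n / fact n)"

lemma bernoulli_poly_coeff:
  "fact M * (BF * fps_exp c) $ M = (\<Sum>j\<le>M. of_nat (M choose j) * bernoulli j * c ^ (M - j))"
  unfolding fps_mult_nth sum_distrib_left atLeast0AtMost
  by (intro sum.cong refl) (simp add: binomial_fact)

text \<open>Compare coefficients in \<open>BF\<close> (exp(N t) - 1) = t (1 + exp(t) + ... + exp((N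
  - 1) t)). The -1 removes the term with B_(m+1).\<close>

lemma faulhaber:
  "of_nat (m + 1) * (\<Sum>b<N. of_nat b ^ m) = (\<Sum>j\<le>m. of_nat (m + 1 choose j) * bernoulli j * of_nat N ^ (m + 1 - j))"
proof -
  have gs: "(fps_exp (1::rat) - 1) * (\<Sum>b<N. fps_exp (of_nat b)) = fps_exp (of_nat N) - 1"
  proof (induction N)
    case (Suc N)
    have "fps_exp (1 + of_nat N :: rat) = fps_exp 1 * fps_exp (of_nat N)" by (rule fps_exp_add_mult)
    with Suc show ?case by (simp add: algebra_simps)
  qed simp
  have "BF * (fps_exp (of_nat N) - 1) = fps_X * (\<Sum>b<N. fps_exp (of_nat b))"
    unfolding gs[symmetric] mult.assoc[symmetric] bernoulli_fps_mult ..
  from arg_cong[OF this, of "\<lambda>f. fact (m+1) * f $ (m+1)"]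
  have "fact (m+1) * (BF * fps_exp (of_nat N)) $ (m+1) - fact (m+1) * BF $ (m+1)
      = fact (m+1) * (fps_X * (\<Sum>b<N. fps_exp (of_nat b))) $ (m+1)"
    by (simp only: right_diff_distrib fps_sub_nth mult_1_right)
  moreover have "fact (m+1) * (fps_X * (\<Sum>b<N. fps_exp (of_nat b))) $ (m+1) = of_nat (m+1) * (\<Sum>b<N. (of_nat b :: rat) ^ m)"
    by (simp add: fps_sum_nth sum_distrib_left del: of_nat_Suc)
  moreover have "fact (m+1) * BF $ (m+1) = bernoulli (m+1)" by simp
  ultimately show ?thesis unfolding bernoulli_poly_coeff by simp
qed

lemma bernoulli_recurrence: "m \<ge> 1 \<Longrightarrow> (\<Sum>j\<le>m. of_nat (m + 1 choose j) * bernoulli j) = 0"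
  using faulhaber[of m 1] by (cases m) simp_all

lemma bernoulli_0: "bernoulli 0 = 1"
  using faulhaber[of 0 1] by simp

text \<open>The value of the Bernoulli polynomial at 1/2: multiplying t / (e^t - 1) by e^(t/2) + 1
  gives t / (e^(t/2) - 1), twice the generating function at t/2.\<close>

lemma bernoulli_half:
  "(\<Sum>j\<le>M. of_nat (M choose j) * bernoulli j * (1/2) ^ (M - j)) = (2 / 2 ^ M - 1) * bernoulli M"
proof -
  define G where "G = Abs_fps (\<lambda>n. bernoulli n / fact n * (1/2) ^ n)"
  have "G * (fps_exp (1/2) - 1) = fps_compose (BF * (fps_exp 1 - 1)) (fps_const (1/2) * fps_X)"
  proof -
    have "G = fps_compose BF (fps_const (1/2) * fps_X)"
      unfolding fps_compose_linear G_def by (simp add: fps_eq_iff)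
    moreover have "fps_exp (1/2) - 1 = fps_compose (fps_exp 1 - 1) (fps_const (1/2) * fps_X :: rat fps)"
      unfolding fps_compose_linear by (simp add: fps_eq_iff)
    ultimately show ?thesis by (simp add: fps_compose_mult_distrib)
  qed
  also have "\<dots> = fps_const (1/2) * fps_X" unfolding bernoulli_fps_mult by simp
  finally have G: "fps_const 2 * (G * (fps_exp (1/2) - 1)) = fps_X"
    by (simp add: mult.assoc[symmetric])
  have "(fps_exp (1/2) - 1) * (fps_exp (1/2) + 1) = fps_exp (1::rat) - 1"
    using fps_exp_add_mult[of "1/2" "1/2::rat"] by (simp add: algebra_simps)
  then have "(fps_exp (1/2) - 1) * (BF * (fps_exp (1/2) + 1)) = BF * (fps_exp 1 - 1)"
    by (metis mult.left_commute)
  also have "\<dots> = (fps_exp (1/2) - 1) * (fps_const 2 * G)"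
    unfolding bernoulli_fps_mult G[symmetric] by (simp only: mult_ac)
  finally have "(fps_exp (1/2) - 1) * (BF * (fps_exp (1/2) + 1)) = (fps_exp (1/2) - 1) * (fps_const 2 * G)" .
  moreover have "fps_exp (1/2) - 1 \<noteq> (0 :: rat fps)"
  proof
    assume "fps_exp (1/2) - 1 = (0 :: rat fps)"
    then have "(fps_exp (1/2) - 1 :: rat fps) $ 1 = 0" by simp
    then show False by simp
  qed
  ultimately have "BF * (fps_exp (1/2) + 1) = fps_const 2 * G"
    by (simp only: mult_cancel_left) simp
  then have "BF * fps_exp (1/2) + BF = fps_const 2 * G"
    by (simp add: distrib_left)
  then have "fact M * (BF * fps_exp (1/2)) $ M + fact M * BF $ M = fact M * (fps_const 2 * G) $ M"
    by (metis distrib_left fps_add_nth)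
  then show ?thesis unfolding bernoulli_poly_coeff by (simp add: G_def power_one_over algebra_simps)
qed

section \<open>Integrality of Bernoulli numbers and harmonic sums modulo p\<close>

context padic begin

text \<open>Solving the recurrence for B_j divides by j + 1 only, which is less than p.\<close>

lemma bernoulli_R: "j \<le> p - 2 \<Longrightarrow> bernoulli j \<in> R"
proof (induction j rule: less_induct)
  case (less j)
  show ?case
  proof (cases "j = 0")
    case False
    then have "(\<Sum>i<j. of_nat (j + 1 choose i) * bernoulli i) + of_nat (j + 1) * bernoulli j = 0"
      using bernoulli_recurrence[of j] by (cases j) (simp_all add: lessThan_Suc_atMost)
    then have "bernoulli j = - (\<Sum>i<j. of_nat (j + 1 choose i) * bernoulli i) / of_nat (j + 1)"
      by (simp add: field_simps del: of_nat_Suc of_nat_add)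
    moreover have "- (\<Sum>i<j. of_nat (j + 1 choose i) * bernoulli i) / of_nat (j + 1) \<in> R"
      using less p_ge_5 by (intro R_divide not_dvd_less R_uminus R_sum R_mult) auto
    ultimately show ?thesis by simp
  qed (simp add: bernoulli_0)
qed

text \<open>At N = p every term of Faulhaber's formula carries a factor p, and k + 1 is
  invertible.\<close>

lemma sum_power_cg:
  assumes "1 \<le> k" "k \<le> p - 2"
  shows "cg 1 (\<Sum>b=1..p-1. of_nat b ^ k) 0"
proof -
  have "(\<Sum>j\<le>k. of_nat (k + 1 choose j) * bernoulli j * P ^ (k + 1 - j)) = P * (\<Sum>j\<le>k. of_nat (k + 1 choose j) * bernoulli j * P ^ (k - j))"
    unfolding sum_distrib_left by (intro sum.cong refl) (simp add: Suc_diff_le)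
  then have "of_nat (k + 1) * (\<Sum>b<p. of_nat b ^ k) = P * (\<Sum>j\<le>k. of_nat (k + 1 choose j) * bernoulli j * P ^ (k - j))"
    unfolding faulhaber .
  moreover have "(\<Sum>j\<le>k. of_nat (k + 1 choose j) * bernoulli j * P ^ (k - j)) \<in> R"
    using assms by (intro R_sum R_mult R_power bernoulli_R) auto
  ultimately have "cg 1 (of_nat (k + 1) * (\<Sum>b<p. of_nat b ^ k)) (of_nat (k + 1) * 0)"
    by (intro cgI) auto
  then have "cg 1 (\<Sum>b<p. of_nat b ^ k) 0"
    using assms p_ge_5 by (intro cg_cancel_nat[of 1 "k + 1" _ 0] not_dvd_less) auto
  moreover have "(\<Sum>b<p. of_nat b ^ k) = (\<Sum>b=1..p-1. (of_nat b :: rat) ^ k)"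
    using assms by (intro sum.mono_neutral_right) auto
  ultimately show ?thesis by simp
qed

lemma HH_full: "1 \<le> s \<Longrightarrow> s \<le> p - 2 \<Longrightarrow> cg 1 (HH s (p - 1)) 0"
proof -
  assume s: "1 \<le> s" "s \<le> p - 2"
  have "cg 1 (HH s (p - 1)) (\<Sum>b=1..p-1. of_nat b ^ (p - 1 - s))"
    unfolding HH_def using s by (intro cg_sum inverse_power_cg) auto
  also have "cg 1 (\<Sum>b=1..p-1. (of_nat b :: rat) ^ (p - 1 - s)) 0"
    using s by (intro sum_power_cg) auto
  finally show ?thesis .
qed

lemma HH_Suc: "HH s (Suc n) = HH s n + 1 / of_nat (Suc n) ^ s"
  by (simp add: HH_def)

abbreviation Bp :: rat where "Bp \<equiv> bernoulli (p - 3)"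

text \<open>Only the term with \<open>B\<^sub>p\<^sub>-\<^sub>3\<close> of Faulhaber's formula survives the summation over \<open>b\<close>.\<close>

lemma sum_HH1_bernoulli: "cg 1 (\<Sum>b=1..p-1. HH 1 b / of_nat b ^ 2) Bp"
proof -
  have p: "p - 2 + 1 = p - 1" "p - 1 - 1 = p - 2" using p_ge_5 by auto
  define c where "c j = of_nat (p - 1 choose j) * bernoulli j" for j
  have cR: "c j \<in> R" if "j \<le> p - 2" for j using that unfolding c_def by (intro R_mult bernoulli_R) auto
  have nd: "\<not> p dvd p - 1" using p_ge_5 by (intro not_dvd_less) auto
  have *: "cg 1 (of_nat (p - 1) * HH 1 (b - 1)) (\<Sum>j\<le>p-2. c j * of_nat b ^ (p - 1 - j))" if b: "b \<in> {1..p-1}" for b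
  proof -
    have "cg 1 (HH 1 (b - 1)) (\<Sum>a=1..b-1. of_nat a ^ (p - 2))"
      unfolding HH_def using b inverse_power_cg[of _ 1] p by (intro cg_sum) auto
    also have "(\<Sum>a=1..b-1. (of_nat a :: rat) ^ (p - 2)) = (\<Sum>a<b. of_nat a ^ (p - 2))"
      using p_ge_5 by (intro sum.mono_neutral_left) auto
    finally have "cg 1 (of_nat (p - 1) * HH 1 (b - 1)) (of_nat (p - 1) * (\<Sum>a<b. of_nat a ^ (p - 2)))"
      by (intro cg_mult_left) auto
    also have "of_nat (p - 1) * (\<Sum>a<b. (of_nat a :: rat) ^ (p - 2)) = (\<Sum>j\<le>p-2. c j * of_nat b ^ (p - 1 - j))"
      using faulhaber[of "p - 2" b] unfolding p c_def .
    finally show ?thesis .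
  qed
  have "cg 1 (\<Sum>b=1..p-1. of_nat (p - 1) * HH 1 (b - 1) / of_nat b ^ 2) (\<Sum>b=1..p-1. (\<Sum>j\<le>p-2. c j * of_nat b ^ (p - 1 - j)) / of_nat b ^ 2)"
  proof (intro cg_sum)
    fix b assume b: "b \<in> {1..p-1}"
    have "cg 1 ((1 / of_nat b) ^ 2 * (of_nat (p - 1) * HH 1 (b - 1))) ((1 / of_nat b) ^ 2 * (\<Sum>j\<le>p-2. c j * of_nat b ^ (p - 1 - j)))"
      using b by (intro cg_mult_left * R_power R_inverse_less) auto
    then show "cg 1 (of_nat (p - 1) * HH 1 (b - 1) / of_nat b ^ 2) ((\<Sum>j\<le>p-2. c j * of_nat b ^ (p - 1 - j)) / of_nat b ^ 2)"
      by (simp add: power_one_over)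
  qed
  also have "(\<Sum>b=1..p-1. (\<Sum>j\<le>p-2. c j * of_nat b ^ (p - 1 - j)) / of_nat b ^ 2)
      = (\<Sum>j\<le>p-2. c j * (\<Sum>b=1..p-1. of_nat b ^ (p - 1 - j) / of_nat b ^ 2))"
    unfolding sum_divide_distrib sum_distrib_left by (subst sum.swap) simp
  \<comment> \<open>The inner sum has exponent p - 3 - j: it vanishes modulo p for j < p - 3,
    consists of p - 1 ones for j = p - 3, and is H_1(p - 1) for j = p - 2.\<close>
  also have "cg 1 (\<Sum>j\<le>p-2. c j * (\<Sum>b=1..p-1. of_nat b ^ (p - 1 - j) / of_nat b ^ 2)) (\<Sum>j\<le>p-2. c j * (if j = p - 3 then of_nat (p - 1) else 0))"
  proof (intro cg_sum cg_mult_left cR)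
    fix j assume j: "j \<in> {..p-2}"
    have e: "(of_nat b :: rat) ^ (p - 1 - j) / of_nat b ^ 2 = of_nat b ^ (p - 3 - j)" if "b \<in> {1..p-1}" "j \<le> p - 3" for b
    proof -
      have "p - 1 - j = p - 3 - j + 2" using that p_ge_5 by auto
      then show ?thesis using that by (simp only: power_add) auto
    qed
    consider "j < p - 3" | "j = p - 3" | "j = p - 2" using j by fastforce
    then show "cg 1 (\<Sum>b=1..p-1. of_nat b ^ (p - 1 - j) / of_nat b ^ 2) (if j = p - 3 then of_nat (p - 1) else 0)"
    proof cases
      case 1
      then have "(\<Sum>b=1..p-1. (of_nat b :: rat) ^ (p - 1 - j) / of_nat b ^ 2) = (\<Sum>b=1..p-1. of_nat b ^ (p - 3 - j))"
        by (intro sum.cong refl e) auto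
      with 1 show ?thesis using sum_power_cg[of "p - 3 - j"] by simp
    next
      case 2
      then have "(\<Sum>b=1..p-1. (of_nat b :: rat) ^ (p - 1 - j) / of_nat b ^ 2) = (\<Sum>b=1..p-1. of_nat b ^ (p - 3 - j))"
        by (intro sum.cong refl e) auto
      with 2 show ?thesis by simp
    next
      case 3
      then have "p - 1 - j = 1" "j \<noteq> p - 3" using p_ge_5 by auto
      moreover have "(\<Sum>b=1..p-1. (of_nat b :: rat) ^ 1 / of_nat b ^ 2) = HH 1 (p - 1)"
        unfolding HH_def by (intro sum.cong) (auto simp: power2_eq_square)
      ultimately show ?thesis using HH_full[of 1] p_ge_5 by simp
    qed
  qed auto
  also have "(\<Sum>j\<le>p-2. c j * (if j = p - 3 then of_nat (p - 1) else 0)) = of_nat (p - 1) * c (p - 3)"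
  proof -
    have "(\<Sum>j\<le>p-2. c j * (if j = p - 3 then of_nat (p - 1) else 0)) = (\<Sum>j\<le>p-2. if j = p - 3 then of_nat (p - 1) * c j else 0)"
      by (intro sum.cong) auto
    then show ?thesis using p_ge_5 by (simp add: sum.delta)
  qed
  finally have "cg 1 (of_nat (p - 1) * (\<Sum>b=1..p-1. HH 1 (b - 1) / of_nat b ^ 2)) (of_nat (p - 1) * c (p - 3))"
    by (simp add: sum_distrib_left)
  from cg_cancel_nat[OF this nd] have 1: "cg 1 (\<Sum>b=1..p-1. HH 1 (b - 1) / of_nat b ^ 2) (c (p - 3))" .
  \<comment> \<open>The binomial coefficient is (p - 1)(p - 2) / 2, congruent to 1.\<close>
  have "cg 1 (2 * of_nat (p - 1 choose (p - 3))) 2"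
  proof -
    have "p - 1 choose (p - 3) = p - 1 choose 2" using binomial_symmetric[of 2 "p - 1"] p_ge_5 by (simp add: numeral_eq_Suc)
    also have "\<dots> = (p - 1) * (p - 2) div 2" by (simp only: choose_two p(2))
    finally have c: "p - 1 choose (p - 3) = (p - 1) * (p - 2) div 2" .
    have "even (p - 1)" using prime_odd_nat[OF prime_p] p_ge_5 by simp
    then have "2 * (p - 1 choose (p - 3)) = (p - 1) * (p - 2)" unfolding c by simp
    then have "(2 * of_nat (p - 1 choose (p - 3)) :: rat) = of_nat (p - 1) * of_nat (p - 2)"
      by (metis of_nat_mult of_nat_numeral)
    also have "\<dots> = (P - 1) * (P - 2)" using p_ge_5 by (simp add: of_nat_diff)
    finally have "(2 * of_nat (p - 1 choose (p - 3)) :: rat) = (P - 1) * (P - 2)" .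
    then show ?thesis by (intro cgI[of "P - 3"]) (auto simp: algebra_simps)
  qed
  then have "cg 1 (of_nat 2 * of_nat (p - 1 choose (p - 3))) (of_nat 2 * 1)" by simp
  from cg_cancel_nat[OF this not_dvd_2(1)] have "cg 1 (Bp * of_nat (p - 1 choose (p - 3))) (Bp * 1)"
    using p_ge_5 by (intro cg_mult_left bernoulli_R) auto
  then have 2: "cg 1 (c (p - 3)) Bp" by (simp add: c_def mult.commute)
  have "(\<Sum>b=1..p-1. HH 1 b / of_nat b ^ 2) = (\<Sum>b=1..p-1. HH 1 (b - 1) / of_nat b ^ 2) + HH 3 (p - 1)"
    unfolding HH_def[of 3] sum.distrib[symmetric]
  proof (intro sum.cong refl)
    fix b assume "b \<in> {1..p-1}"
    then obtain a where "b = Suc a" by (cases b) auto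
    then show "HH 1 b / of_nat b ^ 2 = HH 1 (b - 1) / of_nat b ^ 2 + 1 / of_nat b ^ 3"
      by (simp add: HH_Suc add_divide_distrib power2_eq_square power3_eq_cube mult_ac del: of_nat_Suc)
  qed
  also have "cg 1 \<dots> (Bp + 0)"
    using p_ge_5 by (intro cg_add cg_trans[OF 1 2] HH_full) auto
  finally show ?thesis by simp
qed

text \<open>Modulo p, (p + 1) / 2 is 1/2, so Faulhaber's formula yields B_M(1/2) - B_M with M = p -
  3. The factor 2 / 2^M - 2 is congruent to 6, and division by M, congruent to -3, gives -2.\<close>

lemma HH3_half: "cg 1 (HH 3 ((p - 1) div 2)) (- 2 * Bp)"
proof -
  define N where "N = (p + 1) div 2"
  have odd: "odd p" using prime_odd_nat[OF prime_p] p_ge_5 by auto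
  then have N: "2 * N = p + 1" "N < p" "(p - 1) div 2 = N - 1" "N \<ge> 1" using p_ge_5 by (auto simp: N_def elim!: oddE)
  define M where "M = p - 3"
  have M: "p - 1 - 3 = M - 1" "M - 1 + 1 = M" "M \<ge> 2" "M \<le> p - 2" using p_ge_5 by (auto simp: M_def)
  have half: "cg 1 (of_nat N) (1 / 2)"
  proof -
    have "2 * of_nat N = P + 1" using N(1) by (metis of_nat_1 of_nat_add of_nat_mult of_nat_numeral)
    then show ?thesis by (intro cgI[of "1 / 2"]) auto
  qed
  have "cg 1 (HH 3 (N - 1)) (\<Sum>a=1..N-1. of_nat a ^ (M - 1))"
    unfolding HH_def using N p_ge_5 M inverse_power_cg[of _ 3] by (intro cg_sum) auto
  also have "(\<Sum>a=1..N-1. (of_nat a :: rat) ^ (M - 1)) = (\<Sum>a<N. of_nat a ^ (M - 1))"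
    using M N by (intro sum.mono_neutral_left) auto
  finally have "cg 1 (of_nat M * HH 3 (N - 1)) (of_nat M * (\<Sum>a<N. of_nat a ^ (M - 1)))" by (intro cg_mult_left) auto
  also have "of_nat M * (\<Sum>a<N. (of_nat a :: rat) ^ (M - 1)) = (\<Sum>j\<le>M-1. of_nat (M choose j) * bernoulli j * of_nat N ^ (M - j))"
    using faulhaber[of "M - 1" N] unfolding M .
  also have "cg 1 \<dots> (\<Sum>j\<le>M-1. of_nat (M choose j) * bernoulli j * (1 / 2) ^ (M - j))"
    using M by (intro cg_sum cg_mult_left cg_power half R_mult bernoulli_R) auto
  also have "(\<Sum>j\<le>M-1. of_nat (M choose j) * bernoulli j * (1 / 2) ^ (M - j)) = (2 / 2 ^ M - 2) * bernoulli M"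
  proof -
    have "Suc (M - 1) = M" using M by simp
    then have "(\<Sum>j\<le>M-1. f j) + f M = (\<Sum>j\<le>M. f j)" for f :: "nat \<Rightarrow> rat"
      by (metis sum.atMost_Suc)
    from this[of "\<lambda>j. of_nat (M choose j) * bernoulli j * (1 / 2) ^ (M - j)"] show ?thesis
      unfolding bernoulli_half by (simp add: algebra_simps)
  qed
  also have "cg 1 \<dots> (6 * bernoulli M)"
  proof -
    have "cg 1 (1 / of_nat 2 ^ M) (of_nat 2 ^ (p - 1 - M))" using p_ge_5 M by (intro inverse_power_cg) auto
    moreover have "p - 1 - M = 2" using p_ge_5 by (simp add: M_def)
    ultimately have "cg 1 (2 * (1 / 2 ^ M) - 2) (2 * 4 - 2)" by (intro cg_diff cg_mult_left) auto
    then have "cg 1 (bernoulli M * (2 * (1 / 2 ^ M) - 2)) (bernoulli M * 6)"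
      using M by (intro cg_mult_left bernoulli_R) auto
    then show ?thesis by (simp add: mult.commute)
  qed
  finally have 1: "cg 1 (of_nat M * HH 3 (N - 1)) (6 * bernoulli M)" .
  have "of_nat M = P - 3" using p_ge_5 by (simp add: M_def of_nat_diff)
  then have "of_nat M * HH 3 (N - 1) - (- 3 * HH 3 (N - 1)) = P ^ 1 * HH 3 (N - 1)"
    by (simp add: left_diff_distrib)
  then have "cg 1 (of_nat M * HH 3 (N - 1)) (- 3 * HH 3 (N - 1))"
    using N by (intro cgI[of "HH 3 (N - 1)"]) auto
  from cg_trans[OF cg_sym[OF this] 1] have "cg 1 (of_nat 3 * - HH 3 (N - 1)) (of_nat 3 * (2 * bernoulli M))" by simp
  from cg_uminus[OF cg_cancel_nat[OF this not_dvd_2(2)]] show ?thesis using N by (simp add: M_def)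
qed
end

section \<open>Harmonic sums modulo powers of the prime\<close>

text \<open>Summation by parts against the constant 1; for products of harmonic numbers the
  increments are simpler than the terms.\<close>

lemma abel_power_sum:
  fixes u :: "nat \<Rightarrow> rat"
  shows "(\<Sum>i<Suc N. u i) = of_nat (Suc N) * u N - (\<Sum>b=1..N. of_nat b * (u b - u (b - 1)))"
  by (induction N) (simp_all add: algebra_simps)

lemma telescope_1:
  fixes u :: "nat \<Rightarrow> rat"
  shows "(\<Sum>b=1..N. u b - u (b - 1)) = u N - u 0"
  by (induction N) simp_all

lemma HH_pred: "Suc 0 \<le> b \<Longrightarrow> HH s (b - Suc 0) = HH s b - 1 / of_nat b ^ s"
  by (cases b) (simp_all add: HH_def)

lemma HH_0 [simp]: "HH s 0 = 0" by (simp add: HH_def)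

section \<open>Alternating binomial sums\<close>

definition altsum :: "nat \<Rightarrow> nat \<Rightarrow> rat" where
  "altsum s n = (\<Sum>k=1..n. (-1) ^ (k + 1) * of_nat (n choose k) / of_nat k ^ s)"

lemma altsum_0: "n \<ge> 1 \<Longrightarrow> altsum 0 n = 1"
proof -
  assume n: "n \<ge> 1"
  have "(\<Sum>k\<le>n. (-1) ^ k * of_nat (n choose k) :: rat) = 0"
    using choose_alternating_sum[of n] n by simp
  moreover have "(\<Sum>k\<le>n. (-1) ^ k * of_nat (n choose k) :: rat) = 1 + (\<Sum>k=1..n. (-1) ^ k * of_nat (n choose k))"
    by (simp add: atMost_atLeast0 sum.atLeast_Suc_atMost)
  ultimately show ?thesis by (simp add: altsum_def sum_negf)
qed

text \<open>Pascal's rule, with the absorption identity (n + 1) binom(n, k - 1) = k binom(n + 1, k),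
  which lowers the exponent by one.\<close>

lemma altsum_Suc: "altsum (Suc s) (Suc n) = altsum (Suc s) n + altsum s (Suc n) / of_nat (Suc n)"
proof -
  have "altsum (Suc s) (Suc n) = (\<Sum>k=1..Suc n. (-1) ^ (k + 1) * of_nat (n choose k) / of_nat k ^ Suc s
     + (-1) ^ (k + 1) * of_nat (Suc n choose k) / of_nat k ^ s / of_nat (Suc n))"
    unfolding altsum_def
  proof (intro sum.cong refl)
    fix k assume "k \<in> {1..Suc n}"
    then obtain j where k: "k = Suc j" by (cases k) auto
    have "Suc n * (n choose j) = (Suc n choose Suc j) * Suc j" by (rule Suc_times_binomial_eq)
    then have "of_nat (Suc n) * of_nat (n choose j) = (of_nat (Suc n choose Suc j) * of_nat (Suc j) :: rat)"
      by (metis of_nat_mult)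
    then have "of_nat (n choose j) = (of_nat (Suc n choose k) * of_nat k / of_nat (Suc n) :: rat)"
      unfolding k by (simp add: field_simps del: of_nat_Suc binomial_Suc_Suc)
    moreover have "of_nat (Suc n choose k) = (of_nat (n choose k) + of_nat (n choose j) :: rat)"
      unfolding k by simp
    ultimately have "of_nat (Suc n choose k) = (of_nat (n choose k) + of_nat (Suc n choose k) * of_nat k / of_nat (Suc n) :: rat)"
      by simp
    moreover have "x = y + x * c / m \<Longrightarrow> e * x / c ^ Suc s = e * y / c ^ Suc s + e * x / c ^ s / m"
      if "c \<noteq> 0" "m \<noteq> 0" for x y c m e :: rat
    proof -
      assume "x = y + x * c / m"
      then have "e * x / c ^ Suc s = e * (y + x * c / m) / c ^ Suc s" by simp
      also have "\<dots> = e * y / c ^ Suc s + e * x / c ^ s / m" using that by (simp add: field_simps)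
      finally show ?thesis .
    qed
    ultimately show "(-1) ^ (k + 1) * of_nat (Suc n choose k) / of_nat k ^ Suc s = (-1) ^ (k + 1) * of_nat (n choose k) / of_nat k ^ Suc s
     + (-1) ^ (k + 1) * of_nat (Suc n choose k) / of_nat k ^ s / (of_nat (Suc n) :: rat)"
      using k by (metis (no_types, lifting) of_nat_eq_0_iff nat.distinct(1))
  qed
  also have "\<dots> = (\<Sum>k=1..Suc n. (-1) ^ (k + 1) * of_nat (n choose k) / of_nat k ^ Suc s) + altsum s (Suc n) / of_nat (Suc n)"
    unfolding sum.distrib altsum_def sum_divide_distrib ..
  finally show ?thesis by (simp add: altsum_def[of "Suc s" n])
qed

lemma altsum_1: "altsum 1 n = HH 1 n"
proof (induction n)
  case (Suc n)
  have "altsum 1 (Suc n) = altsum 1 n + altsum 0 (Suc n) / of_nat (Suc n)"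
    unfolding One_nat_def by (rule altsum_Suc)
  then show ?case using Suc by (simp add: altsum_0 HH_def)
qed (simp add: altsum_def)

lemma altsum_2: "altsum 2 n = (\<Sum>b=1..n. HH 1 b / of_nat b)"
proof (induction n)
  case (Suc n)
  have "altsum 2 (Suc n) = altsum 2 n + altsum 1 (Suc n) / of_nat (Suc n)"
    using altsum_Suc[of 1 n] by (simp add: numeral_2_eq_2)
  then show ?case using Suc by (simp add: altsum_1[unfolded One_nat_def])
qed (simp add: altsum_def)

text \<open>Telescoping of H_1(b)^2 - H_1(b - 1)^2 = 2 H_1(b) / b - 1 / b^2.\<close>

lemma HH_square_sum: "2 * (\<Sum>b=1..n. HH 1 b / of_nat b) = HH 1 n ^ 2 + HH 2 n"
proof -
  have "(\<Sum>b=1..n. 2 * HH 1 b / of_nat b - 1 / of_nat b ^ 2) = (\<Sum>b=1..n. HH 1 b ^ 2 - HH 1 (b - 1) ^ 2)"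
    by (intro sum.cong refl) (simp add: HH_pred power2_eq_square field_simps)
  also have "\<dots> = HH 1 n ^ 2" by (subst telescope_1) simp
  finally show ?thesis by (simp add: sum_subtractf HH_def[of 2] sum_distrib_left)
qed

context padic begin

lemma lessThan_p: "{..<p} = insert 0 {1..p-1}"
proof -
  have "{..<Suc n} = insert 0 {1..n}" for n by auto
  from this[of "p - 1"] show ?thesis using p_ge_5 by simp
qed

lemma odd_p: "odd p" using prime_odd_nat[OF prime_p] p_ge_5 by auto

text \<open>Each step multiplies by (p - i - 1) / (i + 1) = p / (i + 1) - 1.\<close>

lemma choose_cg: "i < p \<Longrightarrow> cg 2 (of_nat (p - 1 choose i)) ((-1) ^ i * (1 - P * HH 1 i))"
proof (induction i)
  case (Suc i)
  have "(of_nat (p - 1 choose Suc i) :: rat) * of_nat (Suc i) = of_nat (p - 1 choose i) * of_nat (p - 1 - i)"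
    using binomial_absorb_comp[of "p - 1" i] Suc_times_binomial_eq[of "p - 2" i] Suc.prems p_ge_5
    by (metis (no_types, lifting) Suc_diff_Suc Suc_lessD diff_Suc_1 mult.commute of_nat_mult binomial_absorption[of i "p - 1"])
  moreover have "of_nat (p - 1 - i) = P - of_nat (Suc i)" using Suc.prems by (simp add: of_nat_diff)
  ultimately have "of_nat (p - 1 choose Suc i) = of_nat (p - 1 choose i) * (P * (1 / of_nat (Suc i)) - 1)"
    by (simp add: field_simps del: of_nat_Suc)
  also have "cg 2 \<dots> ((-1) ^ i * (1 - P * HH 1 i) * (P * (1 / of_nat (Suc i)) - 1))"
    using Suc by (intro cg_mult R_diff R_mult R_inverse_less) (auto simp del: of_nat_Suc)
  also have "cg 2 \<dots> ((-1) ^ Suc i * (1 - P * HH 1 (Suc i)))"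
  proof (rule cgI)
    show "- ((-1) ^ i * (HH 1 i * (1 / of_nat (Suc i)))) \<in> R"
      using Suc.prems by (intro R_mult R_uminus R_power R_inverse_less HH_R) auto
  qed (simp add: HH_Suc algebra_simps power2_eq_square del: of_nat_Suc)
  finally show ?case .
qed simp

lemma choose_cg1: "i < p \<Longrightarrow> cg 1 (of_nat (p - 1 choose i)) ((-1) ^ i)"
proof -
  assume i: "i < p"
  have "cg 1 ((-1) ^ i * (1 - P * HH 1 i)) ((-1) ^ i)"
    using i by (intro cgI[of "- ((-1) ^ i * HH 1 i)"]) (auto simp: algebra_simps intro!: R_mult R_uminus R_power)
  with cg_trans[OF cg_le[OF choose_cg[OF i]]] show ?thesis by blast
qed

abbreviation W1 :: rat where "W1 \<equiv> (\<Sum>b=1..p-1. HH 1 b / of_nat b ^ 2)"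

text \<open>\<open>altsum 2 (p - 1)\<close> is evaluated twice. It equals (H_1^2 + H_2) / 2 at p -
  1, where H_1^2 vanishes modulo p^2; and inserting \<open>choose_cg\<close> gives -H_2(p - 1) + p
  \<open>W1\<close>.\<close>

lemma HH2_full: "cg 2 (3 * HH 2 (p - 1)) (2 * (P * W1))"
proof -
  have "cg 2 (altsum 2 (p - 1)) (\<Sum>k=1..p-1. - (1 - P * HH 1 k) / of_nat k ^ 2)"
    unfolding altsum_def
  proof (intro cg_sum)
    fix k assume k: "k \<in> {1..p-1}"
    have "cg 2 (((-1) ^ (k + 1) * (1 / of_nat k) ^ 2) * of_nat (p - 1 choose k)) (((-1) ^ (k + 1) * (1 / of_nat k) ^ 2) * ((-1) ^ k * (1 - P * HH 1 k)))"
      using k by (intro cg_mult_left R_mult R_power R_inverse_less choose_cg) auto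
    moreover have "((-1) ^ (k + 1) * (1 / of_nat k) ^ 2) * ((-1) ^ k * (1 - P * HH 1 k)) = - (1 - P * HH 1 k) / of_nat k ^ 2"
    proof -
      have "(-1 :: rat) ^ (k + 1) * (-1) ^ k = - 1" by (cases "even k") simp_all
      moreover have "(e * c) * (d * a) = (e * d) * (a * c)" for a c d e :: rat by (simp only: mult_ac)
      ultimately have "((-1) ^ (k + 1) * c) * ((-1) ^ k * a) = - (a * c)" for a c :: rat by simp
      then show ?thesis by (simp only: power_one_over) (simp add: diff_divide_distrib)
    qed
    moreover have "((-1) ^ (k + 1) * (1 / of_nat k) ^ 2) * of_nat (p - 1 choose k) = ((-1) ^ (k + 1) * of_nat (p - 1 choose k) / of_nat k ^ 2 :: rat)"
      by (simp only: power_one_over) simp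
    ultimately show "cg 2 ((-1) ^ (k + 1) * of_nat (p - 1 choose k) / of_nat k ^ 2) (- (1 - P * HH 1 k) / of_nat k ^ 2)"
      by (simp only:)
  qed
  also have "(\<Sum>k=1..p-1. - (1 - P * HH 1 k) / of_nat k ^ 2) = - HH 2 (p - 1) + P * W1"
    unfolding HH_def[of 2] sum_distrib_left sum_negf[symmetric] sum.distrib[symmetric]
    by (intro sum.cong refl) (simp add: diff_divide_distrib)
  finally have "cg 2 (2 * altsum 2 (p - 1)) (2 * (- HH 2 (p - 1) + P * W1))" by (intro cg_mult_left) auto
  then have "cg 2 (HH 1 (p - 1) ^ 2 + HH 2 (p - 1)) (2 * (- HH 2 (p - 1) + P * W1))"
    unfolding altsum_2 HH_square_sum .
  moreover have "cg 2 (HH 1 (p - 1) ^ 2) 0"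
  proof -
    have "cg 1 (HH 1 (p - 1)) 0" using p_ge_5 by (intro HH_full) auto
    then obtain c where "c \<in> R" "HH 1 (p - 1) = P * c" unfolding cg_def by auto
    then show ?thesis by (intro cgI[of "c^2"]) (auto simp: power_mult_distrib)
  qed
  ultimately have "cg 2 ((HH 1 (p - 1) ^ 2 + HH 2 (p - 1)) - HH 1 (p - 1) ^ 2 + 2 * HH 2 (p - 1)) (2 * (- HH 2 (p - 1) + P * W1) - 0 + 2 * HH 2 (p - 1))"
    by (intro cg_add cg_diff) auto
  then show ?thesis by (simp add: algebra_simps)
qed

lemma sum_HH: "(\<Sum>i<p. HH (Suc s) i) = P * HH (Suc s) (p - 1) - HH s (p - 1)"
proof -
  have p: "Suc (p - 1) = p" using p_ge_5 by simp
  have "(\<Sum>b=1..p-1. of_nat b * (HH (Suc s) b - HH (Suc s) (b - 1))) = HH s (p - 1)"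
    unfolding HH_def[of s] by (intro sum.cong refl) (simp add: HH_pred)
  then show ?thesis using abel_power_sum[of "HH (Suc s)" "p - 1"] unfolding p by simp
qed

lemma sum_HH1: "cg 1 (\<Sum>i<p. HH 1 i) 1"
proof -
  have "HH 0 (p - 1) = P - 1" using p_ge_5 by (simp add: HH_def of_nat_diff)
  then have "(\<Sum>i<p. HH 1 i) = P * HH 1 (p - 1) - (P - 1)" using sum_HH[of 0] by simp
  moreover have "HH 1 (p - 1) \<in> R" using p_ge_5 by auto
  ultimately show ?thesis by (intro cgI[of "HH 1 (p - 1) - 1"]) (auto simp: algebra_simps)
qed

lemma sum_HH3: "cg 2 (\<Sum>i<p. HH 3 i) (- HH 2 (p - 1))"
proof -
  have "cg 1 (HH 3 (p - 1)) 0" using p_ge_5 by (intro HH_full) auto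
  then obtain c where "c \<in> R" "HH 3 (p - 1) = P * c"
    unfolding cg_def by auto
  then show ?thesis using sum_HH[of 2] by (intro cgI[of c]) (auto simp: power2_eq_square numeral_3_eq_3)
qed

text \<open>By Abel summation the two summands are -2 \<open>W2\<close> and -2 \<open>W1\<close> up
  to terms that vanish modulo p, and \<open>W1 + W2\<close> telescopes to H_1 H_2 + H_3 at p - 1.
  This combination is the one that \<open>Cterm_sum\<close> leaves.\<close>

lemma sum_products: "cg 1 ((\<Sum>i<p. HH 2 i ^ 2) + 2 * (\<Sum>i<p. HH 1 i * HH 3 i)) 0"
proof -
  have p: "Suc (p - 1) = p" using p_ge_5 by simp
  define W2 where "W2 = (\<Sum>b=1..p-1. HH 2 b / of_nat b)"
  have H3: "cg 1 (HH 3 (p - 1)) 0" and H2: "cg 1 (HH 2 (p - 1)) 0" using HH_full p_ge_5 by simp_all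
  have HR: "HH s (p - 1) \<in> R" for s using p_ge_5 by auto
  have "(\<Sum>b=1..p-1. HH 1 b * HH 2 b - HH 1 (b - 1) * HH 2 (b - 1)) = W1 + W2 - HH 3 (p - 1)"
    unfolding W2_def HH_def[of 3] sum.distrib[symmetric] sum_subtractf[symmetric]
    by (intro sum.cong refl) (auto simp: HH_pred field_simps eval_nat_numeral)
  then have "W1 + W2 = HH 1 (p - 1) * HH 2 (p - 1) + HH 3 (p - 1)" by (subst (asm) telescope_1) simp
  also have "cg 1 \<dots> (HH 1 (p - 1) * 0 + 0)" by (intro cg_add cg_mult_left HR H2 H3)
  finally have W: "cg 1 (W1 + W2) 0" by simp
  have "(\<Sum>b=1..p-1. of_nat b * (HH 2 b ^ 2 - HH 2 (b - 1) ^ 2)) = 2 * W2 - HH 3 (p - 1)"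
    unfolding W2_def HH_def[of 3] sum_distrib_left sum_subtractf[symmetric]
    by (intro sum.cong refl) (auto simp: HH_pred field_simps eval_nat_numeral)
  then have S22: "(\<Sum>i<p. HH 2 i ^ 2) = P * HH 2 (p - 1) ^ 2 - (2 * W2 - HH 3 (p - 1))"
    using abel_power_sum[of "\<lambda>i. HH 2 i ^ 2" "p - 1"] unfolding p by simp
  have "(\<Sum>b=1..p-1. HH 3 b) = (\<Sum>i<p. HH 3 i)"
  proof -
    show ?thesis unfolding lessThan_p by simp
  qed
  moreover have "(\<Sum>b=1..p-1. of_nat b * (HH 1 b * HH 3 b - HH 1 (b - 1) * HH 3 (b - 1))) = W1 + (\<Sum>b=1..p-1. HH 3 b) - HH 3 (p - 1)"
    unfolding HH_def[of 3 "p - 1"] sum.distrib[symmetric] sum_subtractf[symmetric]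
    by (intro sum.cong refl) (auto simp: HH_pred field_simps eval_nat_numeral)
  ultimately have S13: "(\<Sum>i<p. HH 1 i * HH 3 i) = P * (HH 1 (p - 1) * HH 3 (p - 1)) - (W1 + (\<Sum>i<p. HH 3 i) - HH 3 (p - 1))"
    using abel_power_sum[of "\<lambda>i. HH 1 i * HH 3 i" "p - 1"] unfolding p by simp
  have s3: "cg 1 (\<Sum>i<p. HH 3 i) 0"
    using cg_trans[OF cg_le[OF sum_HH3] cg_uminus[OF H2]] by simp
  have "(\<Sum>i<p. HH 2 i ^ 2) + 2 * (\<Sum>i<p. HH 1 i * HH 3 i) = P * (HH 2 (p - 1) ^ 2 + 2 * (HH 1 (p - 1) * HH 3 (p - 1)))
       + 3 * HH 3 (p - 1) - 2 * (\<Sum>i<p. HH 3 i) - 2 * (W1 + W2)"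
    unfolding S22 S13 by (simp add: algebra_simps)
  also have "cg 1 \<dots> (0 + 3 * 0 - 2 * 0 - 2 * 0)"
    by (intro cg_add cg_diff cg_mult_left cg_zero_P R_add R_mult R_power HR H3 s3 W R_numbers)
  finally show ?thesis by simp
qed

section \<open>Reflection of harmonic numbers\<close>

lemma HH_tail: "i < p \<Longrightarrow> HH s (p - 1 - i) = HH s (p - 1) - (\<Sum>l=1..i. 1 / (P - of_nat l) ^ s)"
proof (induction i)
  case (Suc i)
  then have "p - 1 - i = Suc (p - 1 - Suc i)" by simp
  then have "HH s (p - 1 - i) = HH s (p - 1 - Suc i) + 1 / of_nat (p - 1 - i) ^ s" by (metis HH_Suc)
  moreover have "of_nat (p - 1 - i) = P - of_nat (Suc i)" using Suc.prems by (simp add: of_nat_diff)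
  ultimately show ?case using Suc by (simp del: of_nat_Suc)
qed simp

lemma HH_reflect:
  assumes "i < p" "1 \<le> s" "s \<le> p - 2"
  shows "cg 1 (HH s (p - 1 - i)) (- ((-1) ^ s * HH s i))"
proof -
  have "cg 1 (HH s (p - 1) - (\<Sum>l=1..i. 1 / (P - of_nat l) ^ s)) (0 - (\<Sum>l=1..i. (-1) ^ s / of_nat l ^ s))"
    using assms by (intro cg_diff HH_full cg_sum inverse_shift) auto
  then show ?thesis unfolding HH_tail[OF assms(1)] by (simp add: HH_def sum_distrib_left)
qed

text \<open>1/l + 1/(p - l) = p / (l (p - l)) makes one power of p explicit, so the cofactor matters
  modulo p only.\<close>

lemma HH1_reflect:
  assumes "i < p"
  shows "cg 2 (HH 1 (p - 1 - i) - HH 1 i) (HH 1 (p - 1) + P * HH 2 i)"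
proof -
  have 1: "cg 1 (1 / (of_nat l * (P - of_nat l))) (- (1 / of_nat l ^ 2))" if l: "l \<in> {1..i}" for l
  proof -
    have "cg 1 (1 / of_nat l * (1 / (P - of_nat l) ^ 1)) (1 / of_nat l * ((-1) ^ 1 / of_nat l ^ 1))"
      using l assms by (intro cg_mult_left inverse_shift R_inverse_less) auto
    then show ?thesis by (simp add: power2_eq_square)
  qed
  have "HH 1 (p - 1 - i) - HH 1 i = HH 1 (p - 1) - P * (\<Sum>l=1..i. 1 / (of_nat l * (P - of_nat l)))"
  proof -
    have "(\<Sum>l=1..i. 1 / (P - of_nat l) ^ 1) + HH 1 i = P * (\<Sum>l=1..i. 1 / (of_nat l * (P - of_nat l)))"
      unfolding HH_def sum_distrib_left sum.distrib[symmetric]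
    proof (intro sum.cong refl)
      fix l assume "l \<in> {1..i}"
      then have "(of_nat l :: rat) \<noteq> 0" "P - of_nat l \<noteq> 0" using assms by auto
      then show "1 / (P - of_nat l) ^ 1 + 1 / of_nat l ^ 1 = P * (1 / (of_nat l * (P - of_nat l)))"
        by (simp add: field_simps)
    qed
    then show ?thesis using HH_tail[OF assms, of 1] by (simp add: algebra_simps)
  qed
  also have "cg 2 \<dots> (HH 1 (p - 1) - P * (\<Sum>l=1..i. - (1 / of_nat l ^ 2)))"
    by (intro cg_diff cg_refl cg_P cg_sum 1)
  finally show ?thesis by (simp add: HH_def[of 2] sum_negf)
qed

text \<open>The term H_1(p - 1) is common to both reflections and drops out. Hence
  \<open>D0\<close>, three times the left side, is divisible by p.\<close>

lemma D0_cg: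
  assumes "i < p" "k < p"
  shows "cg 2 (HH 1 (p - 1 - i) - HH 1 i - HH 1 (p - 1 - k) + HH 1 k) (P * (HH 2 i - HH 2 k))"
  using cg_diff[OF HH1_reflect[OF assms(1)] HH1_reflect[OF assms(2)]] by (simp add: algebra_simps)

section \<open>Double sums off the antidiagonal\<close>

lemma sum_diff_reflect:
  assumes "i < p"
  shows "cg 1 (\<Sum>l\<in>{..<p}-{i}. 1 / (of_nat i - of_nat l)) 0"
proof -
  have p: "{..<p} = {..p - 1}" using p_ge_5 by auto
  have "(\<Sum>l\<in>{..<p}-{i}. 1 / (of_nat i - of_nat l :: rat)) = HH 1 i - HH 1 (p - 1 - i)"
    using sum_diff_nodes[of i "p - 1" 1] assms unfolding p by simp
  also have "cg 1 \<dots> (HH 1 i - - ((-1) ^ 1 * HH 1 i))"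
    using assms p_ge_5 by (intro cg_diff cg_refl HH_reflect) auto
  finally show ?thesis by simp
qed

lemma R_inverse_diff: "i < p \<Longrightarrow> l < p \<Longrightarrow> i \<noteq> l \<Longrightarrow> 1 / (of_nat i - of_nat l) \<in> R"
proof -
  assume "i < p" "l < p" "i \<noteq> l"
  then have "\<bar>int i - int l\<bar> < int p" "int i - int l \<noteq> 0" by auto
  then have "\<not> int p dvd int i - int l" using zdvd_imp_le[of "int p" "\<bar>int i - int l\<bar>"] by auto
  then have "1 / of_int (int i - int l) \<in> R" by (rule R_inverse_int)
  then show ?thesis by simp
qed

definition ZZ :: "nat \<Rightarrow> rat" where
  "ZZ l = (\<Sum>i\<in>{..<p}-{l}. HH 1 i / (of_nat i - of_nat l))"

text \<open>After an index shift both sums have the denominators j - L with L = l + 1, and the terms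
  differ by 1/(j (j - L)) = (1/(j - L) - 1/j) / L. Completing the two sums of reciprocals to full
  ones, which vanish modulo p, yields 1/L twice.\<close>

lemma ZZ_Suc:
  assumes "Suc l < p"
  shows "cg 1 (ZZ (Suc l) - ZZ l) (2 / of_nat (Suc l) ^ 2)"
proof -
  define L where "L = Suc l"
  define t where "t j = 1 / (of_nat j - of_nat L :: rat)" for j
  define J where "J = {1..p-1} - {L}"
  have L: "L < p" "L \<ge> 1" "(of_nat L :: rat) \<noteq> 0" using assms by (auto simp: L_def)
  have finJ: "finite J" by (simp add: J_def)
  have 1: "ZZ L = (\<Sum>j\<in>J. HH 1 j * t j)"
  proof -
    have "{..<p} - {L} = insert 0 J" unfolding lessThan_p J_def using L by auto
    then show ?thesis using finJ by (simp add: ZZ_def t_def J_def)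
  qed
  \<comment> \<open>The shift sends i = p - 1 to j = p; the weight H_1(p - 1) found there vanishes
    modulo p.\<close>
  have "ZZ l = (\<Sum>j\<in>insert p J. HH 1 (j - 1) * t j)"
    unfolding ZZ_def t_def J_def using L assms p_ge_5
    by (intro sum.reindex_bij_witness[of _ "\<lambda>j. j - 1" Suc]) (auto simp: L_def)
  also have "\<dots> = HH 1 (p - 1) * t p + (\<Sum>j\<in>J. HH 1 (j - 1) * t j)"
    using finJ p_ge_5 by (subst sum.insert) (auto simp: J_def)
  finally have 2: "ZZ l = HH 1 (p - 1) * t p + (\<Sum>j\<in>J. HH 1 (j - 1) * t j)" .
  have "ZZ L - ZZ l = (\<Sum>j\<in>J. (1 / of_nat L) * (t j - 1 / of_nat j)) - t p * HH 1 (p - 1)"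
  proof -
    have "(\<Sum>j\<in>J. HH 1 j * t j) - (\<Sum>j\<in>J. HH 1 (j - 1) * t j) = (\<Sum>j\<in>J. (1 / of_nat L) * (t j - 1 / of_nat j))"
      unfolding sum_subtractf[symmetric]
    proof (intro sum.cong refl)
      fix j assume j: "j \<in> J"
      then have nz: "(of_nat j :: rat) \<noteq> 0" "of_nat j - of_nat L \<noteq> (0 :: rat)" by (auto simp: J_def)
      have "HH 1 j * t j - HH 1 (j - 1) * t j = 1 / of_nat j * t j"
        using j by (simp add: HH_pred J_def algebra_simps)
      also have "\<dots> = (1 / of_nat L) * (t j - 1 / of_nat j)"
        unfolding t_def using nz L by (simp add: field_simps)
      finally show "HH 1 j * t j - HH 1 (j - 1) * t j = (1 / of_nat L) * (t j - 1 / of_nat j)" .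
    qed
    then show ?thesis unfolding 1 2 by simp
  qed
  also have "\<dots> = (1 / of_nat L) * ((\<Sum>j\<in>J. t j) - (\<Sum>j\<in>J. 1 / of_nat j)) - t p * HH 1 (p - 1)"
    unfolding sum_distrib_left[symmetric] sum_subtractf ..
  also have "(\<Sum>j\<in>J. 1 / of_nat j) = HH 1 (p - 1) - 1 / of_nat L"
    unfolding J_def HH_def using L by (subst sum_diff1) auto
  also have "(\<Sum>j\<in>J. t j) = (\<Sum>j\<in>{..<p}-{L}. t j) + 1 / of_nat L"
  proof -
    have "{..<p} - {L} = insert 0 J" unfolding lessThan_p J_def using L by auto
    then show ?thesis using finJ by (simp add: J_def t_def)
  qed
  also have "(\<Sum>j\<in>{..<p}-{L}. t j) = - (\<Sum>j\<in>{..<p}-{L}. 1 / (of_nat L - of_nat j))"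
    unfolding sum_negf[symmetric] t_def by (intro sum.cong refl) (simp flip: divide_minus_right)
  also have "cg 1 ((1 / of_nat L) * (- (\<Sum>j\<in>{..<p}-{L}. 1 / (of_nat L - of_nat j)) + 1 / of_nat L - (HH 1 (p - 1) - 1 / of_nat L)) - t p * HH 1 (p - 1))
     ((1 / of_nat L) * (- 0 + 1 / of_nat L - (0 - 1 / of_nat L)) - t p * 0)"
  proof (intro cg_diff)
    show "cg 1 (1 / of_nat L * (- (\<Sum>j\<in>{..<p}-{L}. 1 / (of_nat L - of_nat j)) + 1 / of_nat L - (HH 1 (p - 1) - 1 / of_nat L)))
      (1 / of_nat L * (- 0 + 1 / of_nat L - (0 - 1 / of_nat L)))"
      using L p_ge_5 by (intro cg_mult_left R_inverse_less cg_diff cg_add cg_uminus sum_diff_reflect HH_full cg_refl) auto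
    have "t p = 1 / of_nat (p - L)" using L by (simp add: t_def of_nat_diff)
    moreover have "1 / of_nat (p - L) \<in> R" using L by (intro R_inverse_less) auto
    ultimately have "t p \<in> R" by (simp only:)
    then show "cg 1 (t p * HH 1 (p - 1)) (t p * 0)"
      using p_ge_5 by (intro cg_mult_left HH_full) auto
  qed
  finally show ?thesis by (simp add: L_def power2_eq_square)
qed

text \<open>The increments are those of 2 H_2, and 2 \<open>ZZ 0\<close> = H_1(p - 1)^2 + H_2(p - 1)
  vanishes modulo p.\<close>

lemma ZZ_cg: "l < p \<Longrightarrow> cg 1 (ZZ l) (2 * HH 2 l)"
proof (induction l)
  case 0
  have "2 * ZZ 0 = HH 1 (p - 1) * HH 1 (p - 1) + HH 2 (p - 1)"
  proof -
    have "ZZ 0 = (\<Sum>b=1..p-1. HH 1 b / of_nat b)"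
      unfolding ZZ_def lessThan_p by (intro sum.cong) auto
    then show ?thesis using HH_square_sum[of "p - 1"] by (simp add: power2_eq_square)
  qed
  also have "cg 1 \<dots> (HH 1 (p - 1) * 0 + 0)"
    using p_ge_5 by (intro cg_add cg_mult_left HH_full HH_R) auto
  finally have "cg 1 (of_nat 2 * ZZ 0) (of_nat 2 * 0)" by simp
  from cg_cancel_nat[OF this not_dvd_2(1)] show ?case by simp
next
  case (Suc l)
  then have "cg 1 (ZZ (Suc l) - ZZ l + ZZ l) (2 / of_nat (Suc l) ^ 2 + 2 * HH 2 l)"
    by (intro cg_add ZZ_Suc) auto
  then show ?case by (simp add: HH_Suc add.commute del: of_nat_Suc)
qed

lemma cg_inverse:
  assumes "int p dvd a - b" "\<not> int p dvd b"
  shows "cg 1 (1 / of_int a) (1 / of_int b)"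
proof -
  obtain k where k: "a - b = int p * k" using assms(1) by (elim dvdE)
  then have "(of_int (a - b) :: rat) = of_int (int p * k)" by simp
  then have "cg 1 (of_int a) (of_int b)" by (intro cgI[of "of_int k"]) auto
  moreover have "\<not> int p dvd a" using assms dvd_diff_commute dvd_diff_right_iff by blast
  ultimately show ?thesis using cg_divide_power[of a b 1] assms(2) by simp
qed

abbreviation off :: "nat \<Rightarrow> nat set" where "off i \<equiv> {..<p} - {p - 1 - i}"

text \<open>For k = p - 1 - l one has i + k + 1 = p + i - l, and H_2(k) is congruent to -H_2(l). The
  part with H_2(i) contains the vanishing sum of the 1/(i - l); the part with H_2(l) contains
  \<open>ZZ l\<close>.\<close>

lemma offdiag_sum_1:
  "cg 1 (\<Sum>i<p. \<Sum>k\<in>off i. HH 1 i * (HH 2 i - HH 2 k) / of_nat (i + k + 1)) (2 * (\<Sum>i<p. HH 2 i ^ 2))"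
proof -
  have swap: "(\<Sum>i<p. \<Sum>l\<in>{..<p}-{i}. HH 2 l * (HH 1 i / (of_nat i - of_nat l))) = (\<Sum>l<p. HH 2 l * ZZ l)"
  proof -
    have "(\<Sum>i<p. \<Sum>l\<in>{l\<in>{..<p}. l \<noteq> i}. HH 2 l * (HH 1 i / (of_nat i - of_nat l)))
      = (\<Sum>l<p. \<Sum>i\<in>{i\<in>{..<p}. l \<noteq> i}. HH 2 l * (HH 1 i / (of_nat i - of_nat l)))"
      by (rule sum.swap_restrict) auto
    moreover have "{l\<in>{..<p}. l \<noteq> i} = {..<p}-{i}" "{l\<in>{..<p}. i \<noteq> l} = {..<p}-{i}" for i by auto
    ultimately show ?thesis by (simp add: ZZ_def sum_distrib_left)
  qed
  have 1: "(\<Sum>i<p. \<Sum>k\<in>off i. HH 1 i * (HH 2 i - HH 2 k) / of_nat (i + k + 1))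
      = (\<Sum>i<p. \<Sum>l\<in>{..<p}-{i}. HH 1 i * ((HH 2 i - HH 2 (p - 1 - l)) * (1 / of_nat (i + (p - 1 - l) + 1))))"
    by (intro sum.cong refl sum.reindex_bij_witness[of _ "\<lambda>l. p - 1 - l" "\<lambda>k. p - 1 - k"]) auto
  have 2: "cg 1 (\<Sum>i<p. \<Sum>l\<in>{..<p}-{i}. HH 1 i * ((HH 2 i - HH 2 (p - 1 - l)) * (1 / of_nat (i + (p - 1 - l) + 1)))) (\<Sum>i<p. \<Sum>l\<in>{..<p}-{i}. HH 1 i * ((HH 2 i - - ((-1) ^ 2 * HH 2 l)) * (1 / (of_nat i - of_nat l))))"
  proof (intro cg_sum cg_mult_left cg_mult cg_diff HH_reflect cg_refl R_diff)
    fix i l assume i: "i \<in> {..<p}" and l: "l \<in> {..<p}-{i}"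
    then have "1 / of_nat (i + (p - 1 - l) + 1) = 1 / (of_int (int i + int p - int l) :: rat)"
      by (simp add: of_nat_diff)
    also have "cg 1 \<dots> (1 / of_int (int i - int l))"
    proof (rule cg_inverse)
      have "\<bar>int i - int l\<bar> < int p" "int i - int l \<noteq> 0" using i l by auto
      then show "\<not> int p dvd int i - int l" using zdvd_imp_le[of "int p" "\<bar>int i - int l\<bar>"] by auto
    qed simp
    finally show "cg 1 (1 / of_nat (i + (p - 1 - l) + 1)) (1 / (of_nat i - of_nat l))" by simp
    show "1 / (of_nat i - of_nat l) \<in> R" using i l by (intro R_inverse_diff) auto
  qed (use p_ge_5 in auto)
  have 3: "(\<Sum>i<p. \<Sum>l\<in>{..<p}-{i}. HH 1 i * ((HH 2 i - - ((-1) ^ 2 * HH 2 l)) * (1 / (of_nat i - of_nat l))))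
     = (\<Sum>i<p. HH 1 i * HH 2 i * (\<Sum>l\<in>{..<p}-{i}. 1 / (of_nat i - of_nat l))) + (\<Sum>l<p. HH 2 l * ZZ l)"
    unfolding swap[symmetric] sum_distrib_left sum.distrib[symmetric] by (intro sum.cong refl) (simp add: add_divide_distrib algebra_simps)
  have "cg 1 ((\<Sum>i<p. HH 1 i * HH 2 i * (\<Sum>l\<in>{..<p}-{i}. 1 / (of_nat i - of_nat l))) + (\<Sum>l<p. HH 2 l * ZZ l))
      ((\<Sum>i<p. HH 1 i * HH 2 i * 0) + (\<Sum>l<p. HH 2 l * (2 * HH 2 l)))"
    by (intro cg_add cg_sum cg_mult_left[of "HH 1 _ * HH 2 _"] cg_mult_left[of "HH 2 _"] sum_diff_reflect ZZ_cg R_mult HH_R) auto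
  from cg_trans[OF 2[unfolded 3] this] show ?thesis unfolding 1 by (simp add: sum_distrib_left power2_eq_square mult_ac)
qed

text \<open>Modulo \<open>p\<close>, the quotient by \<open>p\<close> of an off-diagonal term \<open>tt (p - 1) i k\<close> is \<open>sg (i + k) / (i + k + 1)\<close>.\<close>

abbreviation sg :: "nat \<Rightarrow> rat" where "sg s \<equiv> (if s < p - 1 then - 1 else 1)"

lemma HH_beyond: "HH 1 (p + q) = HH 1 (p - 1) + 1 / P + (\<Sum>m=1..q. 1 / of_nat (p + m))"
proof (induction q)
  case 0
  show ?case using HH_Suc[of 1 "p - 1"] p_ge_5 by simp
qed (simp add: HH_Suc)

lemma R_inverse_beyond: "m \<in> {1..q} \<Longrightarrow> q < p \<Longrightarrow> 1 / of_nat (p + m) \<in> R"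
  by (intro R_inverse_nat) (auto dest!: dvd_imp_le simp: dvd_add_right_iff)

text \<open>Below the antidiagonal i + k + 1 runs from i + 1 to p - 1, above it from p + 1 to p + i.
  Each range contributes H_1(i) modulo p, the first because of the sign and H_1(p - 1) being
  divisible by p.\<close>

lemma inner_sum_cg:
  assumes "i < p"
  shows "cg 1 (\<Sum>k\<in>off i. sg (i + k) / of_nat (i + k + 1)) (2 * HH 1 i)"
proof -
  have U: "off i = {..<p-1-i} \<union> {p-i..<p}" using assms by auto
  have "(\<Sum>k\<in>off i. sg (i + k) / of_nat (i + k + 1)) =
     (\<Sum>k\<in>{..<p-1-i}. sg (i + k) / of_nat (i + k + 1)) + (\<Sum>k\<in>{p-i..<p}. sg (i + k) / of_nat (i + k + 1))"
    unfolding U by (intro sum.union_disjoint) auto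
  also have "(\<Sum>k\<in>{..<p-1-i}. sg (i + k) / of_nat (i + k + 1)) = - (\<Sum>m\<in>{i+1..p-1}. 1 / of_nat m)"
    unfolding sum_negf[symmetric]
    by (intro sum.reindex_bij_witness[of _ "\<lambda>m. m - i - 1" "\<lambda>k. i + k + 1"]) auto
  also have "(\<Sum>m\<in>{i+1..p-1}. 1 / of_nat m) = HH 1 (p - 1) - HH 1 i"
  proof -
    have "{1..p-1} = {1..i} \<union> {i+1..p-1}" using assms by auto
    then have "HH 1 (p - 1) = (\<Sum>m\<in>{1..i} \<union> {i+1..p-1}. 1 / of_nat m)"
      by (simp add: HH_def)
    also have "\<dots> = HH 1 i + (\<Sum>m\<in>{i+1..p-1}. 1 / of_nat m)"
      unfolding HH_def by (subst sum.union_disjoint) auto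
    finally have "HH 1 (p - 1) = HH 1 i + (\<Sum>m\<in>{i+1..p-1}. 1 / of_nat m)" .
    then show ?thesis by simp
  qed
  also have "(\<Sum>k\<in>{p-i..<p}. sg (i + k) / of_nat (i + k + 1)) = (\<Sum>m\<in>{1..i}. 1 / of_nat (p + m))"
    using assms by (intro sum.reindex_bij_witness[of _ "\<lambda>m. p + m - i - 1" "\<lambda>k. i + k + 1 - p"]) auto
  also have "cg 1 (- (HH 1 (p - 1) - HH 1 i) + (\<Sum>m\<in>{1..i}. 1 / of_nat (p + m))) (- (0 - HH 1 i) + (\<Sum>m\<in>{1..i}. 1 / of_nat m))"
  proof (intro cg_add cg_uminus cg_diff cg_sum HH_full cg_refl)
    fix m assume m: "m \<in> {1..i}"
    have "\<not> int p dvd int m" using m assms not_dvd_less[of m] by auto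
    then have "cg 1 (1 / of_int (int (p + m))) (1 / of_int (int m))" by (intro cg_inverse) auto
    then show "cg 1 (1 / of_nat (p + m)) (1 / of_nat m)" by simp
  qed (use p_ge_5 in auto)
  finally show ?thesis by (simp add: HH_def)
qed

lemma offdiag_sum_2:
  assumes "\<And>i. i < p \<Longrightarrow> f i \<in> R"
  shows "cg 1 (\<Sum>i<p. \<Sum>k\<in>off i. sg (i + k) * f i / of_nat (i + k + 1)) (2 * (\<Sum>i<p. f i * HH 1 i))"
proof -
  have "(\<Sum>i<p. \<Sum>k\<in>off i. sg (i + k) * f i / of_nat (i + k + 1)) = (\<Sum>i<p. f i * (\<Sum>k\<in>off i. sg (i + k) / of_nat (i + k + 1)))"
    unfolding sum_distrib_left by (intro sum.cong refl) simp
  also have "cg 1 \<dots> (\<Sum>i<p. f i * (2 * HH 1 i))"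
    using assms by (intro cg_sum cg_mult_left[of "f _"] inner_sum_cg) auto
  finally show ?thesis by (simp add: sum_distrib_left mult_ac)
qed
end

section \<open>The double sums modulo the square of the prime\<close>

text \<open>The quotient of binom(2n, n) by binom(2n, s).\<close>

definition Rw :: "nat \<Rightarrow> nat \<Rightarrow> rat" where
  "Rw n s = fact s * fact (2 * n - s) / fact n ^ 2"

lemma tt_binomial:
  assumes "i \<le> n" "k \<le> n"
  shows "tt n i k = of_nat (n choose i) ^ 3 * of_nat (n choose k) ^ 3 * Rw n (i + k)"
  unfolding tt_def Rw_def using assms
  by (simp add: binomial_fact field_simps eval_nat_numeral)

lemma Rw_reflect: "d \<le> n \<Longrightarrow> Rw n (n + d) = Rw n (n - d)"
  by (simp add: Rw_def mult.commute mult_2 add.commute)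

lemma Rw_step:
  assumes "d < n"
  shows "Rw n (n - Suc d) = Rw n (n - d) * of_nat (n + d + 1) / of_nat (n - d)"
proof -
  have "n - d = Suc (n - Suc d)" "2 * n - (n - Suc d) = Suc (2 * n - (n - d))" "Suc (2 * n - (n - d)) = n + d + 1"
    using assms by auto
  then have 1: "fact (n - d) = of_nat (n - d) * (fact (n - Suc d) :: rat)"
    and 2: "fact (2 * n - (n - Suc d)) = of_nat (n + d + 1) * (fact (2 * n - (n - d)) :: rat)"
    by (metis fact_Suc, metis fact_Suc)
  have "(of_nat (n - d) :: rat) \<noteq> 0" using assms by simp
  then show ?thesis unfolding Rw_def 1 2 by (simp add: mult_ac del: of_nat_Suc of_nat_add of_nat_diff)
qed

context padic begin

text \<open>The first step away from the centre multiplies by p / (p - 1) and supplies the factor p.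
  Each later one multiplies by (p + d) / (p - d - 1), a unit congruent to -d / (d + 1).\<close>

lemma Rw_cg: "d \<in> {1..p-1} \<Longrightarrow> \<exists>v. Rw (p - 1) (p - 1 - d) = P * v \<and> cg 1 v ((-1) ^ d * (1 / of_nat d))"
proof (induction d)
  case (Suc d)
  show ?case
  proof (cases "d = 0")
    case True
    have "Rw (p - 1) (p - 1 - Suc 0) = Rw (p - 1) (p - 1) * of_nat p / of_nat (p - 1)"
      using Rw_step[of 0 "p - 1"] p_ge_5 by simp
    also have "Rw (p - 1) (p - 1) = 1" by (simp add: Rw_def power2_eq_square)
    finally have "Rw (p - 1) (p - 1 - Suc 0) = P * (1 / (P - of_nat 1) ^ 1)" using p_ge_5 by (simp add: of_nat_diff)
    then show ?thesis using inverse_shift[of 1 1] p_ge_5 True by (intro exI[of _ "1 / (P - of_nat 1) ^ 1"]) simp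
  next
    case False
    with Suc obtain v where v: "Rw (p - 1) (p - 1 - d) = P * v" "cg 1 v ((-1) ^ d * (1 / of_nat d))" by auto
    have d: "d < p" "Suc d < p" "0 < d" using False Suc.prems by auto
    have e: "of_nat (p - 1 - d) = P - of_nat (Suc d)" "p - 1 + d + 1 = p + d" using d by (auto simp: of_nat_diff)
    have "Rw (p - 1) (p - 1 - Suc d) = Rw (p - 1) (p - 1 - d) * of_nat (p - 1 + d + 1) / of_nat (p - 1 - d)"
      using Suc.prems by (intro Rw_step) auto
    also have "\<dots> = P * (v * (of_nat (p + d) * (1 / (P - of_nat (Suc d)) ^ 1)))"
      unfolding v e by simp
    finally have 1: "Rw (p - 1) (p - 1 - Suc d) = P * (v * (of_nat (p + d) * (1 / (P - of_nat (Suc d)) ^ 1)))" .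
    have pd: "cg 1 (of_nat (p + d)) (of_nat d)" by (rule cgI[of 1]) auto
    have vR: "v \<in> R" using d by (intro cg_R[OF v(2)] R_mult R_power R_inverse_less) auto
    have "cg 1 (v * (of_nat (p + d) * (1 / (P - of_nat (Suc d)) ^ 1)))
        ((-1) ^ d * (1 / of_nat d) * (of_nat d * ((-1) ^ 1 * (1 / of_nat (Suc d)) ^ 1)))"
      using d inverse_shift[of "Suc d" 1]
      by (intro cg_mult[OF v(2)] cg_mult[OF pd] vR R_mult R_power R_inverse_less) auto
    also have "(-1) ^ d * (1 / of_nat d) * (of_nat d * ((-1) ^ 1 * (1 / of_nat (Suc d)) ^ 1)) = ((-1) ^ Suc d * (1 / of_nat (Suc d)) :: rat)"
      using d by simp
    finally show ?thesis using 1 by blast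
  qed
qed simp

text \<open>s + 1 is p - d below and p + d above the antidiagonal.\<close>

lemma sg_inverse_cg:
  assumes "d \<in> {1..p-1}" "s = p - 1 - d \<or> s = p - 1 + d"
  shows "cg 1 (1 / of_nat d) (sg s / of_nat (s + 1))"
proof -
  have "0 < d" "d < p" using assms(1) by auto
  then have nd: "\<not> int p dvd int d" using not_dvd_less[of d] by auto
  have p: "int p dvd x \<longleftrightarrow> int p dvd y" if "x = y + int p * c" for x y c using that by (metis dvd_add_times_triv_right_iff mult.commute)
  show ?thesis
  proof (cases "s = p - 1 - d")
    case True
    then have s: "int d - (- int (s + 1)) = int p" "sg s = - 1" using assms(1) by auto
    have "\<not> int p dvd - int (s + 1)" using nd s(1) p[of "- int (s + 1)" "int d" "- 1"] by auto
    then have "cg 1 (1 / of_int (int d)) (1 / of_int (- int (s + 1)))" using s(1) by (intro cg_inverse) auto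
    moreover have "1 / of_int (- int (s + 1)) = sg s / (of_nat (s + 1) :: rat)" unfolding s(2)
      by (simp only: of_int_minus of_int_of_nat_eq minus_divide_right[symmetric] minus_divide_left)
    ultimately show ?thesis by (simp only: of_int_of_nat_eq)
  next
    case False
    then have s: "int d - int (s + 1) = int p * (-1)" "sg s = 1" using assms by auto
    have "\<not> int p dvd int (s + 1)" using nd s(1) p[of "int (s + 1)" "int d" 1] by auto
    then have "cg 1 (1 / of_int (int d)) (1 / of_int (int (s + 1)))" using s(1) by (intro cg_inverse) auto
    then show ?thesis unfolding s(2) by (simp only: of_int_of_nat_eq)
  qed
qed

lemma offdiag_distance:
  assumes "i < p" "k < p" "i + k \<noteq> p - 1"
  obtains d where "d \<in> {1..p-1}" "i + k = p - 1 - d \<or> i + k = p - 1 + d" "even (i + k) = even d"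
proof (cases "i + k < p - 1")
  case True
  then have "i + k + (p - 1 - (i + k)) = p - 1" by simp
  moreover have "even (p - 1)" using odd_p by simp
  ultimately have "even (i + k) = even (p - 1 - (i + k))" by (metis even_add)
  then show ?thesis using True by (intro that[of "p - 1 - (i + k)"]) auto
next
  case False
  then have "i + k = (p - 1) + (i + k - (p - 1))" by simp
  moreover have "even (p - 1)" using odd_p by simp
  ultimately have "even (i + k) = even (i + k - (p - 1))" by (metis even_add)
  then show ?thesis using False assms by (intro that[of "i + k - (p - 1)"]) auto
qed

lemma tt_offdiag:
  assumes "i < p" "k < p" "i + k \<noteq> p - 1"
  obtains v where "tt (p - 1) i k = P * v" "v \<in> R" "cg 1 v (sg (i + k) / of_nat (i + k + 1))"
proof -
  obtain d where d: "d \<in> {1..p-1}" "i + k = p - 1 - d \<or> i + k = p - 1 + d" and par: "even (i + k) = even d"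
    using offdiag_distance[OF assms] .
  obtain w where w: "Rw (p - 1) (p - 1 - d) = P * w" "cg 1 w ((-1) ^ d * (1 / of_nat d))"
    using Rw_cg[OF d(1)] by blast
  have Rik: "Rw (p - 1) (i + k) = P * w" using d w(1) Rw_reflect[of d "p - 1"] by auto
  have dR: "1 / of_nat d \<in> R" using d by (intro R_inverse_less) auto
  define v where "v = of_nat (p - 1 choose i) ^ 3 * (of_nat (p - 1 choose k) ^ 3 * w)"
  have "tt (p - 1) i k = P * v"
    using assms(1,2) tt_binomial[of i "p - 1" k] unfolding v_def Rik by (simp add: mult_ac)
  have "cg 1 v (((-1) ^ i) ^ 3 * (((-1) ^ k) ^ 3 * ((-1) ^ d * (1 / of_nat d))))"
    unfolding v_def using assms dR by (intro cg_mult w cg_power choose_cg1 R_power R_mult) auto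
  \<comment> \<open>Since p - 1 is even, i + k and d have the same parity.\<close>
  also have "((-1) ^ i) ^ 3 * (((-1) ^ k) ^ 3 * ((-1) ^ d * (1 / of_nat d))) = (1 / of_nat d :: rat)"
    using par by (cases "even i"; cases "even k"; cases "even d") simp_all
  finally have v: "cg 1 v (1 / of_nat d)" .
  show thesis
    by (rule that[of v]) (fact \<open>tt (p - 1) i k = P * v\<close> cg_R[OF v dR] cg_trans[OF v sg_inverse_cg[OF d]])+
qed

text \<open>Exactly one of the two arguments reaches p, and its harmonic number contains the term
  1/p once.\<close>

lemma HH_difference_cg:
  assumes "i < p" "k < p" "i + k \<noteq> p - 1"
  shows "cg 1 (P * (HH 1 (i + k) - HH 1 (2 * (p - 1) - (i + k)))) (sg (i + k))"
proof -
  obtain d where d: "d \<in> {1..p-1}" "i + k = p - 1 - d \<or> i + k = p - 1 + d"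
    using offdiag_distance[OF assms] by blast
  define c where "c = HH 1 (p - 1) + (\<Sum>m=1..d-1. 1 / of_nat (p + m)) - HH 1 (p - 1 - d)"
  have cR: "c \<in> R" unfolding c_def using d p_ge_5 by (intro R_diff R_add HH_R R_sum R_inverse_beyond[of _ "d - 1"]) auto
  have "p - 1 + d = p + (d - 1)" using d by auto
  then have "HH 1 (p - 1 + d) - HH 1 (p - 1 - d) = 1 / P + c"
    using HH_beyond[of "d - 1"] by (simp add: c_def)
  then have c: "P * (HH 1 (p - 1 + d) - HH 1 (p - 1 - d)) = 1 + P * c" using p_ge_5 by (simp add: algebra_simps)
  have 1: "cg 1 (P * (HH 1 (p - 1 + d) - HH 1 (p - 1 - d))) 1" unfolding c using cR by (intro cgI[of c]) auto
  from d(2) show ?thesis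
  proof
    assume s: "i + k = p - 1 - d"
    then have "2 * (p - 1) - (i + k) = p - 1 + d" "sg (i + k) = - 1" using d by auto
    then show ?thesis using cg_uminus[OF 1] unfolding s by (simp add: algebra_simps)
  next
    assume s: "i + k = p - 1 + d"
    then have "2 * (p - 1) - (i + k) = p - 1 - d" "sg (i + k) = 1" using d by auto
    then show ?thesis using 1 unfolding s by simp
  qed
qed

lemma Cterm_eq:
  assumes "i < p" "k < p"
  defines "D \<equiv> HH 1 (p - 1 - i) - HH 1 i - HH 1 (p - 1 - k) + HH 1 k"
    and "S \<equiv> HH 1 (i + k) - HH 1 (2 * (p - 1) - (i + k))"
    and "Q \<equiv> HH 1 (p - 1 - i) - HH 1 i + HH 1 (p - 1 - k) - HH 1 k"
    and "E \<equiv> HH 2 i + HH 2 (p - 1 - i) - HH 2 k - HH 2 (p - 1 - k)"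
  shows "Cterm (p - 1) i k = tt (p - 1) i k * (HH 1 i * ((3 * D * (3 * Q + 2 * S) + 3 * E) / 2) - 6 * HH 2 i * D + 3 * HH 3 i)"
proof -
  interpret local_expansion "p - 1" i k using assms by unfold_locales auto
  have "D0 = 3 * D" "Dp = 3 * Q + 2 * S" unfolding D0_def Dp_def D_def Q_def S_def by simp_all
  then show ?thesis unfolding Cterm_def E_def by simp
qed

text \<open>\<open>tt\<close> supplies one factor p, so the bracket matters modulo p only. There
  \<open>?D\<close> is divisible by p, which only the 1/p in \<open>?S\<close> can compensate:
  \<open>?D * ?S\<close> becomes \<open>B * sg (i + k)\<close>, while the terms with
  \<open>?D * ?Q\<close>, \<open>?E\<close> and \<open>HH 2 i * ?D\<close> vanish.\<close>

lemma Cterm_offdiag: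
  assumes "i < p" "k < p" "i + k \<noteq> p - 1"
  shows "cg 2 (Cterm (p - 1) i k)
    (P * (3 * (HH 1 i * (HH 2 i - HH 2 k) / of_nat (i + k + 1) + sg (i + k) * HH 3 i / of_nat (i + k + 1))))"
proof -
  let ?D = "HH 1 (p - 1 - i) - HH 1 i - HH 1 (p - 1 - k) + HH 1 k"
  let ?S = "HH 1 (i + k) - HH 1 (2 * (p - 1) - (i + k))"
  let ?Q = "HH 1 (p - 1 - i) - HH 1 i + HH 1 (p - 1 - k) - HH 1 k"
  let ?E = "HH 2 i + HH 2 (p - 1 - i) - HH 2 k - HH 2 (p - 1 - k)"
  define r where "r = sg (i + k) / of_nat (i + k + 1)"
  define B where "B = HH 2 i - HH 2 k"
  obtain v where v: "tt (p - 1) i k = P * v" "v \<in> R" "cg 1 v r"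
    using tt_offdiag[OF assms] unfolding r_def by blast
  have sgR: "sg (i + k) \<in> R" by auto
  have BR: "B \<in> R" unfolding B_def using assms by auto
  obtain c where c: "c \<in> R" "?D = P * (B + P * c)"
    using D0_cg[OF assms(1,2)] unfolding cg_def B_def by (auto simp: algebra_simps power2_eq_square)
  have QR: "?Q \<in> R" using assms by (intro R_add R_diff HH_R) auto
  have E: "cg 1 ?E 0"
  proof -
    have "cg 1 ?E (HH 2 i + - ((-1) ^ 2 * HH 2 i) - HH 2 k - - ((-1) ^ 2 * HH 2 k))"
      using assms p_ge_5 by (intro cg_diff cg_add cg_refl HH_reflect) auto
    then show ?thesis by simp
  qed
  have HR: "HH s i \<in> R" for s using assms by auto
  have rR: "r \<in> R"
    using v(3) by (rule cg_R[OF cg_sym]) (rule v)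
  define Z where "Z = v * (HH 1 i * ((3 * (B + P * c) * (3 * (P * ?Q) + 2 * (P * ?S)) + 3 * ?E) / 2)
      - 6 * HH 2 i * (P * (B + P * c)) + 3 * HH 3 i)"
  have 1: "Cterm (p - 1) i k = P * Z"
    unfolding Z_def Cterm_eq[OF assms(1,2)] v(1) unfolding c(2) by (simp add: algebra_simps)
  have 2: "cg 2 (P * Z) (P * (r * (HH 1 i * ((3 * B * (3 * 0 + 2 * sg (i + k)) + 3 * 0) / 2) - 6 * HH 2 i * 0 + 3 * HH 3 i)))"
    unfolding Z_def
  proof (intro cg_P cg_mult[OF v(3) _ v(2)] cg_diff cg_add cg_refl)
    have Bc: "cg 1 (3 * (B + P * c)) (3 * B)"
      using c(1) by (intro cgI[of "3 * c"]) (auto simp: algebra_simps)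
    have "cg 1 (1 / of_nat 2 * (3 * (B + P * c) * (3 * (P * ?Q) + 2 * (P * ?S)) + 3 * ?E)) (1 / of_nat 2 * (3 * B * (3 * 0 + 2 * sg (i + k)) + 3 * 0))"
      using c(1) BR QR sgR assms p_ge_5
      by (intro cg_mult_left R_inverse_less cg_add cg_mult[OF Bc] cg_zero_P HH_difference_cg E) auto
    then show "cg 1 (HH 1 i * ((3 * (B + P * c) * (3 * (P * ?Q) + 2 * (P * ?S)) + 3 * ?E) / 2)) (HH 1 i * ((3 * B * (3 * 0 + 2 * sg (i + k)) + 3 * 0) / 2))"
      by (intro cg_mult_left HR) simp
    show "cg 1 (6 * HH 2 i * (P * (B + P * c))) (6 * HH 2 i * 0)"
      using c(1) BR by (intro cg_mult_left R_mult HR cg_zero_P) auto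
    show "HH 1 i * ((3 * B * (3 * 0 + 2 * sg (i + k)) + 3 * 0) / 2) - 6 * HH 2 i * 0 + 3 * HH 3 i \<in> R"
      using BR HR sgR by (intro R_add R_diff R_mult R_half) auto
  qed
  have 3: "r * (HH 1 i * ((3 * B * (3 * 0 + 2 * sg (i + k)) + 3 * 0) / 2) - 6 * HH 2 i * 0 + 3 * HH 3 i)
     = 3 * (HH 1 i * B / of_nat (i + k + 1) + sg (i + k) * HH 3 i / of_nat (i + k + 1))"
  proof -
    have "sg (i + k) * sg (i + k) = 1" by simp
    then have "e * e = 1 \<Longrightarrow> e / m * (h * ((3 * B * (3 * 0 + 2 * e) + 3 * 0) / 2) - 6 * z * 0 + 3 * y) = 3 * (h * B / m + e * y / m)" for h z y m e :: rat
      by (simp add: algebra_simps add_divide_distrib)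
    then show ?thesis unfolding r_def using \<open>sg (i + k) * sg (i + k) = 1\<close> by blast
  qed
  show ?thesis using 2[unfolded 3] unfolding 1 B_def .
qed

lemma tt_diag:
  assumes "i < p"
  shows "cg 2 (tt (p - 1) i (p - 1 - i)) (1 - 6 * (P * HH 1 i))"
proof -
  have "Rw (p - 1) (p - 1) = 1" by (simp add: Rw_def power2_eq_square)
  then have "tt (p - 1) i (p - 1 - i) = of_nat (p - 1 choose i) ^ 6"

    using assms tt_binomial[of i "p - 1" "p - 1 - i"] binomial_symmetric[of i "p - 1"] by (simp flip: power_add)
  also have "cg 2 \<dots> (((-1) ^ i * (1 - P * HH 1 i)) ^ 6)"
    using assms by (intro cg_power choose_cg R_mult R_power R_diff) auto
  also have "((-1) ^ i * (1 - P * HH 1 i)) ^ 6 = (1 - P * HH 1 i) ^ 6"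
    unfolding power_mult_distrib by (simp flip: power_mult)
  also have "cg 2 \<dots> (1 - 6 * (P * HH 1 i))"
  proof (rule cgI)
    let ?h = "HH 1 i"
    have "?h \<in> R" using assms by auto
    then show "?h ^ 2 * (15 - 20 * (P * ?h) + 15 * (P * ?h) ^ 2 - 6 * (P * ?h) ^ 3 + (P * ?h) ^ 4) \<in> R"
      by (intro R_mult R_add R_diff R_power) auto
    show "(1 - P * ?h) ^ 6 - (1 - 6 * (P * ?h)) = P ^ 2 * (?h ^ 2 * (15 - 20 * (P * ?h) + 15 * (P * ?h) ^ 2 - 6 * (P * ?h) ^ 3 + (P * ?h) ^ 4))"
    proof -
      have "(1 - x) ^ 6 - (1 - 6 * x) = x ^ 2 * (15 - 20 * x + 15 * x ^ 2 - 6 * x ^ 3 + x ^ 4)" for x :: rat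
        by (simp add: eval_nat_numeral algebra_simps)
      from this[of "P * ?h"] show ?thesis by (simp only: power_mult_distrib mult.assoc)
    qed
  qed
  finally show ?thesis .
qed

text \<open>For k = p - 1 - i the quantities \<open>S\<close>, \<open>Q\<close> and \<open>E\<close>
  of \<open>Cterm_eq\<close> are exactly zero. The coefficient of p collects -6 H_1 times 3 H_3 and
  -6 H_2 times 2 H_2.\<close>

lemma Cterm_diag:
  assumes "i < p"
  shows "cg 2 (Cterm (p - 1) i (p - 1 - i)) (3 * HH 3 i - P * (18 * (HH 1 i * HH 3 i) + 12 * HH 2 i ^ 2))"
proof -
  let ?k = "p - 1 - i"
  let ?D = "HH 1 (p - 1 - i) - HH 1 i - HH 1 (p - 1 - ?k) + HH 1 ?k"
  have k: "?k < p" "p - 1 - ?k = i" "i + ?k = p - 1" "2 * (p - 1) - (p - 1) = p - 1" using assms by auto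
  have HR: "HH s i \<in> R" for s using assms by auto
  have D: "cg 2 ?D (P * (2 * HH 2 i))"
  proof -
    have "cg 1 (HH 2 i - HH 2 ?k) (HH 2 i - - ((-1) ^ 2 * HH 2 i))"
      using assms p_ge_5 by (intro cg_diff cg_refl HH_reflect) auto
    then have "cg 2 (P * (HH 2 i - HH 2 ?k)) (P * (2 * HH 2 i))" by (intro cg_P) simp
    with D0_cg[OF assms k(1)] show ?thesis by (rule cg_trans)
  qed
  have "Cterm (p - 1) i ?k = tt (p - 1) i ?k * (3 * HH 3 i - 6 * HH 2 i * ?D)"
    unfolding Cterm_eq[OF assms k(1)] k by (simp add: algebra_simps)
  also have "cg 2 \<dots> ((1 - 6 * (P * HH 1 i)) * (3 * HH 3 i - 6 * HH 2 i * (P * (2 * HH 2 i))))"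
    using HR by (intro cg_mult tt_diag assms cg_diff cg_refl cg_mult_left D cg_R[OF tt_diag[OF assms]] R_diff R_mult) auto
  also have "cg 2 \<dots> (3 * HH 3 i - P * (18 * (HH 1 i * HH 3 i) + 12 * HH 2 i ^ 2))"
  proof (rule cgI)
    show "72 * HH 1 i * HH 2 i ^ 2 \<in> R" using HR by (intro R_mult R_power) auto
  qed (simp add: algebra_simps power2_eq_square)
  finally show ?thesis .
qed

lemma sum_split_diag:
  fixes f :: "nat \<Rightarrow> nat \<Rightarrow> rat"
  shows "(\<Sum>i\<le>p-1. \<Sum>k\<le>p-1. f i k) = (\<Sum>i<p. f i (p - 1 - i)) + (\<Sum>i<p. \<Sum>k\<in>off i. f i k)"
proof -
  have "{..p - 1} = {..<p}" using p_ge_5 by auto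
  then show ?thesis unfolding sum.distrib[symmetric]
    by (simp, intro sum.cong refl, subst sum.remove[of _ "p - 1 - _"]) auto
qed

lemma tt_sum: "cg 2 (\<Sum>i\<le>p-1. \<Sum>k\<le>p-1. tt (p - 1) i k) (- 3 * P)"
proof -
  have 1: "cg 2 (\<Sum>i<p. tt (p - 1) i (p - 1 - i)) (P - 6 * (P * 1))"
  proof -
    have "cg 2 (\<Sum>i<p. tt (p - 1) i (p - 1 - i)) (\<Sum>i<p. 1 - 6 * (P * HH 1 i))"
      by (intro cg_sum tt_diag) auto
    also have "(\<Sum>i<p. 1 - 6 * (P * HH 1 i)) = P - 6 * (P * (\<Sum>i<p. HH 1 i))"
      by (simp add: sum_subtractf sum_distrib_left)
    also have "cg 2 \<dots> (P - 6 * (P * 1))" by (intro cg_diff cg_refl cg_mult_left cg_P sum_HH1) auto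
    finally show ?thesis .
  qed
  have 2: "cg 2 (\<Sum>i<p. \<Sum>k\<in>off i. tt (p - 1) i k) (P * (2 * 1))"
  proof -
    have "cg 2 (\<Sum>i<p. \<Sum>k\<in>off i. tt (p - 1) i k) (\<Sum>i<p. \<Sum>k\<in>off i. P * (sg (i + k) * 1 / of_nat (i + k + 1)))"
    proof (intro cg_sum)
      fix i k assume ik: "i \<in> {..<p}" "k \<in> off i"
      then have "i < p" "k < p" "i + k \<noteq> p - 1" by auto
      from tt_offdiag[OF this] obtain v where "tt (p - 1) i k = P * v" "cg 1 v (sg (i + k) / of_nat (i + k + 1))" .
      then show "cg 2 (tt (p - 1) i k) (P * (sg (i + k) * 1 / of_nat (i + k + 1)))"
        using cg_P[of v] by (simp only: mult_1_right)
    qed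
    also have "(\<Sum>i<p. \<Sum>k\<in>off i. P * (sg (i + k) * 1 / of_nat (i + k + 1)))
       = P * (\<Sum>i<p. \<Sum>k\<in>off i. sg (i + k) * 1 / of_nat (i + k + 1))" by (simp only: sum_distrib_left)
    also have "cg 2 \<dots> (P * (2 * (\<Sum>i<p. 1 * HH 1 i)))"
      by (intro cg_P offdiag_sum_2) auto
    also have "cg 2 \<dots> (P * (2 * 1))" using sum_HH1 by (intro cg_P cg_mult_left) auto
    finally show ?thesis .
  qed
  \<comment> \<open>The antidiagonal gives p - 6p, the other terms 2p.\<close>
  show ?thesis unfolding sum_split_diag using cg_add[OF 1 2] by simp
qed

lemma Cterm_sum: "cg 2 (\<Sum>i\<le>p-1. \<Sum>k\<le>p-1. Cterm (p - 1) i k) (- (2 * (P * Bp)))"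
proof -
  let ?S3 = "\<Sum>i<p. HH 3 i" and ?S13 = "\<Sum>i<p. HH 1 i * HH 3 i" and ?S22 = "\<Sum>i<p. HH 2 i ^ 2"
  have 1: "cg 2 (\<Sum>i<p. Cterm (p - 1) i (p - 1 - i)) (3 * ?S3 - P * (18 * ?S13 + 12 * ?S22))"
  proof -
    have "cg 2 (\<Sum>i<p. Cterm (p - 1) i (p - 1 - i)) (\<Sum>i<p. 3 * HH 3 i - P * (18 * (HH 1 i * HH 3 i) + 12 * HH 2 i ^ 2))"
      by (intro cg_sum Cterm_diag) auto
    also have "(\<Sum>i<p. 3 * HH 3 i - P * (18 * (HH 1 i * HH 3 i) + 12 * HH 2 i ^ 2)) = 3 * ?S3 - P * (18 * ?S13 + 12 * ?S22)"
      by (simp only: sum_subtractf sum_distrib_left[symmetric] sum.distrib)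
    finally show ?thesis .
  qed
  have dist: "(\<Sum>i<p. \<Sum>k\<in>off i. P * (3 * (g i k + h i k))) = P * (3 * ((\<Sum>i<p. \<Sum>k\<in>off i. g i k) + (\<Sum>i<p. \<Sum>k\<in>off i. h i k)))"
    for g h :: "nat \<Rightarrow> nat \<Rightarrow> rat"
    by (simp only: sum_distrib_left[symmetric] sum.distrib)
  have 2: "cg 2 (\<Sum>i<p. \<Sum>k\<in>off i. Cterm (p - 1) i k) (P * (3 * (2 * ?S22 + 2 * (\<Sum>i<p. HH 3 i * HH 1 i))))"
  proof -
    have "cg 2 (\<Sum>i<p. \<Sum>k\<in>off i. Cterm (p - 1) i k) (\<Sum>i<p. \<Sum>k\<in>off i.
       P * (3 * (HH 1 i * (HH 2 i - HH 2 k) / of_nat (i + k + 1) + sg (i + k) * HH 3 i / of_nat (i + k + 1))))"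
      by (intro cg_sum Cterm_offdiag) auto
    also have "(\<Sum>i<p. \<Sum>k\<in>off i.
         P * (3 * (HH 1 i * (HH 2 i - HH 2 k) / of_nat (i + k + 1) + sg (i + k) * HH 3 i / of_nat (i + k + 1))))
       = P * (3 * ((\<Sum>i<p. \<Sum>k\<in>off i. HH 1 i * (HH 2 i - HH 2 k) / of_nat (i + k + 1))
          + (\<Sum>i<p. \<Sum>k\<in>off i. sg (i + k) * HH 3 i / of_nat (i + k + 1))))"
      by (rule dist)
    also have "cg 2 \<dots> (P * (3 * (2 * ?S22 + 2 * (\<Sum>i<p. HH 3 i * HH 1 i))))"
      by (intro cg_P cg_mult_left cg_add offdiag_sum_1 offdiag_sum_2) auto
    finally show ?thesis .
  qed
  have "(\<Sum>i<p. HH 3 i * HH 1 i) = ?S13" by (simp add: mult.commute)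
  from cg_add[OF 1 2[unfolded this]] have "cg 2 (\<Sum>i\<le>p-1. \<Sum>k\<le>p-1. Cterm (p - 1) i k)
     (3 * ?S3 - P * (18 * ?S13 + 12 * ?S22) + P * (3 * (2 * ?S22 + 2 * ?S13)))"
    unfolding sum_split_diag .
  \<comment> \<open>-18 + 6 = -12 and -12 + 6 = -6, the proportion that \<open>sum_products\<close>
    annihilates.\<close>
  also have "3 * ?S3 - P * (18 * ?S13 + 12 * ?S22) + P * (3 * (2 * ?S22 + 2 * ?S13)) = 3 * ?S3 - P * (6 * (?S22 + 2 * ?S13))"
    by (simp add: algebra_simps)
  also have "cg 2 \<dots> (3 * (- HH 2 (p - 1)) - P * (6 * 0))"
    by (intro cg_diff cg_mult_left sum_HH3 cg_P sum_products) auto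
  also have "3 * (- HH 2 (p - 1)) - P * (6 * 0) = - (3 * HH 2 (p - 1))" by simp
  also have "cg 2 \<dots> (- (2 * (P * W1)))" by (intro cg_uminus HH2_full)
  also have "cg 2 \<dots> (- (2 * (P * Bp)))" by (intro cg_uminus cg_mult_left cg_P sum_HH1_bernoulli) auto
  finally show ?thesis .
qed

text \<open>Replacing n by p - n flips both (-1)^(n - 1) and the sign of the cube, so the full
  alternating sum is twice the half sum. Removing the even terms of H_3(p - 1) twice shows that it
  is also H_3(p - 1) - H_3((p - 1)/2) / 4, congruent to B_(p-3) / 2.\<close>

lemma altharmonic_half: "cg 1 (\<Sum>n=1..(p-1) div 2. (-1) ^ (n - 1) / of_nat n ^ 3) (1 / 4 * Bp)"
proof -
  define m where "m = (p - 1) div 2"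
  have m: "p = 2 * m + 1" using odd_p p_ge_5 unfolding m_def by presburger
  have m5: "m \<ge> 2" using p_ge_5 m by simp
  define S where "S = (\<Sum>n=1..m. (-1) ^ (n - 1) / of_nat n ^ 3 :: rat)"
  define T where "T = (\<Sum>n=1..p-1. (-1) ^ (n - 1) / of_nat n ^ 3 :: rat)"
  have "T = S + (\<Sum>n=1..m. (-1) ^ (p - n - 1) / of_nat (p - n) ^ 3)"
  proof -
    have "{1..p-1} = {1..m} \<union> {m+1..p-1}" using m by auto
    then have "T = S + (\<Sum>n=m+1..p-1. (-1) ^ (n - 1) / of_nat n ^ 3)"
      unfolding T_def S_def by (simp add: sum.union_disjoint)
    also have "(\<Sum>n=m+1..p-1. (-1) ^ (n - 1) / of_nat n ^ 3) = (\<Sum>n=1..m. (-1) ^ (p - n - 1) / of_nat (p - n) ^ 3 :: rat)"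
      using m by (intro sum.reindex_bij_witness[of _ "\<lambda>n. p - n" "\<lambda>n. p - n"]) auto
    finally show ?thesis .
  qed
  also have "cg 1 \<dots> (S + S)"
    unfolding S_def
  proof (intro cg_add cg_sum cg_refl)
    fix n assume n: "n \<in> {1..m}"
    have "even (p - n - 1) \<longleftrightarrow> \<not> even (n - 1)" using n m by presburger
    then have e: "(-1) ^ (p - n - 1) = - ((-1) ^ (n - 1) :: rat)" by (cases "even (n - 1)") simp_all
    have "cg 1 ((-1) ^ (p - n - 1) * (1 / (P - of_nat n) ^ 3)) ((-1) ^ (p - n - 1) * ((-1) ^ 3 / of_nat n ^ 3))"
      using n m by (intro cg_mult_left inverse_shift R_power R_uminus R_numbers) auto
    then show "cg 1 ((-1) ^ (p - n - 1) / of_nat (p - n) ^ 3) ((-1) ^ (n - 1) / of_nat n ^ 3)"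
      using n m unfolding e by (simp add: of_nat_diff)
  qed
  finally have 1: "cg 1 T (S + S)" .
  have "T = HH 3 (p - 1) - 1 / 4 * HH 3 m"
  proof -
    have "HH 3 (p - 1) - T = (\<Sum>n=1..2*m. (if even n then 2 / of_nat n ^ 3 else 0))"
      unfolding HH_def T_def sum_subtractf[symmetric] using m by (intro sum.cong) auto
    also have "\<dots> = (\<Sum>n=1..m. 1 / 4 * (1 / of_nat n ^ 3))"
      by (induction m) (simp_all add: power_mult_distrib field_simps del: of_nat_Suc, simp add: algebra_simps power3_eq_cube)
    also have "\<dots> = 1 / 4 * HH 3 m" by (simp only: HH_def sum_distrib_left)
    finally show ?thesis by simp
  qed
  also have "cg 1 \<dots> (0 - 1 / of_nat 4 * (- 2 * Bp))"
    using cg_mult_left[OF R_inverse_less[of 4] HH3_half] p_ge_5 by (intro cg_diff HH_full) (auto simp: m_def)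
  finally have "cg 1 (S + S) (1 / 2 * Bp)" using cg_trans[OF cg_sym[OF 1]] by simp
  then have "cg 1 (of_nat 2 * S) (of_nat 2 * (1 / 4 * Bp))" by simp
  from cg_cancel_nat[OF this not_dvd_2(1)] show ?thesis unfolding S_def m_def .
qed

end

section \<open>Congruences in the cyclotomic field\<close>

definition ev :: "int poly \<Rightarrow> complex \<Rightarrow> complex" where
  "ev f z = poly (map_poly of_int f) z"

lemma ev_0 [simp]: "ev 0 z = 0" by (simp add: ev_def)

lemma ev_pCons [simp]: "ev (pCons a f) z = of_int a + z * ev f z"
  by (simp add: ev_def map_poly_pCons)

lemma ev_add [simp]: "ev (f + g) z = ev f z + ev g z"
  by (induction f g rule: poly_induct2) (simp_all add: algebra_simps)

lemma ev_smult [simp]: "ev (Polynomial.smult c f) z = of_int c * ev f z"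
  by (induction f) (simp_all add: algebra_simps)

lemma ev_uminus [simp]: "ev (- f) z = - ev f z"
  using ev_smult[of "- 1" f z] by simp

lemma ev_diff [simp]: "ev (f - g) z = ev f z - ev g z"
  using ev_add[of f "- g" z] by simp

lemma ev_mult [simp]: "ev (f * g) z = ev f z * ev g z"
  by (induction f) (simp_all add: algebra_simps)

lemma ev_1 [simp]: "ev 1 z = 1" by (simp add: one_pCons)

lemma ev_power [simp]: "ev (f ^ n) z = ev f z ^ n"
  by (induction n) simp_all

lemma ev_sum [simp]: "ev (sum f A) z = (\<Sum>a\<in>A. ev (f a) z)"
  by (induction A rule: infinite_finite_induct) simp_all

lemma ev_prod [simp]: "ev (prod f A) z = (\<Prod>a\<in>A. ev (f a) z)"
  by (induction A rule: infinite_finite_induct) simp_all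

lemma ev_monom [simp]: "ev (Polynomial.monom c n) z = of_int c * z ^ n"
  by (simp add: ev_def map_poly_monom poly_monom)

lemma ev_pcompose [simp]: "ev (f \<circ>\<^sub>p g) z = ev f (ev g z)"
  by (induction f) (simp_all add: pcompose_pCons)

lemma ev_of_int: "ev f (of_int a) = of_int (poly f a)"
  by (induction f) simp_all

lemma ev_at_1: "ev f 1 = of_int (poly f 1)"
  using ev_of_int[of f 1] by simp

lemma unity_root_power_eq_1: "N \<ge> 1 \<Longrightarrow> unity_root N ^ k = 1 \<longleftrightarrow> N dvd k"
proof -
  assume N: "N \<ge> 1"
  have "unity_root N ^ k = exp (2 * of_real pi * \<i> * of_nat k / of_nat N)"
    unfolding unity_root_def by (simp add: exp_of_nat_mult[symmetric] field_simps)
  then show ?thesis using complex_root_unity_eq_1[OF N, of k] by simp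
qed

lemma sum_powers_of_root_of_unity:
  assumes "q ^ N = (1 :: complex)"
  shows "(\<Sum>j<N. (q ^ j) ^ m) = (if q ^ m = 1 then of_nat N else 0)"
proof -
  have "(\<Sum>j<N. (q ^ j) ^ m) = (\<Sum>j<N. (q ^ m) ^ j)" by (simp flip: power_mult add: mult.commute)
  also have "\<dots> = (if q ^ m = 1 then of_nat N else 0)"
  proof -
    have "(q ^ m) ^ N = 1" using assms by (metis power_mult mult.commute power_one)
    then show ?thesis by (simp add: sum_gp_strict)
  qed
  finally show ?thesis .
qed

lemma power_commuting_exp: "((q :: complex) ^ j) ^ m = (q ^ m) ^ j"
  by (metis power_mult mult.commute)

section \<open>Reduction modulo 1 - q\<close>

context padic begin

abbreviation q :: complex where "q \<equiv> unity_root p"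

lemma q_power_eq_1: "q ^ k = 1 \<longleftrightarrow> p dvd k"
  using unity_root_power_eq_1[of p k] p_ge_5 by simp

lemma q_neq_1: "q \<noteq> 1"
  using q_power_eq_1[of 1] p_ge_5 by simp

text \<open>Averaging over all \<open>p\<close>-th roots of unity keeps exactly the coefficients whose index is divisible by \<open>p\<close>.\<close>

lemma sum_ev_roots: "\<exists>c. (\<Sum>j<p. ev f (q ^ j)) = of_int (int p * c)"
proof
  have f: "f = (\<Sum>m\<le>degree f. Polynomial.monom (Polynomial.coeff f m) m)" by (rule poly_as_sum_of_monoms[symmetric])
  have "(\<Sum>j<p. ev f (q ^ j)) = (\<Sum>j<p. \<Sum>m\<le>degree f. of_int (Polynomial.coeff f m) * (q ^ j) ^ m)"
    by (subst f) simp
  also have "\<dots> = (\<Sum>m\<le>degree f. of_int (Polynomial.coeff f m) * (\<Sum>j<p. (q ^ j) ^ m))"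
    by (subst sum.swap) (simp add: sum_distrib_left)
  also have "\<dots> = (\<Sum>m\<le>degree f. of_int (Polynomial.coeff f m) * (if p dvd m then of_nat p else 0))"
    by (subst sum_powers_of_root_of_unity) (simp_all add: q_power_eq_1)
  also have "\<dots> = of_int (int p * (\<Sum>m\<le>degree f. if p dvd m then Polynomial.coeff f m else 0))"
    unfolding sum_distrib_left of_int_sum by (intro sum.cong) auto
  finally show "(\<Sum>j<p. ev f (q ^ j)) = of_int (int p * (\<Sum>m\<le>degree f. if p dvd m then Polynomial.coeff f m else 0))" .
qed

text \<open>The product of the conjugates of \<open>f\<close> vanishes at every primitive root of unity, so its average over
  the roots of unity is \<open>f(1)\<^sup>p\<^sup>-\<^sup>1 / p\<close>.\<close>

lemma dvd_at_1:
  assumes "ev f q = 0"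
  shows "int p dvd poly f 1"
proof -
  define F where "F = (\<Prod>i=1..p-1. f \<circ>\<^sub>p Polynomial.monom 1 i)"
  have F: "ev F z = (\<Prod>i=1..p-1. ev f (z ^ i))" for z by (simp add: F_def)
  have vanish: "ev F (q ^ j) = 0" if j: "j \<in> {1..p-1}" for j
  proof -
    have "0 < j" "j < p" using j by auto
    then have "coprime j p" by (intro prime_imp_coprime[OF prime_p not_dvd_less, THEN coprime_commute[THEN iffD1]])
    \<comment> \<open>Raising q^j to the inverse of j modulo p gives back q, so one factor of
      \<open>ev F (q ^ j)\<close> is \<open>ev f q\<close>.\<close>
    then have "\<exists>i. [j * i = Suc 0] (mod p)" by (rule cong_solve_coprime_nat)
    then obtain i where i: "[j * i = 1] (mod p)" by auto
    have "(q ^ j) ^ (i mod p) = q"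
    proof -
      have mod: "q ^ (n mod p) = q ^ n" for n
      proof -
        have "q ^ n = q ^ (p * (n div p) + n mod p)" by simp
        then have "q ^ n = q ^ (p * (n div p)) * q ^ (n mod p)" by (simp only: power_add)
        then show ?thesis using q_power_eq_1[of "p * (n div p)"] by simp
      qed
      have "(q ^ j) ^ (i mod p) = (q ^ (i mod p)) ^ j" by (rule power_commuting_exp)
      also have "\<dots> = q ^ (j * i)" unfolding mod power_mult by (rule power_commuting_exp)
      also have "\<dots> = q ^ (j * i mod p)" by (rule mod[symmetric])
      also have "\<dots> = q" using i p_ge_5 by (simp add: cong_def)
      finally show ?thesis .
    qed
    moreover have "i mod p \<in> {1..p-1}"
    proof -
      have "i mod p \<noteq> 0"
      proof
        assume "i mod p = 0"
        then have "p dvd j * i" by (simp add: mod_eq_0_iff_dvd)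
        then show False using i p_ge_5 by (simp add: cong_def mod_eq_0_iff_dvd[symmetric])
      qed
      then show ?thesis using p_ge_5 mod_less_divisor[of p i] by (simp del: mod_less_divisor)
    qed
    ultimately have "\<exists>a\<in>{1..p-1}. ev f ((q ^ j) ^ a) = 0" using assms by metis
    then show ?thesis unfolding F by (intro prod_zero) auto
  qed
  obtain c where c: "(\<Sum>j<p. ev F (q ^ j)) = of_int (int p * c)" using sum_ev_roots by blast
  have "{..<p} = insert 0 {1..p-1}" using p_ge_5 by auto
  then have "(\<Sum>j<p. ev F (q ^ j)) = ev F (q ^ 0)" using vanish by simp
  also have "\<dots> = of_int (poly f 1 ^ (p - 1))" unfolding F by (simp add: ev_at_1)
  finally have "(of_int (poly f 1 ^ (p - 1)) :: complex) = of_int (int p * c)" using c by simp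
  then have "poly f 1 ^ (p - 1) = int p * c" by (simp only: of_int_eq_iff)
  then have "int p dvd poly f 1 ^ (p - 1)" by simp
  then show ?thesis using prime_int_p prime_dvd_power by blast
qed

lemma divisible_at_1:
  assumes "poly f 1 = 0"
  obtains g where "\<And>z. ev f z = (1 - z) * ev g z"
proof -
  obtain h where "f = [:- 1, 1:] * h" using assms poly_eq_0_iff_dvd[of f 1] by (auto elim: dvdE)
  then have "ev f z = ev [:-1, 1:] z * ev h z" for z by (simp only: ev_mult)
  then have "ev f z = (1 - z) * ev (- h) z" for z by (simp add: algebra_simps)
  then show thesis using that by blast
qed

text \<open>The polynomial p - (1 + x + ... + x^(p-1)) vanishes at 1 and takes the value p at
  q.\<close>

lemma p_divisible: "\<exists>w. of_nat p = (1 - q) * ev w q"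
proof -
  define f where "f = [:int p:] - (\<Sum>j<p. Polynomial.monom 1 j)"
  have "poly f 1 = 0" by (simp add: f_def poly_sum poly_monom)
  then obtain g where "ev f q = (1 - q) * ev g q" using divisible_at_1 by metis
  moreover have "ev f q = of_nat p"
    using sum_powers_of_root_of_unity[of q p 1] q_power_eq_1[of p] q_neq_1 by (simp add: f_def)
  ultimately show ?thesis by metis
qed

text \<open>Modulo 1 - q a polynomial in q equals its value at 1, and p lies in the ideal.
  Conversely \<open>dvd_at_1\<close> applies to f - (1 - x) g, which has the same value at 1 as
  f.\<close>

lemma ev_prime_ideal_iff: "(\<exists>g. ev f q = (1 - q) * ev g q) \<longleftrightarrow> int p dvd poly f 1"
proof
  assume "\<exists>g. ev f q = (1 - q) * ev g q"
  then obtain g where "ev f q = (1 - q) * ev g q" ..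
  then have "ev (f - [:1, -1:] * g) q = 0" by (simp add: algebra_simps)
  from dvd_at_1[OF this] show "int p dvd poly f 1" by simp
next
  assume "int p dvd poly f 1"
  then obtain k where k: "poly f 1 = int p * k" by (elim dvdE)
  obtain g where g: "ev (f - [:poly f 1:]) q = (1 - q) * ev g q" using divisible_at_1[of "f - [:poly f 1:]"] by auto
  obtain w where w: "of_nat p = (1 - q) * ev w q" using p_divisible by blast
  have "of_int (poly f 1) = (1 - q) * (of_int k * ev w q)" using w unfolding k by simp
  moreover have "ev f q = (1 - q) * ev g q + of_int (poly f 1)" using g by (simp add: algebra_simps)
  ultimately have "ev f q = (1 - q) * ev (g + Polynomial.smult k w) q" by (simp add: distrib_left)
  then show "\<exists>g. ev f q = (1 - q) * ev g q" by blast
qed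

abbreviation Q :: "complex set" where "Q \<equiv> cycloc p"

lemma Q_iff: "x \<in> Q \<longleftrightarrow> (\<exists>f g. x = ev f q / ev g q \<and> \<not> int p dvd poly g 1)"
proof -
  have "(ev g q \<in> {(1 - q) * s |s. s \<in> range (\<lambda>f. ev f q)}) = (int p dvd poly g 1)" for g
    using ev_prime_ideal_iff[of g] by blast
  then show ?thesis unfolding cycloc_def localization_def Zadjoin_def ev_def[symmetric] by blast
qed

lemma denominator_nonzero: "\<not> int p dvd poly g 1 \<Longrightarrow> ev g q \<noteq> 0"
  using dvd_at_1 by blast

lemma Q_ev_divide: "\<not> int p dvd poly g 1 \<Longrightarrow> ev f q / ev g q \<in> Q"
  unfolding Q_iff by blast

lemma Q_ev: "ev f q \<in> Q"
  using Q_ev_divide[of 1 f] prime_gt_1_nat[OF prime_p] by simp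

lemma Q_add: "x \<in> Q \<Longrightarrow> y \<in> Q \<Longrightarrow> x + y \<in> Q"
proof -
  assume "x \<in> Q" "y \<in> Q"
  then obtain f g f' g' where *: "x = ev f q / ev g q" "\<not> int p dvd poly g 1" "y = ev f' q / ev g' q" "\<not> int p dvd poly g' 1"
    unfolding Q_iff by blast
  have "x + y = ev (f * g' + f' * g) q / ev (g * g') q"
    using denominator_nonzero[OF *(2)] denominator_nonzero[OF *(4)] unfolding * by (simp add: field_simps)
  moreover have "\<not> int p dvd poly (g * g') 1" using * prime_int_p by (simp add: prime_dvd_mult_iff)
  ultimately show ?thesis unfolding Q_iff by blast
qed

lemma Q_mult: "x \<in> Q \<Longrightarrow> y \<in> Q \<Longrightarrow> x * y \<in> Q"
proof -
  assume "x \<in> Q" "y \<in> Q"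
  then obtain f g f' g' where *: "x = ev f q / ev g q" "\<not> int p dvd poly g 1" "y = ev f' q / ev g' q" "\<not> int p dvd poly g' 1"
    unfolding Q_iff by blast
  have "x * y = ev (f * f') q / ev (g * g') q" unfolding * by simp
  moreover have "\<not> int p dvd poly (g * g') 1" using * prime_int_p by (simp add: prime_dvd_mult_iff)
  ultimately show ?thesis unfolding Q_iff by blast
qed

lemma Q_of_rat: "x \<in> R \<Longrightarrow> of_rat x \<in> Q"
proof -
  assume "x \<in> R"
  then obtain a b :: int where "x = of_int a / of_int b" "\<not> int p dvd b" unfolding R_iff by blast
  then have "of_rat x = ev [:a:] q / ev [:b:] q" "\<not> int p dvd poly [:b:] 1" by (simp_all add: of_rat_divide)
  then show ?thesis using Q_ev_divide by metis
qed

abbreviation cc :: "complex \<Rightarrow> complex \<Rightarrow> bool" where "cc \<equiv> cong_in Q (1 - q)"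

lemma ccI: "y \<in> Q \<Longrightarrow> c \<in> Q \<Longrightarrow> x - y = (1 - q) * c \<Longrightarrow> cc x y"
proof -
  assume *: "y \<in> Q" "c \<in> Q" "x - y = (1 - q) * c"
  have "1 - q = ev [:1, -1:] q" by simp
  then have "1 - q \<in> Q" using Q_ev by metis
  then have "y + (x - y) \<in> Q" using * by (simp only: Q_add Q_mult)
  then have "x \<in> Q" by simp
  with * show "cc x y" unfolding cong_in_def by auto
qed

lemma cc_trans: "cc x y \<Longrightarrow> cc y z \<Longrightarrow> cc x z"
proof -
  assume "cc x y" "cc y z"
  then obtain c d where "c \<in> Q" "d \<in> Q" "x - y = (1 - q) * c" "y - z = (1 - q) * d" "z \<in> Q" unfolding cong_in_def by blast
  moreover have "x - z = (x - y) + (y - z)" by simp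
  ultimately show ?thesis by (intro ccI[of _ "c + d"] Q_add) (simp_all only: distrib_left)
qed

lemma cc_add: "cc x y \<Longrightarrow> cc z w \<Longrightarrow> cc (x + z) (y + w)"
proof -
  assume "cc x y" "cc z w"
  then obtain c d where "c \<in> Q" "d \<in> Q" "x - y = (1 - q) * c" "z - w = (1 - q) * d" "y \<in> Q" "w \<in> Q" unfolding cong_in_def by blast
  moreover have "x + z - (y + w) = (x - y) + (z - w)" by simp
  ultimately show ?thesis by (intro ccI[of _ "c + d"] Q_add) (simp_all only: distrib_left)
qed

lemma cc_sum: "(\<And>a. a \<in> A \<Longrightarrow> cc (f a) (g a)) \<Longrightarrow> cc (sum f A) (sum g A)"
proof (induction A rule: infinite_finite_induct)
  case (infinite A)
  then show ?case using Q_ev[of 0] by (intro ccI[of _ 0]) auto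
next
  case empty
  then show ?case using Q_ev[of 0] by (intro ccI[of _ 0]) auto
qed (auto intro: cc_add)

lemma cc_of_rat: "cg 1 x y \<Longrightarrow> y \<in> R \<Longrightarrow> cc (of_rat x) (of_rat y)"
proof -
  assume "cg 1 x y" and y: "y \<in> R"
  then obtain c where c: "c \<in> R" "x = y + P * c" unfolding cg_def by (auto simp: algebra_simps)
  obtain w where w: "of_nat p = (1 - q) * ev w q" using p_divisible by blast
  show ?thesis
    using c w by (intro ccI[of _ "ev w q * of_rat c"] Q_of_rat y Q_mult Q_ev) (simp_all add: of_rat_add of_rat_mult)
qed

text \<open>The polynomial g(1) f - f(1) g has the root 1 and is therefore divisible by 1 -
  x.\<close>

lemma cc_ev_divide:
  assumes "\<not> int p dvd poly g 1"
  shows "cc (ev f q / ev g q) (of_rat (of_int (poly f 1) / of_int (poly g 1)))"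
proof -
  define h where "h = Polynomial.smult (poly g 1) f - Polynomial.smult (poly f 1) g"
  have "poly h 1 = 0" by (simp add: h_def)
  then obtain k where k: "ev h q = (1 - q) * ev k q" using divisible_at_1 by metis
  have nz: "ev g q \<noteq> 0" "poly g 1 \<noteq> 0" using denominator_nonzero[OF assms] assms by auto
  have "ev f q / ev g q - of_rat (of_int (poly f 1) / of_int (poly g 1)) = ev h q / ev (Polynomial.smult (poly g 1) g) q"
    using nz by (simp add: h_def of_rat_divide field_simps)
  also have "ev h q / ev (Polynomial.smult (poly g 1) g) q = (1 - q) * (ev k q / ev (Polynomial.smult (poly g 1) g) q)" unfolding k by simp
  finally show ?thesis
  proof (rule ccI[rotated 2])
    show "ev k q / ev (Polynomial.smult (poly g 1) g) q \<in> Q"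
      using assms prime_int_p by (intro Q_ev_divide) (simp add: prime_dvd_mult_iff)
    show "of_rat (of_int (poly f 1) / of_int (poly g 1)) \<in> Q"
      using assms by (intro Q_of_rat) (auto simp: R_iff)
  qed
qed

text \<open>At x = 1 the q-integers become n, which is prime to p as n < p.\<close>

lemma EN_cong_harmonic: "cc (EN p) (of_rat (\<Sum>n=1..(p-1) div 2. (-1) ^ (n - 1) / of_nat n ^ 3))"
  unfolding EN_def Eq_def of_rat_sum
proof (intro cc_sum)
  fix n assume n: "n \<in> {1..(p-1) div 2}"
  define g where "g = (\<Sum>k<n. Polynomial.monom (1 :: int) k) ^ 3"
  define f where "f = Polynomial.smult ((-1) ^ (n - 1)) (Polynomial.monom (1 :: int) (2 * n))"
  have g: "poly g 1 = int n ^ 3" by (simp add: g_def poly_sum poly_monom)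
  have f: "poly f 1 = (-1) ^ (n - 1)" by (simp add: f_def poly_monom)
  have "0 < n" "n < p" using n by auto
  then have "\<not> int p dvd int n" using not_dvd_less by simp
  then have "\<not> int p dvd poly g 1" unfolding g using prime_int_p prime_dvd_power by blast
  from cc_ev_divide[OF this, of f] show "cc ((-1) ^ (n - 1) * q ^ (2 * n) / qint n q ^ 3) (of_rat ((-1) ^ (n - 1) / of_nat n ^ 3))"
    unfolding g f by (simp add: f_def g_def qint_def)
qed

section \<open>Integer representatives of the residues\<close>

lemma R_int_residue:
  assumes "x \<in> R"
  obtains k where "k \<in> {0..<int p}" "cg 1 x (of_int k)"
proof -
  obtain a b :: int where x: "x = of_int a / of_int b" "\<not> int p dvd b" using assms unfolding R_iff by blast
  have "coprime b (int p)" by (rule prime_imp_coprime[OF prime_int_p x(2), THEN coprime_commute[THEN iffD1]])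
  then have "\<exists>c. [b * c = 1] (mod int p)" by (rule cong_solve_coprime_int)
  then obtain c where c: "[b * c = 1] (mod int p)" ..
  define k where "k = (a * c) mod int p"
  have "[a = b * k] (mod int p)"
  proof -
    have "[b * k = b * (a * c)] (mod int p)" unfolding k_def by (simp add: cong_def mod_mult_right_eq)
    also have "b * (a * c) = a * (b * c)" by simp
    also have "[a * (b * c) = a * 1] (mod int p)" using c by (intro cong_mult cong_refl)
    finally show ?thesis by (simp add: cong_sym)
  qed
  then obtain m where m: "a - b * k = int p * m" by (auto simp: cong_iff_dvd_diff elim: dvdE)
  then have "(of_int (a - b * k) :: rat) = of_int (int p * m)" by simp
  then have "of_int a - of_int b * of_int k = P * of_int m" by simp
  moreover have "b \<noteq> 0" using x by auto
  ultimately have "x - of_int k = P ^ 1 * (of_int m / of_int b)" unfolding x by (simp add: field_simps)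
  moreover have "of_int m / of_int b \<in> R" using x unfolding R_iff by blast
  ultimately have "cg 1 x (of_int k)" by (rule cgI[rotated])
  moreover have "k \<in> {0..<int p}" unfolding k_def using p_ge_5 by simp
  ultimately show thesis by (rule that[rotated])
qed

lemma cg_iff_cong_in: "cg 1 x y \<and> y \<in> R \<longleftrightarrow> cong_in R P x y"
  unfolding cong_in_def using cg_R[of 1 x y] by (auto simp: cg_def)

lemma cg_of_int: "cg 1 (of_int a) (of_int b) \<Longrightarrow> [a = b] (mod int p)"
proof -
  assume "cg 1 (of_int a) (of_int b)"
  then obtain c where "c \<in> R" "of_int a - of_int b = P * c" unfolding cg_def by auto
  then obtain m n :: int where *: "of_int a - of_int b = P * (of_int m / of_int n)" "\<not> int p dvd n" unfolding R_iff by blast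
  then have "n \<noteq> 0" by auto
  with * have "of_int ((a - b) * n) = (of_int (int p * m) :: rat)" by (simp add: field_simps)
  then have "(a - b) * n = int p * m" by (simp only: of_int_eq_iff)
  then have "int p dvd (a - b) * n" by simp
  then show ?thesis using * prime_int_p by (simp add: prime_dvd_mult_iff cong_iff_dvd_diff)
qed

lemma cc_of_int: "cc (of_int a) (of_int b) \<Longrightarrow> [a = b] (mod int p)"
proof -
  assume "cc (of_int a) (of_int b)"
  then obtain c where "c \<in> Q" "of_int a - of_int b = (1 - q) * c" unfolding cong_in_def by blast
  then obtain f g where *: "of_int a - of_int b = (1 - q) * (ev f q / ev g q)" "\<not> int p dvd poly g 1" unfolding Q_iff by blast
  then have "ev (Polynomial.smult (a - b) g) q = (1 - q) * ev f q"
    using denominator_nonzero[of g] unfolding ev_smult of_int_diff * by simp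
  then have "int p dvd poly (Polynomial.smult (a - b) g) 1" using ev_prime_ideal_iff by blast
  then show ?thesis using * prime_int_p by (simp add: prime_dvd_mult_iff cong_iff_dvd_diff)
qed

lemma residue_unique: "[a = b] (mod int p) \<Longrightarrow> a \<in> {0..<int p} \<Longrightarrow> b \<in> {0..<int p} \<Longrightarrow> a = b"
  by (simp add: cong_def)

lemma res_rat_eqI: "k \<in> {0..<int p} \<Longrightarrow> cg 1 x (of_int k) \<Longrightarrow> res_rat p x = k"
  unfolding res_rat_def cg_iff_cong_in[symmetric]
  by (rule the_equality) (use R_of_int in blast, metis residue_unique cg_of_int cg_trans cg_sym)

lemma res_rat_cg: "x \<in> R \<Longrightarrow> cg 1 (of_int (res_rat p x)) x"
  by (metis R_int_residue res_rat_eqI cg_sym)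

text \<open>An integer congruent to y modulo p is congruent to x modulo 1 - q, and integers
  congruent modulo 1 - q agree modulo p.\<close>

lemma res_cyc_of_rat:
  assumes "cc x (of_rat y)" "y \<in> R"
  shows "res_cyc p x = res_rat p y"
proof -
  obtain k where k: "k \<in> {0..<int p}" "cg 1 y (of_int k)" using R_int_residue[OF assms(2)] by blast
  have 1: "cc x (of_int k)" using cc_trans[OF assms(1) cc_of_rat[OF k(2)]] by auto
  have "res_cyc p x = k"
    unfolding res_cyc_def
  proof (rule the_equality)
    show "k \<in> {0..<int p} \<and> cc x (of_int k)" using k 1 by blast
    fix l assume l: "l \<in> {0..<int p} \<and> cc x (of_int l)"
    then have lQ: "of_int l \<in> Q" and kQ: "of_int k \<in> Q" and "cc x (of_int l)" using 1 unfolding cong_in_def by auto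
    have "cc (of_int k) (of_int l)"
    proof -
      obtain c d where "c \<in> Q" "d \<in> Q" "x - of_int k = (1 - q) * c" "x - of_int l = (1 - q) * d"
        using 1 l unfolding cong_in_def by blast
      moreover have "- 1 \<in> Q" using Q_ev[of "- 1"] by simp
      moreover have "of_int k - of_int l = (x - of_int l) + (- 1) * (x - of_int k)" by simp
      ultimately show ?thesis using lQ
        by (intro ccI[of _ "d + (- 1) * c"] Q_add Q_mult) (simp_all only: distrib_left mult.left_commute)
    qed
    then show "l = k" using cc_of_int residue_unique k(1) l by blast
  qed
  with res_rat_eqI[OF k] show ?thesis by simp
qed

lemma res_rat_mult:
  assumes "x \<in> R" "y \<in> R" "cg 1 (x * y) z"
  shows "res_rat p x * res_rat p y mod int p = res_rat p z mod int p"
proof -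
  have z: "z \<in> R" by (rule cg_R[OF cg_sym[OF assms(3)] R_mult[OF assms(1,2)]])
  have "cg 1 (of_int (res_rat p x) * of_int (res_rat p y)) (x * y)"
    by (rule cg_mult[OF res_rat_cg[OF assms(1)] res_rat_cg[OF assms(2)] R_of_int assms(2)])
  also have "cg 1 \<dots> z" by fact
  also have "cg 1 \<dots> (of_int (res_rat p z))" by (rule cg_sym[OF res_rat_cg[OF z]])
  finally have "cg 1 (of_int (res_rat p x * res_rat p y)) (of_int (res_rat p z))" by simp
  from cg_of_int[OF this] show ?thesis by (simp add: cong_def)
qed

end

section \<open>The complex limit\<close>

text \<open>Put y = x/2 in sin(2y) = 2 sin(y) cos(y). As y is at most pi/3, cos(y) is at least 1/2
  and, by integration, sin(y) is at least y/2.\<close>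

lemma sin_ge_quarter:
  fixes x :: real
  assumes "0 \<le> x" "x \<le> pi / 2"
  shows "x / 4 \<le> sin x"
proof -
  define y where "y = x / 2"
  have y: "0 \<le> y" "y \<le> pi / 3" using assms pi_gt_zero by (auto simp: y_def)
  have cos: "1 / 2 \<le> cos t" if "0 \<le> t" "t \<le> pi / 3" for t :: real
    using cos_monotone_0_pi_le[of t "pi / 3"] that pi_gt_zero by (simp add: cos_60)
  have "sin 0 - 0 / 2 \<le> sin y - y / 2"
  proof (rule DERIV_nonneg_imp_nondecreasing[OF y(1)])
    fix t assume "0 \<le> t" "t \<le> y"
    then show "\<exists>d. ((\<lambda>t. sin t - t / 2) has_real_derivative d) (at t) \<and> d \<ge> 0"
      using cos[of t] y by (intro exI[of _ "cos t - 1 / 2"]) (auto intro!: derivative_eq_intros)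
  qed
  then have "y / 2 * (1 / 2) \<le> sin y * cos y" using y cos[of y] by (intro mult_mono) auto
  moreover have "sin x = 2 * (sin y * cos y)" using sin_double[of y] by (simp add: y_def)
  ultimately show ?thesis by (simp add: y_def)
qed

text \<open>|1 - q^n| is 2 sin(pi n / N) with an angle of at most pi/2, while |1 - q| is at most 2
  pi / N.\<close>

lemma norm_qint_unity_root:
  assumes "1 \<le> n" "2 * n \<le> N" "2 \<le> N"
  shows "real n / 4 \<le> norm (qint n (unity_root N))"
proof -
  have N: "real N > 0" using assms by simp
  have pw: "unity_root N ^ m = exp (\<i> * of_real (2 * pi * real m / real N))" for m
    unfolding unity_root_def by (simp add: exp_of_nat_mult[symmetric] field_simps)
  have nm: "norm (1 - unity_root N ^ m) = 2 * \<bar>sin (pi * real m / real N)\<bar>" for m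
    using dist_exp_i_1[of "2 * pi * real m / real N"] unfolding pw by (simp add: norm_minus_commute field_simps)
  have "pi * real n / real N \<le> pi / 2" using assms N by (simp add: field_simps)
  then have s: "pi * real n / real N / 4 \<le> sin (pi * real n / real N)" using N by (intro sin_ge_quarter) auto
  then have num: "2 * (pi * real n / real N / 4) \<le> norm (1 - unity_root N ^ n)" unfolding nm by linarith
  have den: "norm (1 - unity_root N) \<le> 2 * (pi / real N)"
    using nm[of 1] abs_sin_x_le_abs_x[of "pi / real N"] N by simp
  have "sin (pi / real N) > 0" using assms N pi_gt_zero by (intro sin_gt_zero) (auto simp: field_simps)
  then have pos: "norm (1 - unity_root N) > 0" using nm[of 1] by simp
  then have "unity_root N \<noteq> 1" by auto
  then have q: "norm (qint n (unity_root N)) = norm (1 - unity_root N ^ n) / norm (1 - unity_root N)"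
    by (simp add: qint_closed_form norm_divide)
  have "real n / 4 * norm (1 - unity_root N) \<le> real n / 4 * (2 * (pi / real N))"
    using den by (intro mult_left_mono) auto
  also have "\<dots> = 2 * (pi * real n / real N / 4)" by simp
  also note num
  finally show ?thesis unfolding q using pos by (simp add: pos_le_divide_eq)
qed

text \<open>The terms with even denominators add up to zeta(3) / 8 and are subtracted twice; they
  sit at odd indices because of the shift by one.\<close>

lemma alternating_zeta_3: "(\<lambda>n. (-1) ^ n / real (Suc n) ^ 3) sums (3 / 4 * zeta 3)"
proof -
  let ?a = "\<lambda>n. 1 / real (Suc n) ^ 3"
  have "summable (\<lambda>n. 1 / real n ^ 3)" using inverse_power_summable[of 3, where ?'a = real] by (simp add: inverse_eq_divide)
  then have "summable ?a" by (subst summable_Suc_iff[of "\<lambda>n. 1 / real n ^ 3"])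
  then have a: "?a sums zeta 3" unfolding zeta_def by (rule summable_sums)
  have "(\<lambda>n. 1 / 8 * ?a n) sums (1 / 8 * zeta 3)" by (intro sums_mult a)
  also have "(\<lambda>n. 1 / 8 * ?a n) = (\<lambda>n. if odd (2 * n + 1) then ?a (2 * n + 1) else 0)"
    by (auto simp: fun_eq_iff field_simps power3_eq_cube)
  finally have "(\<lambda>n. if odd n then ?a n else 0) sums (1 / 8 * zeta 3)"
  proof (subst (asm) sums_mono_reindex[of "\<lambda>n. 2 * n + 1" "\<lambda>n. if odd n then ?a n else 0"])
    fix n :: nat assume "n \<notin> range (\<lambda>n. 2 * n + 1)"
    then have "even n" by (metis oddE rangeI)
    then show "(if odd n then ?a n else 0) = 0" by simp
  qed (simp_all add: strict_mono_def)
  then have "(\<lambda>n. ?a n - 2 * (if odd n then ?a n else 0)) sums (zeta 3 - 2 * (1 / 8 * zeta 3))"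
    by (intro sums_diff a sums_mult)
  also have "(\<lambda>n. ?a n - 2 * (if odd n then ?a n else 0)) = (\<lambda>n. (-1) ^ n / real (Suc n) ^ 3)"
    by (auto simp: fun_eq_iff)
  finally show ?thesis by simp
qed

lemma unity_root_tendsto: "unity_root \<longlonglongrightarrow> 1"
proof -
  have "(\<lambda>N. of_real (2 * pi) * \<i> * (of_real (1 / real N))) \<longlonglongrightarrow> of_real (2 * pi) * \<i> * of_real 0"
    by (intro tendsto_intros lim_1_over_n)
  then have "(\<lambda>N. exp (of_real (2 * pi) * \<i> * (of_real (1 / real N)))) \<longlonglongrightarrow> exp (of_real (2 * pi) * \<i> * of_real 0)"
    by (intro tendsto_intros)
  then show ?thesis by (simp add: unity_root_def[abs_def])
qed

text \<open>The finite sum is padded with zeros to a series dominated by 64 / (k + 1)^3. The limit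
  is taken along all N; the odd ones follow by restriction.\<close>

lemma EN_tendsto: "(EN \<longlongrightarrow> of_real (3 / 4 * zeta 3)) at_top"
proof -
  define f where "f k N = (if Suc k \<le> (N - 1) div 2 then (-1) ^ k * unity_root N ^ (2 * Suc k) / qint (Suc k) (unity_root N) ^ 3 else 0)"
    for k N :: nat
  define b where "b k = (of_real ((-1) ^ k / real (Suc k) ^ 3) :: complex)" for k
  have lim: "(f k \<longlongrightarrow> b k) at_top" for k
  proof -
    have q: "(\<lambda>N. qint (Suc k) (unity_root N)) \<longlonglongrightarrow> qint (Suc k) 1"
      unfolding qint_def by (intro tendsto_intros unity_root_tendsto)
    have q1: "qint (Suc k) 1 = of_nat (Suc k)" by (simp add: qint_def)
    then have "qint (Suc k) 1 ^ 3 \<noteq> 0" by (simp del: of_nat_Suc)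
    then have "(\<lambda>N. (-1) ^ k * unity_root N ^ (2 * Suc k) / qint (Suc k) (unity_root N) ^ 3) \<longlonglongrightarrow> (-1) ^ k * 1 ^ (2 * Suc k) / qint (Suc k) 1 ^ 3"
      by (intro tendsto_intros unity_root_tendsto q)
    also have "(-1) ^ k * 1 ^ (2 * Suc k) / qint (Suc k) 1 ^ 3 = b k" unfolding q1 b_def by simp
    \<comment> \<open>From N = 2k + 3 on, the term with index k belongs to the truncated
      sum.\<close>
    finally show ?thesis
      by (rule Lim_transform_eventually)
         (auto simp: f_def intro!: eventually_mono[OF eventually_ge_at_top[of "2 * k + 3"]])
  qed
  have bound: "norm (f k N) \<le> 64 * (1 / real (Suc k) ^ 3)" for k N
  proof (cases "Suc k \<le> (N - 1) div 2")
    case True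
    then have "real (Suc k) / 4 \<le> norm (qint (Suc k) (unity_root N))" by (intro norm_qint_unity_root) auto
    then have "(real (Suc k) / 4) ^ 3 \<le> norm (qint (Suc k) (unity_root N)) ^ 3" by (intro power_mono) auto
    moreover have "norm (unity_root N) = 1"
      using norm_exp_i_times[of "2 * pi / real N"] by (simp add: unity_root_def mult_ac)
    then have "norm (f k N) = 1 / norm (qint (Suc k) (unity_root N)) ^ 3"
      using True by (simp add: f_def norm_divide norm_mult norm_power)
    moreover have "(0::real) < (real (Suc k) / 4) ^ 3" by simp
    ultimately have "norm (f k N) \<le> 1 / (real (Suc k) / 4) ^ 3" by (simp only: frac_le zero_le_one order_refl)
    then show ?thesis by (simp add: power_divide)
  qed (simp add: f_def)
  have "summable (\<lambda>n. 1 / real n ^ 3)" using inverse_power_summable[of 3, where ?'a = real] by (simp add: inverse_eq_divide)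
  then have "summable (\<lambda>n. 1 / real (Suc n) ^ 3)" by (subst summable_Suc_iff[of "\<lambda>n. 1 / real n ^ 3"])
  then have "summable (\<lambda>n. 64 * (1 / real (Suc n) ^ 3))" by (rule summable_mult)
  moreover have "\<forall>\<^sub>F (k, N) in at_top \<times>\<^sub>F at_top. norm (f k N) \<le> 64 * (1 / real (Suc k) ^ 3)"
    using bound by (intro always_eventually) blast
  ultimately have "((\<lambda>N. suminf (\<lambda>k. f k N)) \<longlongrightarrow> suminf b) at_top"
    using tannerys_theorem[of f b sequentially "\<lambda>k. 64 * (1 / real (Suc k) ^ 3)", OF lim] by simp
  also have "suminf b = of_real (3 / 4 * zeta 3)"
    unfolding b_def by (intro sums_unique[symmetric] sums_of_real alternating_zeta_3)
  also have "(\<lambda>N. suminf (\<lambda>k. f k N)) = EN"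
  proof
    fix N
    have "suminf (\<lambda>k. f k N) = (\<Sum>k<(N - 1) div 2. f k N)" by (rule suminf_finite) (auto simp: f_def)
    also have "\<dots> = EN N"
      unfolding EN_def Eq_def
      by (intro sum.reindex_bij_witness[of _ "\<lambda>n. n - 1" Suc]) (auto simp: f_def)
    finally show "suminf (\<lambda>k. f k N) = EN N" .
  qed
  finally show ?thesis .
qed

section \<open>The ring of families of residues\<close>

lemma reduced_family_carrier: "(\<lambda>p\<in>{p. prime p}. f p mod int p) \<in> carrier prod_Zp"
proof -
  have "f p mod int p \<in> {0..int p - 1}" if "prime p" for p using prime_gt_0_nat[OF that] by simp
  then show ?thesis unfolding prod_Zp_def residue_ring_def by simp
qed

text \<open>The family of differences has finite support, so it lies in the ideal and the cosets
  agree.\<close>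

lemma classA_eqI:
  assumes "finite {p. prime p \<and> f p mod int p \<noteq> g p mod int p}"
  shows "classA f = classA g"
proof -
  interpret cring prod_Zp by (rule cring_prod_Zp)
  interpret I: ideal sum_Zp prod_Zp by (rule ideal_sum_Zp)
  let ?F = "\<lambda>p\<in>{p. prime p}. f p mod int p" and ?G = "\<lambda>p\<in>{p. prime p}. g p mod int p"
  let ?h = "\<lambda>p\<in>{p. prime p}. (f p - g p) mod int p"
  have "{p. prime p \<and> ?h p \<noteq> \<zero>\<^bsub>residue_ring (int p)\<^esub>} \<subseteq> {p. prime p \<and> f p mod int p \<noteq> g p mod int p}"
  proof (intro subsetI CollectI; elim CollectE conjE; intro conjI)
    fix p assume "prime p" "?h p \<noteq> \<zero>\<^bsub>residue_ring (int p)\<^esub>"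
    then have "\<not> int p dvd f p - g p" by (simp add: residue_ring_def mod_eq_0_iff_dvd)
    then show "f p mod int p \<noteq> g p mod int p" by (simp add: mod_eq_dvd_iff)
  qed
  then have h: "?h \<in> sum_Zp"
    unfolding sum_Zp_def using reduced_family_carrier[of "\<lambda>p. f p - g p"] finite_subset[OF _ assms] by blast
  have "?h \<oplus>\<^bsub>prod_Zp\<^esub> ?G = ?F"
    by (auto simp: prod_Zp_def residue_ring_def fun_eq_iff mod_simps)
  moreover have "?h \<oplus>\<^bsub>prod_Zp\<^esub> ?G \<in> sum_Zp +>\<^bsub>prod_Zp\<^esub> ?G"
    by (rule a_rcosI[OF h I.a_subset reduced_family_carrier])
  ultimately have "?F \<in> sum_Zp +>\<^bsub>prod_Zp\<^esub> ?G" by simp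
  from I.a_repr_independence'[OF this reduced_family_carrier] show ?thesis by (simp add: classA_def)
qed

lemma classA_mult: "classA f \<otimes>\<^bsub>ringA\<^esub> classA g = classA (\<lambda>p. f p * g p)"
proof -
  interpret I: ideal sum_Zp prod_Zp by (rule ideal_sum_Zp)
  have "(\<lambda>p\<in>{p. prime p}. f p mod int p) \<otimes>\<^bsub>prod_Zp\<^esub> (\<lambda>p\<in>{p. prime p}. g p mod int p)
      = (\<lambda>p\<in>{p. prime p}. f p * g p mod int p)"
    by (auto simp: prod_Zp_def residue_ring_def fun_eq_iff mod_simps)
  then show ?thesis
    using I.rcoset_mult_add[OF reduced_family_carrier reduced_family_carrier]
    unfolding ringA_def FactRing_def classA_def by simp
qed

lemma classA_eq_large:
  assumes "\<And>p. prime p \<Longrightarrow> p \<ge> N \<Longrightarrow> f p mod int p = g p mod int p"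
  shows "classA f = classA g"
proof (rule classA_eqI)
  have "{p. prime p \<and> f p mod int p \<noteq> g p mod int p} \<subseteq> {..<N}" using assms by (auto simp: not_le[symmetric])
  then show "finite {p. prime p \<and> f p mod int p \<noteq> g p mod int p}" by (rule finite_subset) simp
qed

lemma scaleA_class_rat:
  assumes "\<And>p. prime p \<Longrightarrow> p \<ge> N \<Longrightarrow> p \<ge> 5 \<and> c \<in> Zloc p \<and> x p \<in> Zloc p \<and> padic.cg p 1 (c * x p) (y p)"
  shows "scaleA c (class_rat x) = class_rat y"
  unfolding scaleA_def class_rat_def classA_mult
proof (rule classA_eq_large)
  fix p assume p: "prime p" "p \<ge> N"
  then interpret padic p using assms by unfold_locales auto
  show "res_rat p c * res_rat p (x p) mod int p = res_rat p (y p) mod int p"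
    using assms[OF p] by (intro res_rat_mult) auto
qed

section \<open>Congruences for large primes and their classes\<close>

context padic begin

lemma cong_inI: "cg e x y \<Longrightarrow> y \<in> R \<Longrightarrow> cong_in R (P ^ e) x y"
  unfolding cong_in_def using cg_R[of e x y] by (auto simp: cg_def)

text \<open>An element congruent to a unit is a unit: clearing its denominator shows that its
  numerator is prime to p.\<close>

lemma cg_divide:
  assumes x: "cg 1 x y" and a: "cg 1 a (of_int m)" and m: "\<not> int p dvd m" and y: "y \<in> R"
  shows "cg 1 (x / a) (y / of_int m)"
proof -
  have aR: "a \<in> R" using cg_R[OF a R_of_int] .
  obtain k n :: int where kn: "a = of_int k / of_int n" "\<not> int p dvd n" using aR unfolding R_iff by blast
  have n: "n \<noteq> 0" and m0: "m \<noteq> 0" using kn m by auto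
  have "cg 1 (of_int n * a) (of_int n * of_int m)" by (intro cg_mult_left a) auto
  then have "cg 1 (of_int k) (of_int (n * m))" using n unfolding kn by simp
  from cg_of_int[OF this] have "int p dvd k \<longleftrightarrow> int p dvd n * m" by (rule cong_dvd_iff)
  then have k: "\<not> int p dvd k" using kn m prime_int_p by (simp add: prime_dvd_mult_iff)
  then have k0: "k \<noteq> 0" by auto
  have "1 / a = of_int n * (1 / of_int k)" using k0 n unfolding kn by simp
  then have inv: "1 / a \<in> R" using R_inverse_int[OF k] by (simp only: R_mult R_of_int)
  have "cg 1 (1 / of_int m * (1 / a * (of_int m * x))) (1 / of_int m * (1 / a * (a * y)))"
    using x by (intro cg_mult_left R_inverse_int m inv cg_mult cg_sym[OF a] y) auto
  moreover have "a \<noteq> 0" using k0 n unfolding kn by simp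
  ultimately show ?thesis using m0 by simp
qed

lemma not_dvd_numbers:
  assumes "p \<ge> 11"
  shows "\<not> p dvd 21" "\<not> p dvd 8" "\<not> p dvd 4" "\<not> p dvd 3"
proof -
  have 1: "\<not> p dvd 3" "\<not> p dvd 7" "\<not> p dvd 8" "\<not> p dvd 4" using assms by (auto dest!: dvd_imp_le)
  have "(21::nat) = 3 * 7" by simp
  then show "\<not> p dvd 21" using 1 prime_p by (metis prime_dvd_mult_iff)
qed (use assms in \<open>auto dest!: dvd_imp_le\<close>)

lemma bernoulli_p3_R: "bernoulli (p - 3) \<in> R"
  by (intro bernoulli_R) auto

lemma A_cong:
  assumes "solves_recurrence A" "A 0 = 1" "A 1 = 6"
  shows "cg 2 (A (p - 1)) (- 3 * P)"
  unfolding A_explicit[OF assms] by (rule tt_sum)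

lemma C_cong:
  assumes "solves_recurrence C" "C 0 = 0" "C 1 = 1" "p \<ge> 11"
  shows "cg 2 (C (p - 1)) (P * (- 2 / of_nat 21 * bernoulli (p - 3)))"
proof -
  have "cg 2 (of_nat 21 * C (p - 1)) (of_nat 21 * (P * (- 2 / of_nat 21 * bernoulli (p - 3))))"
    using Cterm_sum C_explicit[OF assms(1-3), of "p - 1"] by simp
  then show ?thesis by (rule cg_cancel_nat) (rule not_dvd_numbers(1)[OF assms(4)])
qed

lemma EN_cong: "cc (EN p) (of_rat (1 / 4 * bernoulli (p - 3)))"
  using p_ge_5 by (intro cc_trans[OF EN_cong_harmonic] cc_of_rat altharmonic_half R_mult bernoulli_p3_R)
    (use R_inverse_less[of 4] in auto)

lemma cg_2_factor: "cg 2 x (P * y) \<Longrightarrow> \<exists>z. x = P * z \<and> cg 1 z y"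
proof -
  assume "cg 2 x (P * y)"
  then obtain c where c: "c \<in> R" "x - P * y = P ^ 2 * c" unfolding cg_def by blast
  then show ?thesis by (intro exI[of _ "y + P * c"]) (auto simp: power2_eq_square algebra_simps intro!: cgI[of c])
qed

text \<open>Both values are p times a cofactor known modulo p, and that of \<open>A\<close> is
  congruent to the unit -3. The quotient is (-2/21) / (-3) = 2/63.\<close>

lemma quotient_cong:
  assumes A: "solves_recurrence A" "A 0 = 1" "A 1 = 6"
    and C: "solves_recurrence C" "C 0 = 0" "C 1 = 1" and p: "p \<ge> 11"
  shows "cg 1 (C (p - 1) / A (p - 1)) (2 / 63 * bernoulli (p - 3))"
proof -
  have "cg 2 (A (p - 1)) (P * of_int (- 3))" using A_cong[OF A] by (simp add: mult.commute)
  from cg_2_factor[OF this] obtain a where a: "A (p - 1) = P * a" "cg 1 a (of_int (- 3))" by blast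
  obtain c where c: "C (p - 1) = P * c" "cg 1 c (- 2 / of_nat 21 * bernoulli (p - 3))"
    using cg_2_factor[OF C_cong[OF C p]] by blast
  have n3: "\<not> int p dvd - 3" using not_dvd_numbers(4)[OF p] by (metis dvd_minus_iff int_dvd_int_iff of_nat_numeral)
  have "- 2 * (1 / of_nat 21) * bernoulli (p - 3) \<in> R"
    using R_inverse_nat[OF not_dvd_numbers(1)[OF p]] by (intro R_mult R_uminus bernoulli_p3_R) auto
  then have "cg 1 (c / a) (- 2 / of_nat 21 * bernoulli (p - 3) / of_int (- 3))"
    by (intro cg_divide c a n3) simp
  then show ?thesis using p_ge_5 unfolding a c by simp
qed

end

text \<open>63/8 times 2/63 is 1/4; all three classes in question are compared with that of B_(p-3)
  / 4.\<close>

lemma class_quotient: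
  assumes A: "solves_recurrence A" "A 0 = 1" "A 1 = 6"
    and C: "solves_recurrence C" "C 0 = 0" "C 1 = 1"
  shows "scaleA (63 / 8) (class_rat (\<lambda>p. C (p - 1) / A (p - 1))) = class_rat (\<lambda>p. 1 / 4 * bernoulli (p - 3))"
proof (rule scaleA_class_rat)
  fix p :: nat assume p: "prime p" "p \<ge> 11"
  then interpret padic p by unfold_locales auto
  have q: "cg 1 (C (p - 1) / A (p - 1)) (2 / 63 * bernoulli (p - 3))" by (rule quotient_cong[OF A C p(2)])
  have n63: "\<not> p dvd 63"
  proof -
    have "(63::nat) = 3 * 21" by simp
    then show ?thesis using not_dvd_numbers[OF p(2)] prime_p by (metis prime_dvd_mult_iff)
  qed
  have "2 * (1 / of_nat 63) * bernoulli (p - 3) \<in> R"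
    by (intro R_mult R_inverse_nat n63 bernoulli_p3_R) auto
  then have qR: "C (p - 1) / A (p - 1) \<in> R" by (intro cg_R[OF q]) simp
  have c: "63 / 8 \<in> R" using R_divide[of 63 8] not_dvd_numbers[OF p(2)] by simp
  from cg_mult_left[OF c q] have "cg 1 (63 / 8 * (C (p - 1) / A (p - 1))) (1 / 4 * bernoulli (p - 3))" by simp
  with qR c p_ge_5 show "p \<ge> 5 \<and> 63 / 8 \<in> R \<and> C (p - 1) / A (p - 1) \<in> R \<and> cg 1 (63 / 8 * (C (p - 1) / A (p - 1))) (1 / 4 * bernoulli (p - 3))"
    by blast
qed

lemma class_Z3: "scaleA (3 / 4) Z3 = class_rat (\<lambda>p. 1 / 4 * bernoulli (p - 3))"
  unfolding Z3_def
proof (rule scaleA_class_rat)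
  fix p :: nat assume p: "prime p" "p \<ge> 11"
  then interpret padic p by unfold_locales auto
  have "3 / 4 \<in> R" "bernoulli (p - 3) / 3 \<in> R"
    using R_divide[of 3 4] R_divide[OF bernoulli_p3_R, of 3] not_dvd_numbers[OF p(2)] by simp_all
  then show "p \<ge> 5 \<and> 3 / 4 \<in> R \<and> bernoulli (p - 3) / 3 \<in> R \<and> cg 1 (3 / 4 * (bernoulli (p - 3) / 3)) (1 / 4 * bernoulli (p - 3))"
    using p_ge_5 by simp
qed

lemma class_EN: "classA (\<lambda>p. res_cyc p (EN p)) = class_rat (\<lambda>p. 1 / 4 * bernoulli (p - 3))"
  unfolding class_rat_def
proof (rule classA_eq_large)
  fix p :: nat assume p: "prime p" "p \<ge> 11"
  then interpret padic p by unfold_locales auto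
  have "1 / of_nat 4 * bernoulli (p - 3) \<in> R"
    using not_dvd_numbers[OF p(2)] by (intro R_mult R_inverse_nat bernoulli_p3_R)
  then show "res_cyc p (EN p) mod int p = res_rat p (1 / 4 * bernoulli (p - 3)) mod int p"
    using res_cyc_of_rat[OF EN_cong] by simp
qed

theorem mainTheorem1:
  fixes A C :: "nat \<Rightarrow> rat"
  assumes "solves_recurrence A" and "A 0 = 1" and "A 1 = 6"
    and "solves_recurrence C" and "C 0 = 0" and "C 1 = 1"
  shows
    "(\<forall>p. prime p \<and> p \<ge> 11 \<longrightarrow>
        cong_in (Zloc p) (of_nat p ^ 2) (A (p - 1)) (- 3 * of_nat p)
      \<and> cong_in (Zloc p) (of_nat p ^ 2) (C (p - 1)) (- (2 * of_nat p / 21) * bernoulli (p - 3))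
      \<and> cong_in (cycloc p) (1 - unity_root p) (EN p) (of_rat (1 / 4 * bernoulli (p - 3))))
    \<and> classA (\<lambda>p. res_cyc p (EN p)) = scaleA (63 / 8) (class_rat (\<lambda>p. C (p - 1) / A (p - 1)))
    \<and> scaleA (63 / 8) (class_rat (\<lambda>p. C (p - 1) / A (p - 1))) = scaleA (3 / 4) Z3
    \<and> (EN \<longlongrightarrow> of_real (3 / 4 * zeta 3)) (inf at_top (principal {N. odd N}))"
proof (intro conjI allI impI; (elim conjE)?)
  fix p :: nat assume "prime p" "p \<ge> 11"
  then interpret padic p by unfold_locales auto
  show "cong_in R (P ^ 2) (A (p - 1)) (- 3 * P)"
    by (intro cong_inI A_cong assms(1-3) R_mult R_uminus R_numbers)
  have 1: "- (2 * P / 21) * bernoulli (p - 3) = P * (- 2 / of_nat 21 * bernoulli (p - 3))" by simp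
  have "P * (- 2 * (1 / of_nat 21) * bernoulli (p - 3)) \<in> R"
    by (intro R_mult R_uminus R_numbers R_inverse_nat not_dvd_numbers(1) bernoulli_p3_R \<open>p \<ge> 11\<close>)
  then show "cong_in R (P ^ 2) (C (p - 1)) (- (2 * P / 21) * bernoulli (p - 3))"
    unfolding 1 by (intro cong_inI C_cong assms(4-6) \<open>p \<ge> 11\<close>) simp
  show "cong_in Q (1 - q) (EN p) (of_rat (1 / 4 * bernoulli (p - 3)))" by (rule EN_cong)
next
  show "classA (\<lambda>p. res_cyc p (EN p)) = scaleA (63 / 8) (class_rat (\<lambda>p. C (p - 1) / A (p - 1)))"
    "scaleA (63 / 8) (class_rat (\<lambda>p. C (p - 1) / A (p - 1))) = scaleA (3 / 4) Z3"
    unfolding class_quotient[OF assms] class_EN class_Z3 by (rule refl)+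
  show "(EN \<longlongrightarrow> of_real (3 / 4 * zeta 3)) (inf at_top (principal {N. odd N}))"
    by (rule tendsto_mono[OF inf_le1 EN_tendsto])
qed

end
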